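(* Let $\pi:SU_q(2)\to C=SU_q(2)/J$ be the coalgebra projection associated with the quantum sphere $S^2_{q,s}$, $s\in[0,1]$, and let $\{\pi(1),g^\pm_n\mid n=1,2,\dots\}$ be the basis of group-like elements of $C$. The linear map $i:C\to SU_q(2)$ given by $i(\pi(1))=1$ and $$i(g^+_n)=\prod_{k=0}^{n-1}\frac{\alpha+q^ks(\beta+\gamma)+q^{2k}s^2\delta}{1+q^{2k}s^2},\qquad i(g^-_n)=\prod_{k=0}^{n-1}\frac{\delta-q^{-k}s(\beta+\gamma)+q^{-2k}s^2\alpha}{1+q^{-2k}s^2}$$ is bicovariant and splits $\pi$; that is, $\pi\circ i=\mathrm{id}_C$, $(\mathrm{id}\otimes\pi)\Delta(i(c))=i(c_{(1)})\otimes c_{(2)}$ and $(\pi\otimes\mathrm{id})\Delta(i(c))=c_{(1)}\otimes i(c_{(2)})$ for all $c\in C$.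
   Context: $k=\mathbb{C}$, $q$ is a nonzero real parameter. $SU_q(2)$ denotes the Hopf algebra generated by $\alpha,\beta,\gamma,\delta$ with relations $\alpha\beta=q\beta\alpha$, $\alpha\gamma=q\gamma\alpha$, $\alpha\delta=\delta\alpha+(q-q^{-1})\beta\gamma$, $\beta\gamma=\gamma\beta$, $\beta\delta=q\delta\beta$, $\gamma\delta=q\delta\gamma$, $\alpha\delta-q\beta\gamma=1$, with matrix coproduct $\Delta\alpha=\alpha\otimes\alpha+\beta\otimes\gamma$, $\Delta\beta=\alpha\otimes\beta+\beta\otimes\delta$, $\Delta\gamma=\gamma\otimes\alpha+\delta\otimes\gamma$, $\Delta\delta=\gamma\otimes\beta+\delta\otimes\delta$ and counit $\epsilon(\alpha)=\epsilon(\delta)=1$, $\epsilon(\beta)=\epsilon(\gamma)=0$. For $s\in[0,1]$ put $\xi=s(\alpha^2-q^{-1}\beta^2)+(s^2-1)q^{-1}\alpha\beta$, $\eta=s(q\gamma^2-\delta^2)+(s^2-1)\gamma\delta$, $\zeta=s(q\alpha\gamma-\beta\delta)+(s^2-1)q\beta\gamma$. Let $J=\{\xi-s,\eta+s,\zeta\}SU_q(2)$ be the right ideal (it is a coideal) generated by these elements, $C=SU_q(2)/J$ the quotient coalgebra, $\pi$ the canonical projection. Set $g^+_n=\pi\big(\prod_{k=0}^{n-1}(\alpha+q^ks\beta)\big)$, $g^-_n=\pi\big(\prod_{k=0}^{n-1}(\delta-q^{-k}s\gamma)\big)$, $n=1,2,\dots$; these are group-like and together with $\pi(1)$ form a basis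 of $C$. In all products $\prod_{k=0}^{n-1}$ the index increases from left to right. *)

theory Defs
  imports Complex_Main "HOL-Library.Poly_Mapping" "HOL-Algebra.QuotRing" "HOL-Algebra.Module"
begin

section \<open>Complex vector spaces and algebras with explicit carriers\<close>

text \<open>
  Everything below depends on real parameters \<open>q\<close> and \<open>s\<close>, so it is carried by
  sets rather than by types.  The record type \<open>(complex, 'a) module\<close> of HOL-Algebra
  serves both as complex algebras and as mere complex vector spaces; in the second case the
  fields \<open>mult\<close> and \<open>one\<close> carry no information and are never used.
\<close>

definition complex_ring :: "complex ring" where
  "complex_ring = \<lparr>carrier = UNIV, mult = (*), one = 1, zero = 0, add = (+)\<rparr>"

definition linear_maps ::
    "(complex, 'a) module \<Rightarrow> (complex, 'b) module \<Rightarrow> ('a \<Rightarrow> 'b) set" where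
  "linear_maps V W = {f \<in> carrier V \<rightarrow> carrier W.
     (\<forall>x\<in>carrier V. \<forall>y\<in>carrier V. f (x \<oplus>\<^bsub>V\<^esub> y) = f x \<oplus>\<^bsub>W\<^esub> f y) \<and>
     (\<forall>c. \<forall>x\<in>carrier V. f (c \<odot>\<^bsub>V\<^esub> x) = c \<odot>\<^bsub>W\<^esub> f x)}"

definition subspace_gen :: "(complex, 'a) module \<Rightarrow> 'a set \<Rightarrow> 'a set" where
  "subspace_gen V S = \<Inter>{N. submodule N complex_ring V \<and> S \<subseteq> N}"

text \<open>Right ideals are additively closed only; in the unital complex algebras below they are
  automatically complex subspaces.\<close>

definition right_ideal_gen :: "('a, 'm) ring_scheme \<Rightarrow> 'a set \<Rightarrow> 'a set" where
  "right_ideal_gen R S = \<Inter>{N. additive_subgroup N R \<and>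
     (\<forall>x\<in>N. \<forall>r\<in>carrier R. x \<otimes>\<^bsub>R\<^esub> r \<in> N) \<and> S \<subseteq> N}"

text \<open>
  The quotient of \<open>M\<close> by a subspace \<open>N\<close>, consisting of additive cosets.  The product
  inherited from \<^const>\<open>FactRing\<close> is meaningful only if \<open>M\<close> is an algebra and
  \<open>N\<close> a two-sided ideal; otherwise the result is to be read as a vector space.
\<close>

definition quot_module :: "(complex, 'a) module \<Rightarrow> 'a set \<Rightarrow> (complex, 'a set) module" where
  "quot_module M N = ring.extend (M Quot N)
     (module.fields (\<lambda>c X. \<Union>x\<in>X. N +>\<^bsub>M\<^esub> (c \<odot>\<^bsub>M\<^esub> x)))"

definition pm_scale :: "complex \<Rightarrow> ('x \<Rightarrow>\<^sub>0 complex) \<Rightarrow> ('x \<Rightarrow>\<^sub>0 complex)" where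
  "pm_scale c p = Poly_Mapping.map (\<lambda>z. c * z) p"

text \<open>The vector space with basis \<open>S\<close>, and the linear extension of a map on the basis.\<close>

definition free_module :: "'x set \<Rightarrow> (complex, 'x \<Rightarrow>\<^sub>0 complex) module" where
  "free_module S = \<lparr>carrier = {p. Poly_Mapping.keys p \<subseteq> S}, mult = undefined, one = undefined,
     zero = 0, add = (+), smult = pm_scale\<rparr>"

definition lin_ext :: "(complex, 'u) module \<Rightarrow> ('x \<Rightarrow> 'u) \<Rightarrow> ('x \<Rightarrow>\<^sub>0 complex) \<Rightarrow> 'u" where
  "lin_ext U f p = (\<Oplus>\<^bsub>U\<^esub>x\<in>Poly_Mapping.keys p. Poly_Mapping.lookup p x \<odot>\<^bsub>U\<^esub> f x)"


section \<open>Tensor products\<close>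

definition tensor_rels ::
    "(complex, 'v) module \<Rightarrow> (complex, 'w) module \<Rightarrow> ('v \<times> 'w \<Rightarrow>\<^sub>0 complex) set" where
  "tensor_rels V W =
     {Poly_Mapping.single (v \<oplus>\<^bsub>V\<^esub> v', w) 1 - Poly_Mapping.single (v, w) 1
        - Poly_Mapping.single (v', w) 1 |v v' w.
        v \<in> carrier V \<and> v' \<in> carrier V \<and> w \<in> carrier W} \<union>
     {Poly_Mapping.single (v, w \<oplus>\<^bsub>W\<^esub> w') 1 - Poly_Mapping.single (v, w) 1
        - Poly_Mapping.single (v, w') 1 |v w w'.
        v \<in> carrier V \<and> w \<in> carrier W \<and> w' \<in> carrier W} \<union>
     {Poly_Mapping.single (c \<odot>\<^bsub>V\<^esub> v, w) 1 - Poly_Mapping.single (v, w) c |c v w.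
        v \<in> carrier V \<and> w \<in> carrier W} \<union>
     {Poly_Mapping.single (v, c \<odot>\<^bsub>W\<^esub> w) 1 - Poly_Mapping.single (v, w) c |c v w.
        v \<in> carrier V \<and> w \<in> carrier W}"

definition tensor_null ::
    "(complex, 'v) module \<Rightarrow> (complex, 'w) module \<Rightarrow> ('v \<times> 'w \<Rightarrow>\<^sub>0 complex) set" where
  "tensor_null V W =
     subspace_gen (free_module (carrier V \<times> carrier W)) (tensor_rels V W)"

definition tensor ::
    "(complex, 'v) module \<Rightarrow> (complex, 'w) module \<Rightarrow> (complex, ('v \<times> 'w \<Rightarrow>\<^sub>0 complex) set) module"
  where
  "tensor V W = quot_module (free_module (carrier V \<times> carrier W)) (tensor_null V W)"

definition pure_tensor ::
    "(complex, 'v) module \<Rightarrow> (complex, 'w) module \<Rightarrow> 'v \<Rightarrow> 'w \<Rightarrow> ('v \<times> 'w \<Rightarrow>\<^sub>0 complex) set" where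
  "pure_tensor V W v w =
     tensor_null V W +>\<^bsub>free_module (carrier V \<times> carrier W)\<^esub> Poly_Mapping.single (v, w) 1"

text \<open>
  The linear map out of a tensor product induced by a bilinear map \<open>b\<close>.  As usual for maps
  out of a quotient in HOL-Algebra, \<^const>\<open>the_elem\<close> extracts the common value on all
  representatives.
\<close>

definition tensor_lift ::
    "(complex, 'u) module \<Rightarrow> ('v \<Rightarrow> 'w \<Rightarrow> 'u) \<Rightarrow> ('v \<times> 'w \<Rightarrow>\<^sub>0 complex) set \<Rightarrow> 'u" where
  "tensor_lift U b X = the_elem (lin_ext U (\<lambda>(v, w). b v w) ` X)"

text \<open>The map \<open>f \<otimes> g\<close> with codomain \<open>V' \<otimes> W'\<close>.\<close>

definition tensor_map ::
    "(complex, 'v2) module \<Rightarrow> (complex, 'w2) module \<Rightarrow> ('v \<Rightarrow> 'v2) \<Rightarrow> ('w \<Rightarrow> 'w2) \<Rightarrow>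
     ('v \<times> 'w \<Rightarrow>\<^sub>0 complex) set \<Rightarrow> ('v2 \<times> 'w2 \<Rightarrow>\<^sub>0 complex) set" where
  "tensor_map V' W' f g =
     tensor_lift (tensor V' W') (\<lambda>v w. pure_tensor V' W' (f v) (g w))"

definition tensor_alg ::
    "(complex, 'v) module \<Rightarrow> (complex, 'w) module \<Rightarrow> (complex, ('v \<times> 'w \<Rightarrow>\<^sub>0 complex) set) module"
  where
  "tensor_alg A B = (tensor A B)
     \<lparr>mult := (\<lambda>X Y. tensor_lift (tensor A B) (\<lambda>a b. tensor_lift (tensor A B)
                (\<lambda>a' b'. pure_tensor A B (a \<otimes>\<^bsub>A\<^esub> a') (b \<otimes>\<^bsub>B\<^esub> b')) Y) X),
      one := pure_tensor A B \<one>\<^bsub>A\<^esub> \<one>\<^bsub>B\<^esub>\<rparr>"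


section \<open>The free algebra on four generators\<close>

datatype gen = Gen_alpha | Gen_beta | Gen_gamma | Gen_delta

text \<open>
  Words form the free monoid.  It is written additively because the convolution product on
  \<^typ>\<open>'x \<Rightarrow>\<^sub>0 complex\<close> is taken over an additive (not necessarily commutative) monoid;
  thus \<open>'g word \<Rightarrow>\<^sub>0 complex\<close> is the free unital complex algebra on \<open>'g\<close>.
\<close>

datatype 'g word = Word (letters: "'g list")

instantiation word :: (type) monoid_add
begin
definition zero_word :: "'a word" where "zero_word = Word []"
definition plus_word :: "'a word \<Rightarrow> 'a word \<Rightarrow> 'a word" where
  "plus_word u v = Word (letters u @ letters v)"
instance
  by standard (simp_all add: zero_word_def plus_word_def)
end

type_synonym free = "gen word \<Rightarrow>\<^sub>0 complex"

definition free_alg :: "(complex, free) module" where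
  "free_alg = \<lparr>carrier = UNIV, mult = (*), one = 1, zero = 0, add = (+), smult = pm_scale\<rparr>"

abbreviation generator :: "gen \<Rightarrow> free" where
  "generator x \<equiv> Poly_Mapping.single (Word [x]) 1"

abbreviation gen_alpha (\<open>\<alpha>\<close>) where "\<alpha> \<equiv> generator Gen_alpha"
abbreviation gen_beta (\<open>\<beta>\<close>) where "\<beta> \<equiv> generator Gen_beta"
abbreviation gen_gamma (\<open>\<gamma>\<close>) where "\<gamma> \<equiv> generator Gen_gamma"
abbreviation gen_delta (\<open>\<delta>\<close>) where "\<delta> \<equiv> generator Gen_delta"

abbreviation rscale :: "real \<Rightarrow> free \<Rightarrow> free" (infixr \<open>\<cdot>\<close> 75) where
  "r \<cdot> p \<equiv> pm_scale (complex_of_real r) p"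

text \<open>The algebra homomorphism from the free algebra with prescribed values on generators.\<close>

definition alg_ext :: "(complex, 'b) module \<Rightarrow> (gen \<Rightarrow> 'b) \<Rightarrow> free \<Rightarrow> 'b" where
  "alg_ext B f =
     lin_ext B (\<lambda>w. foldr (\<lambda>x b. f x \<otimes>\<^bsub>B\<^esub> b) (letters w) \<one>\<^bsub>B\<^esub>)"


section \<open>The quantum group\<close>

definition SUq2_rels :: "real \<Rightarrow> free set" where
  "SUq2_rels q =
     {\<alpha> * \<beta> - q \<cdot> (\<beta> * \<alpha>),
      \<alpha> * \<gamma> - q \<cdot> (\<gamma> * \<alpha>),
      \<alpha> * \<delta> - (\<delta> * \<alpha> + (q - inverse q) \<cdot> (\<beta> * \<gamma>)),
      \<beta> * \<gamma> - \<gamma> * \<beta>,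
      \<beta> * \<delta> - q \<cdot> (\<delta> * \<beta>),
      \<gamma> * \<delta> - q \<cdot> (\<delta> * \<gamma>),
      \<alpha> * \<delta> - q \<cdot> (\<beta> * \<gamma>) - 1}"

definition SUq2_ideal :: "real \<Rightarrow> free set" where
  "SUq2_ideal q = genideal free_alg (SUq2_rels q)"

definition SUq2 :: "real \<Rightarrow> (complex, free set) module" where
  "SUq2 q = quot_module free_alg (SUq2_ideal q)"

text \<open>The element of the quantum group given by a noncommutative polynomial in the generators.\<close>

definition cls :: "real \<Rightarrow> free \<Rightarrow> free set" where
  "cls q p = SUq2_ideal q +>\<^bsub>free_alg\<^esub> p"

fun comult_gen :: "real \<Rightarrow> gen \<Rightarrow> (free set \<times> free set \<Rightarrow>\<^sub>0 complex) set" where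
  "comult_gen q Gen_alpha =
     pure_tensor (SUq2 q) (SUq2 q) (cls q \<alpha>) (cls q \<alpha>) \<oplus>\<^bsub>tensor (SUq2 q) (SUq2 q)\<^esub>
     pure_tensor (SUq2 q) (SUq2 q) (cls q \<beta>) (cls q \<gamma>)"
| "comult_gen q Gen_beta =
     pure_tensor (SUq2 q) (SUq2 q) (cls q \<alpha>) (cls q \<beta>) \<oplus>\<^bsub>tensor (SUq2 q) (SUq2 q)\<^esub>
     pure_tensor (SUq2 q) (SUq2 q) (cls q \<beta>) (cls q \<delta>)"
| "comult_gen q Gen_gamma =
     pure_tensor (SUq2 q) (SUq2 q) (cls q \<gamma>) (cls q \<alpha>) \<oplus>\<^bsub>tensor (SUq2 q) (SUq2 q)\<^esub>
     pure_tensor (SUq2 q) (SUq2 q) (cls q \<delta>) (cls q \<gamma>)"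
| "comult_gen q Gen_delta =
     pure_tensor (SUq2 q) (SUq2 q) (cls q \<gamma>) (cls q \<beta>) \<oplus>\<^bsub>tensor (SUq2 q) (SUq2 q)\<^esub>
     pure_tensor (SUq2 q) (SUq2 q) (cls q \<delta>) (cls q \<delta>)"

definition comult :: "real \<Rightarrow> free set \<Rightarrow> (free set \<times> free set \<Rightarrow>\<^sub>0 complex) set" where
  "comult q a = the_elem (alg_ext (tensor_alg (SUq2 q) (SUq2 q)) (comult_gen q) ` a)"


section \<open>The quotient coalgebra of the quantum sphere\<close>

definition xi :: "real \<Rightarrow> real \<Rightarrow> free" where
  "xi q s = s \<cdot> (\<alpha> * \<alpha> - inverse q \<cdot> (\<beta> * \<beta>)) + ((s\<^sup>2 - 1) * inverse q) \<cdot> (\<alpha> * \<beta>)"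

definition eta :: "real \<Rightarrow> real \<Rightarrow> free" where
  "eta q s = s \<cdot> (q \<cdot> (\<gamma> * \<gamma>) - \<delta> * \<delta>) + (s\<^sup>2 - 1) \<cdot> (\<gamma> * \<delta>)"

definition zeta :: "real \<Rightarrow> real \<Rightarrow> free" where
  "zeta q s = s \<cdot> (q \<cdot> (\<alpha> * \<gamma>) - \<beta> * \<delta>) + ((s\<^sup>2 - 1) * q) \<cdot> (\<beta> * \<gamma>)"

definition sphere_J :: "real \<Rightarrow> real \<Rightarrow> free set set" where
  "sphere_J q s = right_ideal_gen (SUq2 q)
     {cls q (xi q s - s \<cdot> 1), cls q (eta q s + s \<cdot> 1), cls q (zeta q s)}"

definition sphere_C :: "real \<Rightarrow> real \<Rightarrow> (complex, free set set) module" where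
  "sphere_C q s = quot_module (SUq2 q) (sphere_J q s)"

definition proj :: "real \<Rightarrow> real \<Rightarrow> free set \<Rightarrow> free set set" where
  "proj q s a = sphere_J q s +>\<^bsub>SUq2 q\<^esub> a"

text \<open>The coproduct of the quotient: the common value of \<open>(\<pi> \<otimes> \<pi>) \<circ> \<Delta>\<close>
  on all representatives.\<close>

definition comult_C ::
    "real \<Rightarrow> real \<Rightarrow> free set set \<Rightarrow> (free set set \<times> free set set \<Rightarrow>\<^sub>0 complex) set" where
  "comult_C q s c = the_elem
     ((\<lambda>a. tensor_map (sphere_C q s) (sphere_C q s) (proj q s) (proj q s) (comult q a)) ` c)"

text \<open>In the noncommutative products, the index increases from left to right.\<close>

definition g_plus :: "real \<Rightarrow> real \<Rightarrow> nat \<Rightarrow> free set set" where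
  "g_plus q s n = proj q s (cls q (\<Prod>k\<leftarrow>[0..<n]. \<alpha> + (q ^ k * s) \<cdot> \<beta>))"

definition g_minus :: "real \<Rightarrow> real \<Rightarrow> nat \<Rightarrow> free set set" where
  "g_minus q s n = proj q s (cls q (\<Prod>k\<leftarrow>[0..<n]. \<delta> - (inverse q ^ k * s) \<cdot> \<gamma>))"

definition i_plus :: "real \<Rightarrow> real \<Rightarrow> nat \<Rightarrow> free set" where
  "i_plus q s n = cls q (\<Prod>k\<leftarrow>[0..<n]. (1 / (1 + q ^ (2 * k) * s\<^sup>2)) \<cdot>
     (\<alpha> + (q ^ k * s) \<cdot> (\<beta> + \<gamma>) + (q ^ (2 * k) * s\<^sup>2) \<cdot> \<delta>))"

definition i_minus :: "real \<Rightarrow> real \<Rightarrow> nat \<Rightarrow> free set" where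
  "i_minus q s n = cls q (\<Prod>k\<leftarrow>[0..<n]. (1 / (1 + inverse q ^ (2 * k) * s\<^sup>2)) \<cdot>
     (\<delta> - (inverse q ^ k * s) \<cdot> (\<beta> + \<gamma>) + (inverse q ^ (2 * k) * s\<^sup>2) \<cdot> \<alpha>))"

definition is_splitting_map :: "real \<Rightarrow> real \<Rightarrow> (free set set \<Rightarrow> free set) \<Rightarrow> bool" where
  "is_splitting_map q s i \<longleftrightarrow>
     i \<in> linear_maps (sphere_C q s) (SUq2 q) \<and>
     i (proj q s \<one>\<^bsub>SUq2 q\<^esub>) = \<one>\<^bsub>SUq2 q\<^esub> \<and>
     (\<forall>n\<ge>1. i (g_plus q s n) = i_plus q s n \<and> i (g_minus q s n) = i_minus q s n)"

end

theory Submission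
  imports Defs
begin

text \<open>
  Write \<open>A\<close> for the quantum group and \<open>t = q\<^sup>n s\<close>, and set
  \<open>g\<^sub>0 = \<pi>(1)\<close>, \<open>g\<^sub>n = g\<^sup>+\<^sub>n\<close>, \<open>g\<^sub>-\<^sub>n = g\<^sup>-\<^sub>n\<close>.  Since \<open>J\<close> is a right ideal, \<open>C = A/J\<close> is a right
  \<open>A\<close>-module, and everything follows from one formula for this module:
  for every generator \<open>x\<close> and every integer \<open>n\<close>,
  \<open>g\<^sub>n x = u\<^sub>x(t) g\<^sub>n\<^sub>+\<^sub>1 + d\<^sub>x(t) g\<^sub>n\<^sub>-\<^sub>1\<close>.
  When the generators are arranged as a 2-by-2 matrix, \<open>u(t)\<close> is the orthogonal projection
  of the plane onto the line through \<open>(1, t)\<close>, and \<open>d(t)\<close> is the complementary projection.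

  The formula holds in \<open>C\<close> (\<open>pi_generator\<close>).  It amounts to four congruences for right multiples of
  \<open>g\<^sub>n\<close>: two of them, \<open>g\<^sub>n \<beta> = g\<^sub>n \<gamma>\<close> and
  \<open>g\<^sub>n (t \<delta> - t \<alpha> + (1 - t\<^sup>2) \<beta>) = 0\<close>, say that the matrix of generators acts like a symmetric matrix
  with eigenvector \<open>(1, t)\<close>; the others identify \<open>g\<^sub>n (\<alpha> + t \<beta>)\<close> with \<open>g\<^sub>n\<^sub>+\<^sub>1\<close> and
  \<open>g\<^sub>n (\<delta> - t \<gamma>)\<close> with \<open>g\<^sub>n\<^sub>-\<^sub>1\<close>.  At \<open>n = 0\<close> the first two are extracted from the generators of \<open>J\<close>.
  Multiplication by \<open>\<alpha> + t \<beta>\<close> carries them from \<open>t\<close> to \<open>q t\<close>, multiplication by \<open>\<delta> - t \<gamma>\<close>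
  carries them from \<open>t\<close> to \<open>t / q\<close>, and the two moves are inverse to each other modulo \<open>J\<close>; so an
  induction in both directions reaches all \<open>n\<close>.

  Conversely, the same formula defines a right action of \<open>A\<close> on the space with basis
  \<open>(e\<^sub>n)\<close>, \<open>n\<close> an integer (\<open>Phi_rels\<close>), and \<open>e\<^sub>0\<close> is annihilated by the generators
  of \<open>J\<close> (\<open>invariants\<close>).  Acting on \<open>e\<^sub>0\<close> thus gives a map \<open>\<theta>\<close> out of \<open>C\<close> with
  \<open>\<theta>(g\<^sub>n) = e\<^sub>n\<close>, whose inverse sends \<open>e\<^sub>n\<close> to \<open>g\<^sub>n\<close> (\<open>Gamma_theta\<close>).  Therefore a linear map on \<open>C\<close>
  may be prescribed arbitrarily on the \<open>g\<^sub>n\<close> (\<open>C_lift\<close>) and is determined by these values (\<open>C_ext\<close>),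
  which gives existence and uniqueness of \<open>i\<close> and reduces every identity on \<open>C\<close> to the case
  \<open>c = g\<^sub>n\<close>.

  The coproduct of a generator is a matrix product.  Hence, for right module maps \<open>p\<close> and \<open>p'\<close>,
  passing from \<open>(p \<otimes> p') \<Delta>(y)\<close> to \<open>(p \<otimes> p') \<Delta>(y x\<^sub>i\<^sub>j)\<close> means acting with
  \<open>\<Sum>\<^sub>k x\<^sub>i\<^sub>k \<otimes> x\<^sub>k\<^sub>j\<close> (\<open>comult_step\<close>).  As \<open>u(t)\<close> and \<open>d(t)\<close> are idempotent and orthogonal,
  this sends \<open>g\<^sub>n \<otimes> g\<^sub>n\<close> to
  \<open>u\<^sub>x(t) g\<^sub>n\<^sub>+\<^sub>1 \<otimes> g\<^sub>n\<^sub>+\<^sub>1 + d\<^sub>x(t) g\<^sub>n\<^sub>-\<^sub>1 \<otimes> g\<^sub>n\<^sub>-\<^sub>1\<close>; so \<open>(\<pi> \<otimes> \<pi>) \<Delta>\<close> factors through \<open>\<pi>\<close> and the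
  \<open>g\<^sub>n\<close> are group-like (\<open>proj2_Delta\<close>).  Finally \<open>i(g\<^sub>n\<^sub>+\<^sub>1) = i(g\<^sub>n) \<Sum>\<^sub>x u\<^sub>x(t) x\<close> for \<open>n \<ge> 0\<close>, similarly with
  \<open>d(t)\<close> for \<open>n \<le> 0\<close>, and the same idempotency gives the splitting property and both
  covariance properties by induction on \<open>n\<close> (\<open>pi_H\<close>, \<open>right_covariant\<close>, \<open>left_covariant\<close>).
\<close>

section \<open>Vector spaces with explicit carriers\<close>

lemma complex_ring_simps [simp]:
  "carrier complex_ring = UNIV" "mult complex_ring = (*)" "one complex_ring = 1"
  "zero complex_ring = 0" "add complex_ring = (+)"
  by (simp_all add: complex_ring_def)

lemma cring_complex_ring: "cring complex_ring"
proof (rule cringI)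
  show "abelian_group complex_ring"
    by (rule abelian_groupI) (auto intro: exI[of _ "- x" for x] simp: add_eq_0_iff2)
  show "Group.comm_monoid complex_ring"
    by (rule comm_monoidI) (auto simp: mult_ac)
qed (auto simp: algebra_simps)

locale cspace =
  fixes V :: "(complex, 'a) module" (structure)
  assumes is_module: "module complex_ring V"

sublocale cspace \<subseteq> module complex_ring V
  by (rule is_module)

context cspace
begin

lemma scale_closed [simp, intro]: "x \<in> carrier V \<Longrightarrow> c \<odot> x \<in> carrier V"
  by (rule smult_closed) auto

lemma scale_left_distrib: "x \<in> carrier V \<Longrightarrow> (a + b) \<odot> x = a \<odot> x \<oplus> b \<odot> x"
  using smult_l_distr[of a b x] by simp

lemma scale_right_distrib:
  "\<lbrakk>x \<in> carrier V; y \<in> carrier V\<rbrakk> \<Longrightarrow> a \<odot> (x \<oplus> y) = a \<odot> x \<oplus> a \<odot> y"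
  using smult_r_distr[of a x y] by simp

lemma scale_scale [simp]: "x \<in> carrier V \<Longrightarrow> a \<odot> (b \<odot> x) = (a * b) \<odot> x"
  using smult_assoc1[of a b x] by simp

lemma scale_one [simp]: "x \<in> carrier V \<Longrightarrow> 1 \<odot> x = x"
  using smult_one[of x] by simp

lemma scale_zero_left [simp]: "x \<in> carrier V \<Longrightarrow> 0 \<odot> x = \<zero>"
  using smult_l_null[of x] by simp

lemma minus_eq_scale: "x \<in> carrier V \<Longrightarrow> \<ominus> x = (- 1) \<odot> x"
proof -
  assume x: "x \<in> carrier V"
  have "x \<oplus> (- 1) \<odot> x = \<zero>"
    using scale_left_distrib[of x 1 "-1"] x by simp
  then show ?thesis
    using x by (metis minus_equality a_comm scale_closed)
qed

lemma subspaceI: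
  assumes "H \<subseteq> carrier V" "\<zero> \<in> H" "\<And>a b. \<lbrakk>a \<in> H; b \<in> H\<rbrakk> \<Longrightarrow> a \<oplus> b \<in> H"
    "\<And>c x. x \<in> H \<Longrightarrow> c \<odot> x \<in> H"
  shows "submodule H complex_ring V"
  using assms by (intro submoduleI) (auto simp: minus_eq_scale subset_iff)

end

lemma cspaceI:
  fixes V (structure)
  assumes "abelian_group V"
    and "\<And>a x. x \<in> carrier V \<Longrightarrow> a \<odot> x \<in> carrier V"
    and "\<And>a b x. x \<in> carrier V \<Longrightarrow> (a + b) \<odot> x = a \<odot> x \<oplus> b \<odot> x"
    and "\<And>a x y. \<lbrakk>x \<in> carrier V; y \<in> carrier V\<rbrakk> \<Longrightarrow> a \<odot> (x \<oplus> y) = a \<odot> x \<oplus> a \<odot> y"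
    and "\<And>a b x. x \<in> carrier V \<Longrightarrow> (a * b) \<odot> x = a \<odot> (b \<odot> x)"
    and "\<And>x. x \<in> carrier V \<Longrightarrow> 1 \<odot> x = x"
  shows "cspace V"
  unfolding cspace_def
  by (rule moduleI) (use assms cring_complex_ring in auto)

subsection \<open>Linear maps\<close>

lemma linear_mapsI:
  assumes "\<And>x. x \<in> carrier V \<Longrightarrow> f x \<in> carrier W"
    "\<And>x y. \<lbrakk>x \<in> carrier V; y \<in> carrier V\<rbrakk> \<Longrightarrow> f (x \<oplus>\<^bsub>V\<^esub> y) = f x \<oplus>\<^bsub>W\<^esub> f y"
    "\<And>c x. x \<in> carrier V \<Longrightarrow> f (c \<odot>\<^bsub>V\<^esub> x) = c \<odot>\<^bsub>W\<^esub> f x"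
  shows "f \<in> linear_maps V W"
  using assms by (auto simp: linear_maps_def)

lemma linear_closed: "\<lbrakk>f \<in> linear_maps V W; x \<in> carrier V\<rbrakk> \<Longrightarrow> f x \<in> carrier W"
  by (auto simp: linear_maps_def)

lemma linear_add:
  "\<lbrakk>f \<in> linear_maps V W; x \<in> carrier V; y \<in> carrier V\<rbrakk> \<Longrightarrow> f (x \<oplus>\<^bsub>V\<^esub> y) = f x \<oplus>\<^bsub>W\<^esub> f y"
  by (auto simp: linear_maps_def)

lemma linear_scale:
  "\<lbrakk>f \<in> linear_maps V W; x \<in> carrier V\<rbrakk> \<Longrightarrow> f (c \<odot>\<^bsub>V\<^esub> x) = c \<odot>\<^bsub>W\<^esub> f x"
  by (auto simp: linear_maps_def)

lemma linear_zero:
  assumes "cspace V" "cspace W" "f \<in> linear_maps V W"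
  shows "f \<zero>\<^bsub>V\<^esub> = \<zero>\<^bsub>W\<^esub>"
proof -
  interpret V: cspace V by fact
  interpret W: cspace W by fact
  have "f (0 \<odot>\<^bsub>V\<^esub> \<zero>\<^bsub>V\<^esub>) = 0 \<odot>\<^bsub>W\<^esub> f \<zero>\<^bsub>V\<^esub>"
    using assms(3) by (rule linear_scale) simp
  then show ?thesis
    using linear_closed[OF assms(3), of "\<zero>\<^bsub>V\<^esub>"] by simp
qed

lemma linear_comp:
  "\<lbrakk>f \<in> linear_maps U V; g \<in> linear_maps V W\<rbrakk> \<Longrightarrow> (\<lambda>x. g (f x)) \<in> linear_maps U W"
  by (auto simp: linear_maps_def Pi_iff)

lemma linear_id: "(\<lambda>x. x) \<in> linear_maps V V"
  by (auto simp: linear_maps_def)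

lemma linear_maps_add:
  assumes "cspace W" "f \<in> linear_maps V W" "g \<in> linear_maps V W"
  shows "(\<lambda>x. f x \<oplus>\<^bsub>W\<^esub> g x) \<in> linear_maps V W"
proof -
  interpret W: cspace W by fact
  show ?thesis
    using assms(2,3)
    by (intro linear_mapsI)
      (auto simp: linear_closed linear_add linear_scale W.scale_right_distrib W.a_ac)
qed

lemma linear_maps_scale:
  assumes "cspace W" "f \<in> linear_maps V W"
  shows "(\<lambda>x. c \<odot>\<^bsub>W\<^esub> f x) \<in> linear_maps V W"
proof -
  interpret W: cspace W by fact
  show ?thesis
    using assms(2)
    by (intro linear_mapsI)
      (auto simp: linear_closed linear_add linear_scale W.scale_right_distrib mult_ac)
qed

lemma linear_kernel_subspace:
  assumes "cspace V" "cspace W" "f \<in> linear_maps V W"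
  shows "submodule {x \<in> carrier V. f x = \<zero>\<^bsub>W\<^esub>} complex_ring V"
proof -
  interpret V: cspace V by fact
  interpret W: cspace W by fact
  show ?thesis
    using assms
    by (intro V.subspaceI) (auto simp: linear_add linear_scale linear_zero)
qed

subsection \<open>Quotient spaces\<close>

locale subspace = cspace +
  fixes N
  assumes submodule: "submodule N complex_ring V"
begin

lemma N_zero: "\<zero> \<in> N"
  using submoduleE(1-4)[OF submodule]
  by (metis (no_types) UNIV_I complex_ring_simps(1) ex_in_conv scale_zero_left subsetD)

lemma N_sub: "x \<in> N \<Longrightarrow> x \<in> carrier V"
  using submoduleE(1)[OF submodule] by auto

lemma N_add: "\<lbrakk>x \<in> N; y \<in> N\<rbrakk> \<Longrightarrow> x \<oplus> y \<in> N"
  by (rule submoduleE(5)[OF submodule])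

lemma N_scale: "x \<in> N \<Longrightarrow> c \<odot> x \<in> N"
  using submoduleE(4)[OF submodule] by simp

sublocale abelian_subgroup N V
  by (rule abelian_subgroupI3)
    (auto intro: additive_subgroupI submodule.axioms(1)[OF submodule] abelian_group_axioms)

abbreviation Q where "Q \<equiv> quot_module V N"

lemma quot_carrier: "carrier Q = (\<lambda>x. N +> x) ` carrier V"
  by (auto simp: quot_module_def ring.defs module.defs FactRing_def A_RCOSETS_def')

lemma quotE:
  assumes "X \<in> carrier Q"
  obtains x where "x \<in> carrier V" "X = N +> x"
  using assms by (auto simp: quot_carrier)

lemma quot_zero: "\<zero>\<^bsub>Q\<^esub> = N +> \<zero>"
  using a_subset by (simp add: quot_module_def ring.defs module.defs FactRing_def)

lemma coset_eq_iff: "\<lbrakk>x \<in> carrier V; y \<in> carrier V\<rbrakk> \<Longrightarrow> N +> x = N +> y \<longleftrightarrow> x \<ominus> y \<in> N"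
  unfolding a_minus_def
  using a_rcos_module[of y x] a_repr_independence'[of x y] a_rcos_self[of x] by metis

lemma quot_add:
  "\<lbrakk>x \<in> carrier V; y \<in> carrier V\<rbrakk> \<Longrightarrow> (N +> x) \<oplus>\<^bsub>Q\<^esub> (N +> y) = N +> (x \<oplus> y)"
  by (simp add: quot_module_def ring.defs module.defs FactRing_def a_rcos_sum)

lemma quot_scale:
  assumes x: "x \<in> carrier V"
  shows "c \<odot>\<^bsub>Q\<^esub> (N +> x) = N +> (c \<odot> x)"
proof -
  have "N +> (c \<odot> y) = N +> (c \<odot> x)" if "y \<in> N +> x" for y
  proof -
    from that obtain n where n: "n \<in> N" "y = n \<oplus> x"
      by (auto simp: a_r_coset_def')
    have "N +> (c \<odot> y) = (N +> (c \<odot> n)) <+> (N +> (c \<odot> x))"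
      using n x N_sub by (simp add: scale_right_distrib a_rcos_sum)
    also have "N +> (c \<odot> n) = N +> \<zero>"
      using a_rcos_const N_scale[OF n(1)] a_subset by simp
    also have "(N +> \<zero>) <+> (N +> (c \<odot> x)) = N +> (c \<odot> x)"
      using x by (subst a_rcos_sum) auto
    finally show ?thesis .
  qed
  then have "(\<Union>y\<in>N +> x. N +> (c \<odot> y)) = (\<Union>y\<in>N +> x. N +> (c \<odot> x))"
    by (rule SUP_cong[OF refl])
  also have "\<dots> = N +> (c \<odot> x)"
    using a_rcos_self[OF x] by (simp add: UN_constant) blast
  finally show ?thesis
    by (simp add: quot_module_def ring.defs module.defs)
qed

lemma quot_cspace: "cspace Q"
proof (rule cspaceI)
  show "abelian_group Q"
  proof (rule abelian_groupI)
    fix x assume "x \<in> carrier Q"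
    then obtain a where a: "a \<in> carrier V" "x = N +> a" by (auto simp: quot_carrier)
    then show "\<exists>y\<in>carrier Q. y \<oplus>\<^bsub>Q\<^esub> x = \<zero>\<^bsub>Q\<^esub>"
      by (intro bexI[of _ "N +> (\<ominus> a)"]) (auto simp: quot_add l_neg quot_zero quot_carrier)
  qed (auto simp: quot_carrier quot_add a_ac quot_zero)
next
  fix X and a b :: complex assume "X \<in> carrier Q"
  then obtain x where x: "x \<in> carrier V" "X = N +> x" by (rule quotE)
  show "a \<odot>\<^bsub>Q\<^esub> X \<in> carrier Q" "(a + b) \<odot>\<^bsub>Q\<^esub> X = a \<odot>\<^bsub>Q\<^esub> X \<oplus>\<^bsub>Q\<^esub> b \<odot>\<^bsub>Q\<^esub> X"
    "(a * b) \<odot>\<^bsub>Q\<^esub> X = a \<odot>\<^bsub>Q\<^esub> (b \<odot>\<^bsub>Q\<^esub> X)" "1 \<odot>\<^bsub>Q\<^esub> X = X"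
    using x by (simp_all add: quot_carrier quot_scale quot_add scale_left_distrib)
  fix Y assume "Y \<in> carrier Q"
  then obtain y where y: "y \<in> carrier V" "Y = N +> y" by (rule quotE)
  show "a \<odot>\<^bsub>Q\<^esub> (X \<oplus>\<^bsub>Q\<^esub> Y) = a \<odot>\<^bsub>Q\<^esub> X \<oplus>\<^bsub>Q\<^esub> a \<odot>\<^bsub>Q\<^esub> Y"
    using x y by (simp add: quot_scale quot_add scale_right_distrib)
qed

lemma proj_linear: "(\<lambda>x. N +> x) \<in> linear_maps V Q"
  by (rule linear_mapsI) (auto simp: quot_carrier quot_add quot_scale)

text \<open>A linear map that vanishes on \<open>N\<close> is constant on every coset, so its image of a coset is a
  singleton.\<close>

lemma quot_lift:
  assumes "cspace W" "f \<in> linear_maps V W" "\<And>x. x \<in> N \<Longrightarrow> f x = \<zero>\<^bsub>W\<^esub>"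
  shows "(\<lambda>X. the_elem (f ` X)) \<in> linear_maps Q W"
    and "\<And>x. x \<in> carrier V \<Longrightarrow> the_elem (f ` (N +> x)) = f x"
proof -
  interpret W: cspace W by fact
  have *: "the_elem (f ` (N +> x)) = f x" if "x \<in> carrier V" for x
  proof -
    have "f y = f x" if "y \<in> N +> x" for y
    proof -
      from that obtain n where n: "n \<in> N" "y = n \<oplus> x"
        by (auto simp: a_r_coset_def')
      then have "f y = f n \<oplus>\<^bsub>W\<^esub> f x"
        using linear_add[OF assms(2)] N_sub \<open>x \<in> carrier V\<close> by simp
      then show ?thesis
        using assms(3)[OF n(1)] linear_closed[OF assms(2) \<open>x \<in> carrier V\<close>] by simp
    qed
    moreover have "x \<in> N +> x"
      using a_rcos_self that .
    ultimately have "f ` (N +> x) = {f x}" by blast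
    then show ?thesis by simp
  qed
  then show "\<And>x. x \<in> carrier V \<Longrightarrow> the_elem (f ` (N +> x)) = f x" .
  show "(\<lambda>X. the_elem (f ` X)) \<in> linear_maps Q W"
  proof (rule linear_mapsI, goal_cases)
    case (1 X)
    then show ?case using * linear_closed[OF assms(2)] by (auto simp: quot_carrier)
  next
    case (2 X Y)
    from 2(1) obtain x where x: "x \<in> carrier V" "X = N +> x" by (rule quotE)
    from 2(2) obtain y where y: "y \<in> carrier V" "Y = N +> y" by (rule quotE)
    from x y show ?case using * linear_add[OF assms(2)] by (simp add: quot_add)
  next
    case (3 c X)
    then obtain x where "x \<in> carrier V" "X = N +> x" by (rule quotE)
    then show ?case using * linear_scale[OF assms(2)] by (simp add: quot_scale)
  qed
qed

end

subsection \<open>Free modules and linear extension\<close>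

lemma lookup_pm_scale [simp]: "Poly_Mapping.lookup (pm_scale c p) k = c * Poly_Mapping.lookup p k"
  by (simp add: pm_scale_def Poly_Mapping.map.rep_eq when_def)

lemma keys_pm_scale:
  "x \<in> Poly_Mapping.keys (pm_scale c p) \<Longrightarrow> x \<in> Poly_Mapping.keys p"
  by (auto simp: in_keys_iff)

lemma pm_scale_single [simp]: "pm_scale c (Poly_Mapping.single x d) = Poly_Mapping.single x (c * d)"
  by (rule poly_mapping_eqI) (simp add: lookup_single when_def)

lemma diff_conv_scale: "p - r = p + pm_scale (- 1) r"
  by (rule poly_mapping_eqI) (simp add: lookup_minus lookup_add)

lemma pm_scale_distrib:
  "pm_scale c (p + r) = pm_scale c p + pm_scale c r"
  "pm_scale c (p - r) = pm_scale c p - pm_scale c r"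
  "pm_scale c (- p) = - pm_scale c p"
  "pm_scale c 0 = 0"
  "pm_scale (a + b) p = pm_scale a p + pm_scale b p"
  "pm_scale a (pm_scale b p) = pm_scale (a * b) p"
  "pm_scale 1 p = p"
  "pm_scale 0 p = 0"
  by (rule poly_mapping_eqI, simp add: lookup_add lookup_minus algebra_simps)+

text \<open>Expressing coefficients of formal sums through an opaque indicator turns an equation between
  formal sums into a polynomial identity in the indicators of its basis vectors; no case
  distinction on coincidences between basis vectors is needed.\<close>

definition ind :: "'x \<Rightarrow> 'x \<Rightarrow> complex" where "ind x k = (if x = k then 1 else 0)"

lemma lookup_single_ind: "Poly_Mapping.lookup (Poly_Mapping.single x c) k = c * ind x k"
  by (simp add: ind_def lookup_single when_def)

lemma free_module_simps [simp]:
  "carrier (free_module S) = {p. Poly_Mapping.keys p \<subseteq> S}"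
  "add (free_module S) = (+)" "zero (free_module S) = 0" "smult (free_module S) = pm_scale"
  by (simp_all add: free_module_def)

lemma abelian_group_poly_mapping:
  "abelian_group \<lparr>carrier = {p :: 'x \<Rightarrow>\<^sub>0 'b :: ab_group_add. Poly_Mapping.keys p \<subseteq> S}, mult = m, one = u,
     zero = 0, add = (+), \<dots> = e\<rparr>"
proof (rule abelian_groupI, goal_cases)
  case (1 p r)
  then show ?case using keys_add[of p r] by auto
next
  case (6 p)
  then show ?case by (intro bexI[of _ "- p"]) auto
qed (auto simp: add_ac)

lemma free_module_cspace: "cspace (free_module S)"
proof (rule cspaceI)
  show "abelian_group (free_module S)"
    unfolding free_module_def by (rule abelian_group_poly_mapping)
qed (auto simp: pm_scale_distrib subset_iff dest: keys_pm_scale)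

context cspace
begin

text \<open>Enlarging the index set by zero coefficients lets sums over different supports be
  compared.\<close>

lemma lin_ext_superset:
  assumes "finite S" "Poly_Mapping.keys p \<subseteq> S" "f \<in> S \<rightarrow> carrier V"
  shows "lin_ext V f p = (\<Oplus>x\<in>S. Poly_Mapping.lookup p x \<odot> f x)"
  unfolding lin_ext_def
  by (rule add.finprod_mono_neutral_cong_left)
    (use assms in \<open>auto simp: in_keys_iff Pi_iff\<close>)

lemma lin_ext_linear:
  assumes "f \<in> S \<rightarrow> carrier V"
  shows "lin_ext V f \<in> linear_maps (free_module S) V"
proof (rule linear_mapsI)
  fix p assume p: "p \<in> carrier (free_module S)"
  show "lin_ext V f p \<in> carrier V"
    unfolding lin_ext_def using assms p by (auto intro!: finsum_closed)
  fix c
  have k: "f \<in> Poly_Mapping.keys p \<rightarrow> carrier V"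
    using assms p by auto
  have "lin_ext V f (pm_scale c p) = (\<Oplus>x\<in>Poly_Mapping.keys p. (c * Poly_Mapping.lookup p x) \<odot> f x)"
    using k by (subst lin_ext_superset[of "Poly_Mapping.keys p"]) (auto dest: keys_pm_scale)
  also have "\<dots> = (\<Oplus>x\<in>Poly_Mapping.keys p. c \<odot> (Poly_Mapping.lookup p x \<odot> f x))"
    using k by (intro finsum_cong') (auto simp: Pi_iff)
  also have "\<dots> = c \<odot> lin_ext V f p"
    unfolding lin_ext_def using k by (subst finsum_smult_ldistr) auto
  finally show "lin_ext V f (c \<odot>\<^bsub>free_module S\<^esub> p) = c \<odot> lin_ext V f p" by simp
next
  fix p r assume p: "p \<in> carrier (free_module S)" and r: "r \<in> carrier (free_module S)"
  define K where "K = Poly_Mapping.keys p \<union> Poly_Mapping.keys r"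
  have K: "finite K" "Poly_Mapping.keys p \<subseteq> K" "Poly_Mapping.keys r \<subseteq> K"
    "Poly_Mapping.keys (p + r) \<subseteq> K" "f \<in> K \<rightarrow> carrier V"
    using assms p r keys_add[of p r] by (auto simp: K_def Pi_iff)
  have fK: "\<And>x. x \<in> K \<Longrightarrow> f x \<in> carrier V"
    using K(5) by auto
  have "lin_ext V f (p + r)
    = (\<Oplus>x\<in>K. Poly_Mapping.lookup p x \<odot> f x \<oplus> Poly_Mapping.lookup r x \<odot> f x)"
    unfolding lin_ext_superset[OF K(1,4,5)] using fK
    by (intro finsum_cong') (auto simp: lookup_add scale_left_distrib)
  also have "\<dots> = lin_ext V f p \<oplus> lin_ext V f r"
    unfolding lin_ext_superset[OF K(1,2,5)] lin_ext_superset[OF K(1,3,5)] using fK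
    by (intro finsum_addf) auto
  finally show "lin_ext V f (p \<oplus>\<^bsub>free_module S\<^esub> r) = lin_ext V f p \<oplus> lin_ext V f r" by simp
qed

lemma lin_ext_single:
  assumes "f x \<in> carrier V"
  shows "lin_ext V f (Poly_Mapping.single x c) = c \<odot> f x"
  using assms by (subst lin_ext_superset[of "{x}"]) (auto simp: finsum_insert)

lemma free_module_ext:
  assumes "f \<in> linear_maps (free_module S) V" "g \<in> linear_maps (free_module S) V"
    and eq: "\<And>x. x \<in> S \<Longrightarrow> f (Poly_Mapping.single x 1) = g (Poly_Mapping.single x 1)"
    and "Poly_Mapping.keys p \<subseteq> S"
  shows "f p = g p"
  using assms(4)
proof (induction p rule: update_induct)
  case const
  then show ?case
    using linear_zero[OF free_module_cspace cspace_axioms assms(1)]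
      linear_zero[OF free_module_cspace cspace_axioms assms(2)] by simp
next
  case (update p a b)
  have upd: "Poly_Mapping.update a b p = p + pm_scale b (Poly_Mapping.single a 1)"
    using update.hyps
    by (intro poly_mapping_eqI)
      (auto simp: lookup_update lookup_add lookup_single when_def in_keys_iff)
  have keys: "Poly_Mapping.keys (Poly_Mapping.update a b p) = insert a (Poly_Mapping.keys p)"
    using update.hyps by (simp add: keys_update)
  have a: "Poly_Mapping.single a 1 \<in> carrier (free_module S)"
    "pm_scale b (Poly_Mapping.single a 1) \<in> carrier (free_module S)"
    and p: "p \<in> carrier (free_module S)" and aS: "a \<in> S"
    using update.prems keys by auto
  have "f p = g p"
    using update.IH p by simp
  then show ?case
    unfolding upd
    using linear_add[OF assms(1) p a(2)] linear_add[OF assms(2) p a(2)]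
      linear_scale[OF assms(1) a(1), of b] linear_scale[OF assms(2) a(1), of b]
      eq[OF aS]
    by simp
qed

end

subsection \<open>Tensor products\<close>

lemma (in cspace) subspace_gen:
  assumes "S \<subseteq> carrier V"
  shows "submodule (subspace_gen V S) complex_ring V"
    and "S \<subseteq> subspace_gen V S"
    and "\<And>N. \<lbrakk>submodule N complex_ring V; S \<subseteq> N\<rbrakk> \<Longrightarrow> subspace_gen V S \<subseteq> N"
proof -
  have sub: "subspace V N" if "submodule N complex_ring V" for N
    using that by (intro subspace.intro subspace_axioms.intro cspace_axioms)
  show "submodule (subspace_gen V S) complex_ring V"
  proof (rule subspaceI)
    show "subspace_gen V S \<subseteq> carrier V"
      unfolding subspace_gen_def using carrier_is_submodule assms by blast
    show "\<zero> \<in> subspace_gen V S"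
      unfolding subspace_gen_def using subspace.N_zero[OF sub] by blast
    show "a \<oplus> b \<in> subspace_gen V S" if "a \<in> subspace_gen V S" "b \<in> subspace_gen V S" for a b
      using that subspace.N_add[OF sub] unfolding subspace_gen_def by blast
    show "c \<odot> x \<in> subspace_gen V S" if "x \<in> subspace_gen V S" for c x
      using that subspace.N_scale[OF sub] unfolding subspace_gen_def by blast
  qed
qed (auto simp: subspace_gen_def)

definition bilinear ::
    "(complex, 'v) module \<Rightarrow> (complex, 'w) module \<Rightarrow> (complex, 'u) module \<Rightarrow> ('v \<Rightarrow> 'w \<Rightarrow> 'u) \<Rightarrow> bool"
  where "bilinear V W U b \<longleftrightarrow>
    (\<forall>v\<in>carrier V. b v \<in> linear_maps W U) \<and> (\<forall>w\<in>carrier W. (\<lambda>v. b v w) \<in> linear_maps V U)"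

lemma bilinearI:
  assumes "\<And>v. v \<in> carrier V \<Longrightarrow> b v \<in> linear_maps W U"
    "\<And>w. w \<in> carrier W \<Longrightarrow> (\<lambda>v. b v w) \<in> linear_maps V U"
  shows "bilinear V W U b"
  using assms by (auto simp: bilinear_def)

lemma bilinear_left: "\<lbrakk>bilinear V W U b; w \<in> carrier W\<rbrakk> \<Longrightarrow> (\<lambda>v. b v w) \<in> linear_maps V U"
  by (auto simp: bilinear_def)

lemma bilinear_right: "\<lbrakk>bilinear V W U b; v \<in> carrier V\<rbrakk> \<Longrightarrow> b v \<in> linear_maps W U"
  by (auto simp: bilinear_def)

locale tensor_product = V: cspace V + W: cspace W
  for V :: "(complex, 'v) module" and W :: "(complex, 'w) module"
begin

abbreviation F where "F \<equiv> free_module (carrier V \<times> carrier W)"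
abbreviation T where "T \<equiv> tensor V W"
abbreviation pt where "pt \<equiv> pure_tensor V W"

sublocale F: cspace F
  by (rule free_module_cspace)

lemma tensor_rels_carrier: "tensor_rels V W \<subseteq> carrier F"
proof -
  have d: "p - r \<in> carrier F" if "p \<in> carrier F" "r \<in> carrier F" for p r
    using that keys_diff[of p r] by auto
  have s: "Poly_Mapping.single (v, w) c \<in> carrier F" if "v \<in> carrier V" "w \<in> carrier W" for v w c
    using that by auto
  show ?thesis
    unfolding tensor_rels_def
    by (auto simp del: free_module_simps(1) intro!: d s)
qed

sublocale N: subspace F "tensor_null V W"
  unfolding tensor_null_def
  by (intro subspace.intro subspace_axioms.intro F.cspace_axioms
      F.subspace_gen(1)[OF tensor_rels_carrier])

lemma tensor_rels_null: "tensor_rels V W \<subseteq> tensor_null V W"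
  unfolding tensor_null_def by (rule F.subspace_gen(2)[OF tensor_rels_carrier])

sublocale T: cspace T
  unfolding tensor_def by (rule N.quot_cspace)

text \<open>The class of a formal sum.  Identities in the tensor product are proved by collecting each side
  into the class of one formal sum and then comparing coefficients.\<close>

definition formal where "formal p = tensor_null V W +>\<^bsub>F\<^esub> p"

lemma formal_linear: "formal \<in> linear_maps F T"
  using N.proj_linear unfolding formal_def[abs_def] tensor_def .

lemma formal_add:
  "\<lbrakk>p \<in> carrier F; r \<in> carrier F\<rbrakk> \<Longrightarrow> formal p \<oplus>\<^bsub>T\<^esub> formal r = formal (p + r)"
  using linear_add[OF formal_linear, of p r] by simp

lemma formal_scale: "p \<in> carrier F \<Longrightarrow> c \<odot>\<^bsub>T\<^esub> formal p = formal (pm_scale c p)"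
  using linear_scale[OF formal_linear, of p c] by simp

lemma formal_eqI:
  assumes "p - r \<in> tensor_rels V W" "p \<in> carrier F" "r \<in> carrier F"
  shows "formal p = formal r"
proof -
  have "p \<ominus>\<^bsub>F\<^esub> r = p - r"
    using F.minus_eq_scale[OF assms(3)]
    by (simp add: a_minus_def) (auto intro!: poly_mapping_eqI simp: lookup_minus lookup_add)
  then show ?thesis
    unfolding formal_def using assms tensor_rels_null by (subst N.coset_eq_iff) auto
qed

lemma pure_formal: "pt v w = formal (Poly_Mapping.single (v, w) 1)"
  by (simp add: pure_tensor_def formal_def)

lemma tensor_relsI:
  assumes "v \<in> carrier V" "w \<in> carrier W"
  shows "v' \<in> carrier V \<Longrightarrow> Poly_Mapping.single (v \<oplus>\<^bsub>V\<^esub> v', w) 1 -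
      (Poly_Mapping.single (v, w) 1 + Poly_Mapping.single (v', w) 1) \<in> tensor_rels V W"
    and "w' \<in> carrier W \<Longrightarrow> Poly_Mapping.single (v, w \<oplus>\<^bsub>W\<^esub> w') 1 -
      (Poly_Mapping.single (v, w) 1 + Poly_Mapping.single (v, w') 1) \<in> tensor_rels V W"
    and "Poly_Mapping.single (c \<odot>\<^bsub>V\<^esub> v, w) 1 - Poly_Mapping.single (v, w) c \<in> tensor_rels V W"
    and "Poly_Mapping.single (v, c \<odot>\<^bsub>W\<^esub> w) 1 - Poly_Mapping.single (v, w) c \<in> tensor_rels V W"
  unfolding tensor_rels_def diff_diff_eq[symmetric]
  using assms
  by (blast+)

lemma sum_of_pairs_carrier:
  assumes "x \<in> carrier V \<times> carrier W" "y \<in> carrier V \<times> carrier W"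
  shows "Poly_Mapping.single x 1 + Poly_Mapping.single y 1 \<in> carrier F"
  using assms keys_add[of "Poly_Mapping.single x (1 :: complex)" "Poly_Mapping.single y 1"] by auto

lemma pure_closed [simp, intro]: "\<lbrakk>v \<in> carrier V; w \<in> carrier W\<rbrakk> \<Longrightarrow> pt v w \<in> carrier T"
  unfolding pure_formal by (rule linear_closed[OF formal_linear]) simp

lemma pure_add_left:
  assumes "v \<in> carrier V" "v' \<in> carrier V" "w \<in> carrier W"
  shows "pt (v \<oplus>\<^bsub>V\<^esub> v') w = pt v w \<oplus>\<^bsub>T\<^esub> pt v' w"
proof -
  have "pt v w \<oplus>\<^bsub>T\<^esub> pt v' w
    = formal (Poly_Mapping.single (v, w) 1 + Poly_Mapping.single (v', w) 1)"
    unfolding pure_formal by (rule formal_add) (use assms in auto)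
  also have "formal (Poly_Mapping.single (v \<oplus>\<^bsub>V\<^esub> v', w) 1) = \<dots>"
  proof (rule formal_eqI)
    show "Poly_Mapping.single (v \<oplus>\<^bsub>V\<^esub> v', w) 1
        - (Poly_Mapping.single (v, w) 1 + Poly_Mapping.single (v', w) 1) \<in> tensor_rels V W"
      using assms by (intro tensor_relsI)
    show "Poly_Mapping.single (v, w) 1 + Poly_Mapping.single (v', w) 1 \<in> carrier F"
      by (rule sum_of_pairs_carrier) (use assms in auto)
  qed (use assms in auto)
  finally show ?thesis by (simp add: pure_formal)
qed

lemma pure_add_right:
  assumes "v \<in> carrier V" "w \<in> carrier W" "w' \<in> carrier W"
  shows "pt v (w \<oplus>\<^bsub>W\<^esub> w') = pt v w \<oplus>\<^bsub>T\<^esub> pt v w'"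
proof -
  have "pt v w \<oplus>\<^bsub>T\<^esub> pt v w'
    = formal (Poly_Mapping.single (v, w) 1 + Poly_Mapping.single (v, w') 1)"
    unfolding pure_formal by (rule formal_add) (use assms in auto)
  also have "formal (Poly_Mapping.single (v, w \<oplus>\<^bsub>W\<^esub> w') 1) = \<dots>"
  proof (rule formal_eqI)
    show "Poly_Mapping.single (v, w \<oplus>\<^bsub>W\<^esub> w') 1
        - (Poly_Mapping.single (v, w) 1 + Poly_Mapping.single (v, w') 1) \<in> tensor_rels V W"
      using assms by (intro tensor_relsI)
    show "Poly_Mapping.single (v, w) 1 + Poly_Mapping.single (v, w') 1 \<in> carrier F"
      by (rule sum_of_pairs_carrier) (use assms in auto)
  qed (use assms in auto)
  finally show ?thesis by (simp add: pure_formal)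
qed

lemma pure_scale_left:
  assumes "v \<in> carrier V" "w \<in> carrier W"
  shows "pt (c \<odot>\<^bsub>V\<^esub> v) w = c \<odot>\<^bsub>T\<^esub> pt v w"
proof -
  have "c \<odot>\<^bsub>T\<^esub> pt v w = formal (Poly_Mapping.single (v, w) c)"
    unfolding pure_formal using assms by (subst formal_scale) auto
  also have "formal (Poly_Mapping.single (c \<odot>\<^bsub>V\<^esub> v, w) 1) = \<dots>"
  proof (rule formal_eqI)
    show "Poly_Mapping.single (c \<odot>\<^bsub>V\<^esub> v, w) 1 - Poly_Mapping.single (v, w) c \<in> tensor_rels V W"
      using assms by (intro tensor_relsI)
  qed (use assms in auto)
  finally show ?thesis by (simp add: pure_formal)
qed

lemma pure_scale_right:
  assumes "v \<in> carrier V" "w \<in> carrier W"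
  shows "pt v (c \<odot>\<^bsub>W\<^esub> w) = c \<odot>\<^bsub>T\<^esub> pt v w"
proof -
  have "c \<odot>\<^bsub>T\<^esub> pt v w = formal (Poly_Mapping.single (v, w) c)"
    unfolding pure_formal using assms by (subst formal_scale) auto
  also have "formal (Poly_Mapping.single (v, c \<odot>\<^bsub>W\<^esub> w) 1) = \<dots>"
  proof (rule formal_eqI)
    show "Poly_Mapping.single (v, c \<odot>\<^bsub>W\<^esub> w) 1 - Poly_Mapping.single (v, w) c \<in> tensor_rels V W"
      using assms by (intro tensor_relsI)
  qed (use assms in auto)
  finally show ?thesis by (simp add: pure_formal)
qed

lemma pure_bilinear: "bilinear V W T pt"
  by (intro bilinearI linear_mapsI)
    (auto simp: pure_add_left pure_add_right pure_scale_left pure_scale_right)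

lemma pure_carrier:
  "\<lbrakk>v \<in> carrier V; w \<in> carrier W\<rbrakk> \<Longrightarrow> Poly_Mapping.single (v, w) c \<in> carrier F"
  by simp

lemma sum_carrier: "\<lbrakk>p \<in> carrier F; r \<in> carrier F\<rbrakk> \<Longrightarrow> p + r \<in> carrier F"
  using F.a_closed[of p r] by (simp only: free_module_simps(2))

lemma scale_carrier: "p \<in> carrier F \<Longrightarrow> pm_scale c p \<in> carrier F"
  using F.scale_closed[of p c] by (simp only: free_module_simps(4))

lemmas expand_pure = pure_add_left pure_add_right pure_scale_left pure_scale_right
lemmas collect_formal = pure_formal formal_add formal_scale pure_carrier sum_carrier scale_carrier

lemma tensor_carrier: "carrier T = formal ` carrier F"
  unfolding tensor_def N.quot_carrier formal_def ..

text \<open>Linear maps out of a tensor product are determined by their values on pure tensors.\<close>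

lemma tensor_ext:
  assumes "cspace U" "f \<in> linear_maps T U" "g \<in> linear_maps T U"
    and eq: "\<And>v w. \<lbrakk>v \<in> carrier V; w \<in> carrier W\<rbrakk> \<Longrightarrow> f (pt v w) = g (pt v w)"
    and "x \<in> carrier T"
  shows "f x = g x"
proof -
  interpret U: cspace U by fact
  obtain p where p: "p \<in> carrier F" "x = formal p"
    using assms(5) unfolding tensor_carrier by blast
  have "f (formal p) = g (formal p)"
  proof (rule U.free_module_ext[of "\<lambda>p. f (formal p)" "carrier V \<times> carrier W" "\<lambda>p. g (formal p)"])
    show "(\<lambda>p. f (formal p)) \<in> linear_maps F U" "(\<lambda>p. g (formal p)) \<in> linear_maps F U"
      by (rule linear_comp[OF formal_linear assms(2)], rule linear_comp[OF formal_linear assms(3)])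
    show "f (formal (Poly_Mapping.single x 1)) = g (formal (Poly_Mapping.single x 1))"
      if "x \<in> carrier V \<times> carrier W" for x
      using eq that by (auto simp: pure_formal)
  qed (use p in auto)
  then show ?thesis using p by simp
qed

text \<open>The universal property.\<close>

lemma tensor_lift:
  assumes "cspace U" "bilinear V W U b"
  shows "tensor_lift U b \<in> linear_maps T U"
    and "\<And>v w. \<lbrakk>v \<in> carrier V; w \<in> carrier W\<rbrakk> \<Longrightarrow> tensor_lift U b (pt v w) = b v w"
proof -
  interpret U: cspace U by fact
  let ?e = "lin_ext U (\<lambda>(v, w). b v w)"
  have b: "b v w \<in> carrier U" if "v \<in> carrier V" "w \<in> carrier W" for v w
    by (rule linear_closed[OF bilinear_right[OF assms(2) that(1)] that(2)])
  have lin: "?e \<in> linear_maps F U"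
    by (rule U.lin_ext_linear) (auto intro: b)
  have single: "?e (Poly_Mapping.single (v, w) c) = c \<odot>\<^bsub>U\<^esub> b v w"
    if "v \<in> carrier V" "w \<in> carrier W" for v w c
    using that by (subst U.lin_ext_single) (auto intro: b)
  have diff: "?e (p - r) = ?e p \<oplus>\<^bsub>U\<^esub> (- 1) \<odot>\<^bsub>U\<^esub> ?e r" if "p \<in> carrier F" "r \<in> carrier F" for p r
  proof -
    have "p - r = p \<oplus>\<^bsub>F\<^esub> (- 1) \<odot>\<^bsub>F\<^esub> r"
      by (auto intro!: poly_mapping_eqI simp: lookup_minus lookup_add)
    then show ?thesis
      using that by (simp only: linear_add[OF lin] linear_scale[OF lin] F.scale_closed)
  qed
  have keysd: "Poly_Mapping.keys (p - r) \<subseteq> carrier V \<times> carrier W"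
    if "p \<in> carrier F" "r \<in> carrier F" for p r
    using that keys_diff[of p r] by auto
  have cancel: "x \<oplus>\<^bsub>U\<^esub> (- 1) \<odot>\<^bsub>U\<^esub> x = \<zero>\<^bsub>U\<^esub>" if "x \<in> carrier U" for x
    using that by (simp add: U.minus_eq_scale[symmetric] U.r_neg)
  have cancel1: "c \<odot>\<^bsub>U\<^esub> x \<oplus>\<^bsub>U\<^esub> (- c) \<odot>\<^bsub>U\<^esub> x = \<zero>\<^bsub>U\<^esub>" if "x \<in> carrier U" for c x
    using that U.scale_left_distrib[of x c "- c"] by simp
  have cancel2: "x \<oplus>\<^bsub>U\<^esub> y \<oplus>\<^bsub>U\<^esub> (- 1) \<odot>\<^bsub>U\<^esub> x \<oplus>\<^bsub>U\<^esub> (- 1) \<odot>\<^bsub>U\<^esub> y = \<zero>\<^bsub>U\<^esub>"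
    if "x \<in> carrier U" "y \<in> carrier U" for x y
  proof -
    have "x \<oplus>\<^bsub>U\<^esub> y \<oplus>\<^bsub>U\<^esub> (- 1) \<odot>\<^bsub>U\<^esub> x \<oplus>\<^bsub>U\<^esub> (- 1) \<odot>\<^bsub>U\<^esub> y = (x \<oplus>\<^bsub>U\<^esub> (- 1) \<odot>\<^bsub>U\<^esub> x) \<oplus>\<^bsub>U\<^esub> (y \<oplus>\<^bsub>U\<^esub> (- 1) \<odot>\<^bsub>U\<^esub> y)"
      using that by (simp add: U.a_ac)
    then show ?thesis using that by (simp add: cancel)
  qed
  have rels: "?e r = \<zero>\<^bsub>U\<^esub>" if "r \<in> tensor_rels V W" for r
    using that unfolding tensor_rels_def
    apply (elim UnE CollectE exE conjE)
       apply (auto simp: diff keysd single b cancel cancel1 cancel2 linear_add[OF bilinear_left[OF assms(2)]]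
        linear_add[OF bilinear_right[OF assms(2)]] linear_scale[OF bilinear_left[OF assms(2)]]
        linear_scale[OF bilinear_right[OF assms(2)]])
    done
  have "tensor_null V W \<subseteq> {x \<in> carrier F. ?e x = \<zero>\<^bsub>U\<^esub>}"
    unfolding tensor_null_def
    by (rule F.subspace_gen(3)[OF tensor_rels_carrier])
      (use rels tensor_rels_carrier linear_kernel_subspace[OF F.cspace_axioms assms(1) lin] in auto)
  then have null: "\<And>x. x \<in> tensor_null V W \<Longrightarrow> ?e x = \<zero>\<^bsub>U\<^esub>" by auto
  show "tensor_lift U b \<in> linear_maps T U"
    using N.quot_lift(1)[OF assms(1) lin null] by (simp add: tensor_def tensor_lift_def[abs_def])
  show "tensor_lift U b (pt v w) = b v w" if "v \<in> carrier V" "w \<in> carrier W" for v w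
    using N.quot_lift(2)[OF assms(1) lin null, of "Poly_Mapping.single (v, w) 1"] single[OF that, of 1] that
    by (simp add: tensor_lift_def pure_tensor_def b)
qed

end

lemma tensor_productI: "cspace V \<Longrightarrow> cspace W \<Longrightarrow> tensor_product V W"
  by (simp add: tensor_product_def)

lemma tensor_map:
  assumes "cspace V" "cspace W" "cspace V'" "cspace W'"
    "f \<in> linear_maps V V'" "g \<in> linear_maps W W'"
  shows "tensor_map V' W' f g \<in> linear_maps (tensor V W) (tensor V' W')"
    and "\<And>v w. \<lbrakk>v \<in> carrier V; w \<in> carrier W\<rbrakk> \<Longrightarrow>
      tensor_map V' W' f g (pure_tensor V W v w) = pure_tensor V' W' (f v) (g w)"
proof -
  interpret D: tensor_product V W using assms by (intro tensor_productI)
  interpret E: tensor_product V' W' using assms by (intro tensor_productI)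
  have "bilinear V W (tensor V' W') (\<lambda>v w. pure_tensor V' W' (f v) (g w))"
    by (intro bilinearI linear_comp[OF assms(6)] linear_comp[OF assms(5)]
      bilinear_right[OF E.pure_bilinear] bilinear_left[OF E.pure_bilinear]
      linear_closed[OF assms(5)] linear_closed[OF assms(6)])
  note * = D.tensor_lift[OF E.T.cspace_axioms this]
  show "tensor_map V' W' f g \<in> linear_maps (tensor V W) (tensor V' W')"
    and "\<And>v w. \<lbrakk>v \<in> carrier V; w \<in> carrier W\<rbrakk> \<Longrightarrow>
      tensor_map V' W' f g (pure_tensor V W v w) = pure_tensor V' W' (f v) (g w)"
    unfolding tensor_map_def by (fact *)+
qed

section \<open>Algebras with explicit carriers\<close>

text \<open>In contrast to the algebras of the locale \<open>algebra\<close>, multiplication need not commute.\<close>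

locale calgebra = cspace A + ring A for A :: "(complex, 'a) module" (structure) +
  assumes mult_scale_left: "\<lbrakk>x \<in> carrier A; y \<in> carrier A\<rbrakk> \<Longrightarrow> (c \<odot> x) \<otimes> y = c \<odot> (x \<otimes> y)"
    and mult_scale_right: "\<lbrakk>x \<in> carrier A; y \<in> carrier A\<rbrakk> \<Longrightarrow> x \<otimes> (c \<odot> y) = c \<odot> (x \<otimes> y)"
begin

lemma mult_linear_right: "x \<in> carrier A \<Longrightarrow> (\<lambda>y. x \<otimes> y) \<in> linear_maps A A"
  by (rule linear_mapsI) (auto simp: r_distr mult_scale_right)

lemma mult_linear_left: "y \<in> carrier A \<Longrightarrow> (\<lambda>x. x \<otimes> y) \<in> linear_maps A A"
  by (rule linear_mapsI) (auto simp: l_distr mult_scale_left)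

end

lemma calgebraI:
  fixes A (structure)
  assumes "cspace A"
    and one: "\<one> \<in> carrier A"
    and r: "\<And>x. x \<in> carrier A \<Longrightarrow> (\<lambda>y. x \<otimes> y) \<in> linear_maps A A"
    and l: "\<And>y. y \<in> carrier A \<Longrightarrow> (\<lambda>x. x \<otimes> y) \<in> linear_maps A A"
    and assoc: "\<And>x y z. \<lbrakk>x \<in> carrier A; y \<in> carrier A; z \<in> carrier A\<rbrakk> \<Longrightarrow>
      (x \<otimes> y) \<otimes> z = x \<otimes> (y \<otimes> z)"
    and "\<And>x. x \<in> carrier A \<Longrightarrow> \<one> \<otimes> x = x" "\<And>x. x \<in> carrier A \<Longrightarrow> x \<otimes> \<one> = x"
  shows "calgebra A"
proof -
  interpret cspace A by fact
  have "ring A"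
  proof (rule ringI)
    show "abelian_group A" by (rule abelian_group_axioms)
    show "Group.monoid A"
      using assms by (intro monoidI) (simp_all add: linear_closed[OF r])
  qed (simp_all add: linear_add[OF r] linear_add[OF l])
  then show ?thesis
    by (intro calgebra.intro calgebra_axioms.intro cspace_axioms)
      (simp_all add: linear_scale[OF r] linear_scale[OF l])
qed

subsection \<open>The free algebra\<close>

lemma free_alg_simps [simp]:
  "carrier free_alg = UNIV" "mult free_alg = (*)" "one free_alg = 1" "zero free_alg = 0"
  "add free_alg = (+)" "smult free_alg = pm_scale"
  by (simp_all add: free_alg_def)

lemma linear_maps_free_alg: "linear_maps free_alg W = linear_maps (free_module UNIV) W"
  by (simp add: linear_maps_def)

text \<open>The constants of the free algebra are central, although the monoid of words is not
  commutative.\<close>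

lemma single_0_commute:
  fixes p :: "'x :: monoid_add \<Rightarrow>\<^sub>0 complex"
  shows "p * Poly_Mapping.single 0 c = Poly_Mapping.single 0 c * p"
proof (induction p rule: update_induct)
  case const
  then show ?case by simp
next
  case (update p a b)
  have upd: "Poly_Mapping.update a b p = p + Poly_Mapping.single a b"
    using update.hyps
    by (intro poly_mapping_eqI)
      (auto simp: lookup_update lookup_add lookup_single when_def in_keys_iff)
  show ?case
    unfolding upd by (simp add: update.IH distrib_left distrib_right mult_single mult.commute)
qed

lemma pm_scale_mult:
  fixes p r :: "'x :: monoid_add \<Rightarrow>\<^sub>0 complex"
  shows "pm_scale c p * r = pm_scale c (p * r)" "p * pm_scale c r = pm_scale c (p * r)"
proof -
  have *: "pm_scale c p = Poly_Mapping.single 0 c * p" for c and p :: "'x \<Rightarrow>\<^sub>0 complex"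
    unfolding pm_scale_def by (rule mult_map_scale_conv_mult)
  show "pm_scale c p * r = pm_scale c (p * r)"
    by (simp add: * mult.assoc)
  show "p * pm_scale c r = pm_scale c (p * r)"
    unfolding * mult.assoc[symmetric] single_0_commute[of p] ..
qed

lemma free_alg_calgebra: "calgebra free_alg"
proof (rule calgebraI)
  show "cspace free_alg"
  proof (rule cspaceI)
    show "abelian_group free_alg"
      using abelian_group_poly_mapping[where S = UNIV] by (simp add: free_alg_def)
  qed (simp_all add: pm_scale_distrib)
qed (auto intro!: linear_mapsI simp: distrib_left distrib_right pm_scale_mult mult.assoc)

interpretation Fr: calgebra free_alg
  by (rule free_alg_calgebra)

lemma (in cspace) free_alg_ext:
  assumes "f \<in> linear_maps free_alg V" "g \<in> linear_maps free_alg V"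
    and "\<And>w. f (Poly_Mapping.single w 1) = g (Poly_Mapping.single w 1)"
  shows "f p = g p"
  by (rule free_module_ext[OF assms(1,2)[unfolded linear_maps_free_alg] assms(3)]) simp

context calgebra
begin

context
  fixes f :: "gen \<Rightarrow> 'a"
  assumes f: "\<And>x. f x \<in> carrier A"
begin

definition word_val where "word_val w = foldr (\<lambda>x b. f x \<otimes> b) (letters w) \<one>"

lemma word_val_closed [simp, intro]: "word_val w \<in> carrier A"
proof -
  have "foldr (\<lambda>x b. f x \<otimes> b) xs \<one> \<in> carrier A" for xs
    by (induction xs) (simp_all add: f)
  then show ?thesis by (simp add: word_val_def)
qed

lemma word_val_add: "word_val (u + v) = word_val u \<otimes> word_val v"
proof -
  have closed: "foldr (\<lambda>x b. f x \<otimes> b) ys \<one> \<in> carrier A" for ys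
    by (induction ys) (simp_all add: f)
  have "foldr (\<lambda>x b. f x \<otimes> b) xs b = foldr (\<lambda>x b. f x \<otimes> b) xs \<one> \<otimes> b"
    if "b \<in> carrier A" for xs b
    by (induction xs) (simp_all add: f m_assoc closed that)
  from this[OF word_val_closed[of v]] show ?thesis
    by (simp add: word_val_def plus_word_def)
qed

lemma alg_ext_linear: "alg_ext A f \<in> linear_maps free_alg A"
  unfolding alg_ext_def linear_maps_free_alg word_val_def[symmetric]
  by (rule lin_ext_linear) auto

lemma alg_ext_single: "alg_ext A f (Poly_Mapping.single w c) = c \<odot> word_val w"
  unfolding alg_ext_def word_val_def[symmetric]
  by (rule lin_ext_single) simp

lemma alg_ext_closed [simp, intro]: "alg_ext A f p \<in> carrier A"
  by (rule linear_closed[OF alg_ext_linear]) simp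

lemma alg_ext_one: "alg_ext A f 1 = \<one>"
  using alg_ext_single[of 0 1, unfolded single_one] by (simp add: word_val_def zero_word_def)

lemma alg_ext_generator: "alg_ext A f (generator x) = f x"
  using alg_ext_single[of "Word [x]" 1] f by (simp add: word_val_def)

lemma alg_ext_mult: "alg_ext A f (p * r) = alg_ext A f p \<otimes> alg_ext A f r"
proof (rule free_alg_ext[of "\<lambda>p. alg_ext A f (p * r)" "\<lambda>p. alg_ext A f p \<otimes> alg_ext A f r"])
  show "(\<lambda>p. alg_ext A f (p * r)) \<in> linear_maps free_alg A"
    using linear_comp[OF Fr.mult_linear_left alg_ext_linear] by simp
  show "(\<lambda>p. alg_ext A f p \<otimes> alg_ext A f r) \<in> linear_maps free_alg A"
    by (rule linear_comp[OF alg_ext_linear mult_linear_left]) simp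
  fix w
  show "alg_ext A f (Poly_Mapping.single w 1 * r)
    = alg_ext A f (Poly_Mapping.single w 1) \<otimes> alg_ext A f r"
  proof (rule free_alg_ext[of "\<lambda>r. alg_ext A f (Poly_Mapping.single w 1 * r)"
        "\<lambda>r. alg_ext A f (Poly_Mapping.single w 1) \<otimes> alg_ext A f r"])
    show "(\<lambda>r. alg_ext A f (Poly_Mapping.single w 1 * r)) \<in> linear_maps free_alg A"
      using linear_comp[OF Fr.mult_linear_right alg_ext_linear] by simp
    show "(\<lambda>r. alg_ext A f (Poly_Mapping.single w 1) \<otimes> alg_ext A f r) \<in> linear_maps free_alg A"
      by (rule linear_comp[OF alg_ext_linear mult_linear_right]) simp
  qed (simp add: mult_single alg_ext_single word_val_add)
qed

lemma alg_ext_kernel_ideal: "ideal {p. alg_ext A f p = \<zero>} free_alg"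
proof (rule idealI)
  show "ring free_alg"
    by (rule Fr.ring_axioms)
  show "subgroup {p. alg_ext A f p = \<zero>} (add_monoid free_alg)"
    using submodule.axioms(1)[OF
      linear_kernel_subspace[OF Fr.cspace_axioms cspace_axioms alg_ext_linear]]
    by simp
qed (simp_all add: alg_ext_mult)

end

end

subsection \<open>The tensor product of two algebras\<close>

locale tensor_algebra = A: calgebra A + B: calgebra B
  for A :: "(complex, 'v) module" and B :: "(complex, 'w) module"

sublocale tensor_algebra \<subseteq> tensor_product A B
  by unfold_locales

context tensor_algebra
begin

abbreviation TA where "TA \<equiv> tensor_alg A B"

lemma tensor_alg_simps [simp]:
  "carrier TA = carrier T" "zero TA = zero T" "add TA = add T" "smult TA = smult T"
  "one TA = pt \<one>\<^bsub>A\<^esub> \<one>\<^bsub>B\<^esub>"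
  by (simp_all add: tensor_alg_def)

lemma linear_maps_tensor_alg [simp]:
  "linear_maps TA U = linear_maps T U" "linear_maps U TA = linear_maps U T"
  by (simp_all add: linear_maps_def)

text \<open>Left multiplication by the pure tensor of \<open>a\<close> and \<open>b\<close>.  The product of the tensor algebra is
  bilinear by construction in the entries of its left factor only; linearity in the right factor and
  associativity are reduced to pure tensors, where they are inherited from \<open>A\<close> and \<open>B\<close>.\<close>

definition lmult where
  "lmult a b = tensor_lift T (\<lambda>a' b'. pt (a \<otimes>\<^bsub>A\<^esub> a') (b \<otimes>\<^bsub>B\<^esub> b'))"

lemma mult_TA: "X \<otimes>\<^bsub>TA\<^esub> Y = tensor_lift T (\<lambda>a b. lmult a b Y) X"
  by (simp add: tensor_alg_def lmult_def)

lemma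
  assumes a: "a \<in> carrier A" and b: "b \<in> carrier B"
  shows lmult_linear: "lmult a b \<in> linear_maps T T"
    and lmult_pure: "\<And>a' b'. \<lbrakk>a' \<in> carrier A; b' \<in> carrier B\<rbrakk> \<Longrightarrow>
      lmult a b (pt a' b') = pt (a \<otimes>\<^bsub>A\<^esub> a') (b \<otimes>\<^bsub>B\<^esub> b')"
proof -
  have *: "bilinear A B T (\<lambda>a' b'. pt (a \<otimes>\<^bsub>A\<^esub> a') (b \<otimes>\<^bsub>B\<^esub> b'))"
  proof (rule bilinearI)
    fix x assume "x \<in> carrier A"
    with a have "a \<otimes>\<^bsub>A\<^esub> x \<in> carrier A" by simp
    from linear_comp[OF B.mult_linear_right[OF b] bilinear_right[OF pure_bilinear this]]
    show "(\<lambda>b'. pt (a \<otimes>\<^bsub>A\<^esub> x) (b \<otimes>\<^bsub>B\<^esub> b')) \<in> linear_maps B T" .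
  next
    fix x assume "x \<in> carrier B"
    with b have "b \<otimes>\<^bsub>B\<^esub> x \<in> carrier B" by simp
    from linear_comp[OF A.mult_linear_right[OF a] bilinear_left[OF pure_bilinear this]]
    show "(\<lambda>a'. pt (a \<otimes>\<^bsub>A\<^esub> a') (b \<otimes>\<^bsub>B\<^esub> x)) \<in> linear_maps A T" .
  qed
  show "lmult a b \<in> linear_maps T T"
    unfolding lmult_def by (rule tensor_lift(1)[OF T.cspace_axioms *])
  show "\<And>a' b'. \<lbrakk>a' \<in> carrier A; b' \<in> carrier B\<rbrakk> \<Longrightarrow>
      lmult a b (pt a' b') = pt (a \<otimes>\<^bsub>A\<^esub> a') (b \<otimes>\<^bsub>B\<^esub> b')"
    unfolding lmult_def by (rule tensor_lift(2)[OF T.cspace_axioms *])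
qed

lemma lmult_bilinear:
  assumes Y: "Y \<in> carrier T"
  shows "bilinear A B T (\<lambda>a b. lmult a b Y)"
proof (rule bilinearI)
  fix a assume a: "a \<in> carrier A"
  show "(\<lambda>b. lmult a b Y) \<in> linear_maps B T"
  proof (rule linear_mapsI)
    fix b assume b: "b \<in> carrier B"
    show "lmult a b Y \<in> carrier T"
      by (rule linear_closed[OF lmult_linear[OF a b] Y])
    show "lmult a (c \<odot>\<^bsub>B\<^esub> b) Y = c \<odot>\<^bsub>T\<^esub> lmult a b Y" for c
    proof (rule tensor_ext[OF T.cspace_axioms _ _ _ Y, of "lmult a (c \<odot>\<^bsub>B\<^esub> b)" "\<lambda>Y. c \<odot>\<^bsub>T\<^esub> lmult a b Y"])
      show "(\<lambda>Y. c \<odot>\<^bsub>T\<^esub> lmult a b Y) \<in> linear_maps T T"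
        by (rule linear_maps_scale[OF T.cspace_axioms lmult_linear[OF a b]])
    qed (use a b in \<open>simp_all add: lmult_linear lmult_pure B.mult_scale_left pure_scale_right\<close>)
    fix b' assume b': "b' \<in> carrier B"
    show "lmult a (b \<oplus>\<^bsub>B\<^esub> b') Y = lmult a b Y \<oplus>\<^bsub>T\<^esub> lmult a b' Y"
    proof (rule tensor_ext[OF T.cspace_axioms _ _ _ Y, of "lmult a (b \<oplus>\<^bsub>B\<^esub> b')"
          "\<lambda>Y. lmult a b Y \<oplus>\<^bsub>T\<^esub> lmult a b' Y"])
      show "(\<lambda>Y. lmult a b Y \<oplus>\<^bsub>T\<^esub> lmult a b' Y) \<in> linear_maps T T"
        by (rule linear_maps_add[OF T.cspace_axioms lmult_linear[OF a b] lmult_linear[OF a b']])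
    qed (use a b b' in \<open>simp_all add: lmult_linear lmult_pure B.l_distr pure_add_right\<close>)
  qed
next
  fix b assume b: "b \<in> carrier B"
  show "(\<lambda>a. lmult a b Y) \<in> linear_maps A T"
  proof (rule linear_mapsI)
    fix a assume a: "a \<in> carrier A"
    show "lmult a b Y \<in> carrier T"
      by (rule linear_closed[OF lmult_linear[OF a b] Y])
    show "lmult (c \<odot>\<^bsub>A\<^esub> a) b Y = c \<odot>\<^bsub>T\<^esub> lmult a b Y" for c
    proof (rule tensor_ext[OF T.cspace_axioms _ _ _ Y, of "lmult (c \<odot>\<^bsub>A\<^esub> a) b" "\<lambda>Y. c \<odot>\<^bsub>T\<^esub> lmult a b Y"])
      show "(\<lambda>Y. c \<odot>\<^bsub>T\<^esub> lmult a b Y) \<in> linear_maps T T"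
        by (rule linear_maps_scale[OF T.cspace_axioms lmult_linear[OF a b]])
    qed (use a b in \<open>simp_all add: lmult_linear lmult_pure A.mult_scale_left pure_scale_left\<close>)
    fix a' assume a': "a' \<in> carrier A"
    show "lmult (a \<oplus>\<^bsub>A\<^esub> a') b Y = lmult a b Y \<oplus>\<^bsub>T\<^esub> lmult a' b Y"
    proof (rule tensor_ext[OF T.cspace_axioms _ _ _ Y, of "lmult (a \<oplus>\<^bsub>A\<^esub> a') b"
          "\<lambda>Y. lmult a b Y \<oplus>\<^bsub>T\<^esub> lmult a' b Y"])
      show "(\<lambda>Y. lmult a b Y \<oplus>\<^bsub>T\<^esub> lmult a' b Y) \<in> linear_maps T T"
        by (rule linear_maps_add[OF T.cspace_axioms lmult_linear[OF a b] lmult_linear[OF a' b]])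
    qed (use a a' b in \<open>simp_all add: lmult_linear lmult_pure A.l_distr pure_add_left\<close>)
  qed
qed

lemma TA_mult_linear_left: "Y \<in> carrier T \<Longrightarrow> (\<lambda>X. X \<otimes>\<^bsub>TA\<^esub> Y) \<in> linear_maps T T"
  unfolding mult_TA by (rule tensor_lift(1)[OF T.cspace_axioms lmult_bilinear])

lemma pure_mult_lmult:
  "\<lbrakk>a \<in> carrier A; b \<in> carrier B; Y \<in> carrier T\<rbrakk> \<Longrightarrow> pt a b \<otimes>\<^bsub>TA\<^esub> Y = lmult a b Y"
  unfolding mult_TA by (rule tensor_lift(2)[OF T.cspace_axioms lmult_bilinear])

lemma pure_mult:
  "\<lbrakk>a \<in> carrier A; b \<in> carrier B; a' \<in> carrier A; b' \<in> carrier B\<rbrakk> \<Longrightarrow>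
    pt a b \<otimes>\<^bsub>TA\<^esub> pt a' b' = pt (a \<otimes>\<^bsub>A\<^esub> a') (b \<otimes>\<^bsub>B\<^esub> b')"
  by (simp add: pure_mult_lmult lmult_pure)

lemma TA_mult_closed: "\<lbrakk>X \<in> carrier T; Y \<in> carrier T\<rbrakk> \<Longrightarrow> X \<otimes>\<^bsub>TA\<^esub> Y \<in> carrier T"
  by (rule linear_closed[OF TA_mult_linear_left])

lemma TA_mult_linear_right:
  assumes X: "X \<in> carrier T"
  shows "(\<lambda>Y. X \<otimes>\<^bsub>TA\<^esub> Y) \<in> linear_maps T T"
proof (rule linear_mapsI)
  fix Y assume Y: "Y \<in> carrier T"
  show "X \<otimes>\<^bsub>TA\<^esub> Y \<in> carrier T"
    by (rule TA_mult_closed[OF X Y])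
  show "X \<otimes>\<^bsub>TA\<^esub> (c \<odot>\<^bsub>T\<^esub> Y) = c \<odot>\<^bsub>T\<^esub> (X \<otimes>\<^bsub>TA\<^esub> Y)" for c
  proof (rule tensor_ext[OF T.cspace_axioms _ _ _ X])
    show "(\<lambda>X. X \<otimes>\<^bsub>TA\<^esub> (c \<odot>\<^bsub>T\<^esub> Y)) \<in> linear_maps T T"
      using Y by (intro TA_mult_linear_left) simp
    show "(\<lambda>X. c \<odot>\<^bsub>T\<^esub> (X \<otimes>\<^bsub>TA\<^esub> Y)) \<in> linear_maps T T"
      by (rule linear_maps_scale[OF T.cspace_axioms TA_mult_linear_left[OF Y]])
    fix a b assume ab: "a \<in> carrier A" "b \<in> carrier B"
    show "pt a b \<otimes>\<^bsub>TA\<^esub> (c \<odot>\<^bsub>T\<^esub> Y) = c \<odot>\<^bsub>T\<^esub> (pt a b \<otimes>\<^bsub>TA\<^esub> Y)"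
      using ab Y by (simp add: pure_mult_lmult linear_scale[OF lmult_linear])
  qed
  fix Y' assume Y': "Y' \<in> carrier T"
  show "X \<otimes>\<^bsub>TA\<^esub> (Y \<oplus>\<^bsub>T\<^esub> Y') = (X \<otimes>\<^bsub>TA\<^esub> Y) \<oplus>\<^bsub>T\<^esub> (X \<otimes>\<^bsub>TA\<^esub> Y')"
  proof (rule tensor_ext[OF T.cspace_axioms _ _ _ X])
    show "(\<lambda>X. X \<otimes>\<^bsub>TA\<^esub> (Y \<oplus>\<^bsub>T\<^esub> Y')) \<in> linear_maps T T"
      using Y Y' by (intro TA_mult_linear_left) simp
    show "(\<lambda>X. (X \<otimes>\<^bsub>TA\<^esub> Y) \<oplus>\<^bsub>T\<^esub> (X \<otimes>\<^bsub>TA\<^esub> Y')) \<in> linear_maps T T"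
      by (rule linear_maps_add[OF T.cspace_axioms TA_mult_linear_left[OF Y] TA_mult_linear_left[OF Y']])
    fix a b assume ab: "a \<in> carrier A" "b \<in> carrier B"
    show "pt a b \<otimes>\<^bsub>TA\<^esub> (Y \<oplus>\<^bsub>T\<^esub> Y') = (pt a b \<otimes>\<^bsub>TA\<^esub> Y) \<oplus>\<^bsub>T\<^esub> (pt a b \<otimes>\<^bsub>TA\<^esub> Y')"
      using ab Y Y' by (simp add: pure_mult_lmult linear_add[OF lmult_linear])
  qed
qed

lemma TA_mult_assoc:
  assumes X: "X \<in> carrier T" and Y: "Y \<in> carrier T" and Z: "Z \<in> carrier T"
  shows "(X \<otimes>\<^bsub>TA\<^esub> Y) \<otimes>\<^bsub>TA\<^esub> Z = X \<otimes>\<^bsub>TA\<^esub> (Y \<otimes>\<^bsub>TA\<^esub> Z)"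
proof (rule tensor_ext[OF T.cspace_axioms _ _ _ X])
  show "(\<lambda>X. (X \<otimes>\<^bsub>TA\<^esub> Y) \<otimes>\<^bsub>TA\<^esub> Z) \<in> linear_maps T T"
    by (rule linear_comp[OF TA_mult_linear_left[OF Y] TA_mult_linear_left[OF Z]])
  show "(\<lambda>X. X \<otimes>\<^bsub>TA\<^esub> (Y \<otimes>\<^bsub>TA\<^esub> Z)) \<in> linear_maps T T"
    by (rule TA_mult_linear_left[OF TA_mult_closed[OF Y Z]])
  fix a b assume ab: "a \<in> carrier A" "b \<in> carrier B"
  then have P: "pt a b \<in> carrier T" by simp
  show "(pt a b \<otimes>\<^bsub>TA\<^esub> Y) \<otimes>\<^bsub>TA\<^esub> Z = pt a b \<otimes>\<^bsub>TA\<^esub> (Y \<otimes>\<^bsub>TA\<^esub> Z)"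
  proof (rule tensor_ext[OF T.cspace_axioms _ _ _ Y])
    show "(\<lambda>Y. (pt a b \<otimes>\<^bsub>TA\<^esub> Y) \<otimes>\<^bsub>TA\<^esub> Z) \<in> linear_maps T T"
      by (rule linear_comp[OF TA_mult_linear_right[OF P] TA_mult_linear_left[OF Z]])
    show "(\<lambda>Y. pt a b \<otimes>\<^bsub>TA\<^esub> (Y \<otimes>\<^bsub>TA\<^esub> Z)) \<in> linear_maps T T"
      by (rule linear_comp[OF TA_mult_linear_left[OF Z] TA_mult_linear_right[OF P]])
    fix a' b' assume ab': "a' \<in> carrier A" "b' \<in> carrier B"
    then have P': "pt a' b' \<in> carrier T" by simp
    show "(pt a b \<otimes>\<^bsub>TA\<^esub> pt a' b') \<otimes>\<^bsub>TA\<^esub> Z = pt a b \<otimes>\<^bsub>TA\<^esub> (pt a' b' \<otimes>\<^bsub>TA\<^esub> Z)"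
    proof (rule tensor_ext[OF T.cspace_axioms _ _ _ Z])
      show "(\<lambda>Z. (pt a b \<otimes>\<^bsub>TA\<^esub> pt a' b') \<otimes>\<^bsub>TA\<^esub> Z) \<in> linear_maps T T"
        by (rule TA_mult_linear_right[OF TA_mult_closed[OF P P']])
      show "(\<lambda>Z. pt a b \<otimes>\<^bsub>TA\<^esub> (pt a' b' \<otimes>\<^bsub>TA\<^esub> Z)) \<in> linear_maps T T"
        by (rule linear_comp[OF TA_mult_linear_right[OF P'] TA_mult_linear_right[OF P]])
    qed (use ab ab' in \<open>simp add: pure_mult A.m_assoc B.m_assoc\<close>)
  qed
qed

lemma TA_calgebra: "calgebra TA"
proof (rule calgebraI)
  show "cspace TA"
  proof (rule cspaceI)
    show "abelian_group TA"
      using T.abelian_group_axioms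
      by (simp add: abelian_group_def abelian_monoid_def abelian_group_axioms_def)
  qed (simp_all add: T.scale_left_distrib T.scale_right_distrib)
  show "\<one>\<^bsub>TA\<^esub> \<in> carrier TA" by simp
  show "\<one>\<^bsub>TA\<^esub> \<otimes>\<^bsub>TA\<^esub> X = X" if X: "X \<in> carrier TA" for X
  proof (rule tensor_ext[OF T.cspace_axioms _ linear_id, of "\<lambda>X. \<one>\<^bsub>TA\<^esub> \<otimes>\<^bsub>TA\<^esub> X"])
    show "(\<lambda>X. \<one>\<^bsub>TA\<^esub> \<otimes>\<^bsub>TA\<^esub> X) \<in> linear_maps T T"
      by (rule TA_mult_linear_right) simp
  qed (use X in \<open>simp_all add: pure_mult\<close>)
  show "X \<otimes>\<^bsub>TA\<^esub> \<one>\<^bsub>TA\<^esub> = X" if X: "X \<in> carrier TA" for X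
  proof (rule tensor_ext[OF T.cspace_axioms _ linear_id, of "\<lambda>X. X \<otimes>\<^bsub>TA\<^esub> \<one>\<^bsub>TA\<^esub>"])
    show "(\<lambda>X. X \<otimes>\<^bsub>TA\<^esub> \<one>\<^bsub>TA\<^esub>) \<in> linear_maps T T"
      by (rule TA_mult_linear_left) simp
  qed (use X in \<open>simp_all add: pure_mult\<close>)
qed (simp_all add: TA_mult_linear_left TA_mult_linear_right TA_mult_assoc)

end

section \<open>The quantum group\<close>

locale quantum_group =
  fixes q :: real
  assumes q_nonzero: "q \<noteq> 0"
begin

abbreviation A where "A \<equiv> SUq2 q"
abbreviation I where "I \<equiv> SUq2_ideal q"

lemma I_ideal: "ideal I free_alg"
  unfolding SUq2_ideal_def by (rule Fr.genideal_ideal) simp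

lemma I_rels: "SUq2_rels q \<subseteq> I"
  unfolding SUq2_ideal_def by (rule Fr.genideal_self) simp

lemma I_mult_left: "x \<in> I \<Longrightarrow> y * x \<in> I"
  using ideal.I_l_closed[OF I_ideal, of x y] by simp

lemma I_mult_right: "x \<in> I \<Longrightarrow> x * y \<in> I"
  using ideal.I_r_closed[OF I_ideal, of x y] by simp

lemma I_subspace: "subspace free_alg I"
proof -
  interpret I: ideal I free_alg by (rule I_ideal)
  have "submodule I complex_ring free_alg"
  proof (rule Fr.subspaceI)
    show "c \<odot>\<^bsub>free_alg\<^esub> x \<in> I" if "x \<in> I" for c x
      using I_mult_left[OF that, of "pm_scale c 1"] by (simp add: pm_scale_mult)
    show "\<zero>\<^bsub>free_alg\<^esub> \<in> I"
      by (rule I.zero_closed)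
    show "a \<oplus>\<^bsub>free_alg\<^esub> b \<in> I" if "a \<in> I" "b \<in> I" for a b
      using that by (rule I.a_closed)
  qed simp
  then show ?thesis
    by (intro subspace.intro subspace_axioms.intro Fr.cspace_axioms)
qed

interpretation Q: subspace free_alg I
  by (rule I_subspace)

lemma A_cspace: "cspace A"
  unfolding SUq2_def by (rule Q.quot_cspace)

lemma cls_linear: "cls q \<in> linear_maps free_alg A"
  using Q.proj_linear unfolding SUq2_def cls_def[abs_def] .

lemma A_carrier: "carrier A = range (cls q)"
  unfolding SUq2_def cls_def Q.quot_carrier by simp

lemma clsE:
  assumes "a \<in> carrier A"
  obtains p where "a = cls q p"
  using assms unfolding A_carrier by blast

lemma cls_closed [simp, intro]: "cls q p \<in> carrier A"
  by (simp add: A_carrier)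

lemma cls_add: "cls q (p + r) = cls q p \<oplus>\<^bsub>A\<^esub> cls q r"
  using linear_add[OF cls_linear, of p r] by simp

lemma cls_scale: "cls q (pm_scale c p) = c \<odot>\<^bsub>A\<^esub> cls q p"
  using linear_scale[OF cls_linear, of p c] by simp

lemma cls_zero: "cls q 0 = \<zero>\<^bsub>A\<^esub>"
  using linear_zero[OF Fr.cspace_axioms A_cspace cls_linear] by simp

lemma cls_mult: "cls q (p * r) = cls q p \<otimes>\<^bsub>A\<^esub> cls q r"
  using ideal.rcoset_mult_add[OF I_ideal, of p r]
  by (simp add: SUq2_def cls_def quot_module_def ring.defs module.defs FactRing_def)

lemma cls_one: "cls q 1 = \<one>\<^bsub>A\<^esub>"
  by (simp add: SUq2_def cls_def quot_module_def ring.defs module.defs FactRing_def)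

lemma cls_eq_iff: "cls q p = cls q r \<longleftrightarrow> p - r \<in> I"
proof -
  have "p \<ominus>\<^bsub>free_alg\<^esub> r = p - r"
    using Fr.minus_eq_scale[of r]
    by (simp add: a_minus_def) (auto intro!: poly_mapping_eqI simp: lookup_minus lookup_add)
  then show ?thesis
    unfolding cls_def by (subst Q.coset_eq_iff) simp_all
qed

lemma A_calgebra: "calgebra A"
proof (rule calgebraI)
  show "cspace A" by (rule A_cspace)
  show "\<one>\<^bsub>A\<^esub> \<in> carrier A"
    unfolding cls_one[symmetric] by simp
  fix x assume "x \<in> carrier A"
  then obtain p where x: "x = cls q p" by (rule clsE)
  show "\<one>\<^bsub>A\<^esub> \<otimes>\<^bsub>A\<^esub> x = x" "x \<otimes>\<^bsub>A\<^esub> \<one>\<^bsub>A\<^esub> = x"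
    unfolding x cls_one[symmetric] cls_mult[symmetric] by simp_all
  show "(\<lambda>y. x \<otimes>\<^bsub>A\<^esub> y) \<in> linear_maps A A"
  proof (rule linear_mapsI)
    fix y assume "y \<in> carrier A"
    then obtain r where y: "y = cls q r" by (rule clsE)
    show "x \<otimes>\<^bsub>A\<^esub> y \<in> carrier A"
      unfolding x y cls_mult[symmetric] by simp
    show "x \<otimes>\<^bsub>A\<^esub> (c \<odot>\<^bsub>A\<^esub> y) = c \<odot>\<^bsub>A\<^esub> (x \<otimes>\<^bsub>A\<^esub> y)" for c
      unfolding x y cls_mult[symmetric] cls_scale[symmetric] by (simp add: pm_scale_mult)
    fix z assume "z \<in> carrier A"
    then obtain s where z: "z = cls q s" by (rule clsE)
    show "x \<otimes>\<^bsub>A\<^esub> (y \<oplus>\<^bsub>A\<^esub> z) = x \<otimes>\<^bsub>A\<^esub> y \<oplus>\<^bsub>A\<^esub> x \<otimes>\<^bsub>A\<^esub> z"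
      unfolding x y z cls_mult[symmetric] cls_add[symmetric] by (simp add: distrib_left)
  qed
  show "(\<lambda>y. y \<otimes>\<^bsub>A\<^esub> x) \<in> linear_maps A A"
  proof (rule linear_mapsI)
    fix y assume "y \<in> carrier A"
    then obtain r where y: "y = cls q r" by (rule clsE)
    show "y \<otimes>\<^bsub>A\<^esub> x \<in> carrier A"
      unfolding x y cls_mult[symmetric] by simp
    show "(c \<odot>\<^bsub>A\<^esub> y) \<otimes>\<^bsub>A\<^esub> x = c \<odot>\<^bsub>A\<^esub> (y \<otimes>\<^bsub>A\<^esub> x)" for c
      unfolding x y cls_mult[symmetric] cls_scale[symmetric] by (simp add: pm_scale_mult)
    fix z assume "z \<in> carrier A"
    then obtain s where z: "z = cls q s" by (rule clsE)
    show "(y \<oplus>\<^bsub>A\<^esub> z) \<otimes>\<^bsub>A\<^esub> x = y \<otimes>\<^bsub>A\<^esub> x \<oplus>\<^bsub>A\<^esub> z \<otimes>\<^bsub>A\<^esub> x"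
      unfolding x y z cls_mult[symmetric] cls_add[symmetric] by (simp add: distrib_right)
  qed
  fix y z assume "y \<in> carrier A" "z \<in> carrier A"
  then obtain r s where yz: "y = cls q r" "z = cls q s" by (metis clsE)
  show "x \<otimes>\<^bsub>A\<^esub> y \<otimes>\<^bsub>A\<^esub> z = x \<otimes>\<^bsub>A\<^esub> (y \<otimes>\<^bsub>A\<^esub> z)"
    unfolding x yz cls_mult[symmetric] by (simp add: mult.assoc)
qed

sublocale A: calgebra A
  by (rule A_calgebra)

sublocale AA: tensor_algebra A A
  by unfold_locales

text \<open>The universal property of the presentation: an assignment on generators that respects the
  relations is well defined on the quantum group.\<close>

lemma hom_lift:
  assumes "calgebra B" "\<And>x. f x \<in> carrier B"
    and rels: "\<And>r. r \<in> SUq2_rels q \<Longrightarrow> alg_ext B f r = \<zero>\<^bsub>B\<^esub>"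
  shows "the_elem (alg_ext B f ` cls q p) = alg_ext B f p"
proof -
  interpret B: calgebra B by fact
  have "I \<subseteq> {p. alg_ext B f p = \<zero>\<^bsub>B\<^esub>}"
    unfolding SUq2_ideal_def
    by (rule Fr.genideal_minimal[OF B.alg_ext_kernel_ideal[OF assms(2)]]) (use rels in auto)
  then have null: "\<And>x. x \<in> I \<Longrightarrow> alg_ext B f x = \<zero>\<^bsub>B\<^esub>" by blast
  show ?thesis
    unfolding cls_def
    by (rule Q.quot_lift(2)[OF B.cspace_axioms B.alg_ext_linear[OF assms(2)] null]) simp_all
qed

text \<open>Every product of two generators is rewritten in terms of
  \<open>1\<close>, \<open>\<beta>\<alpha>\<close>, \<open>\<gamma>\<alpha>\<close>, \<open>\<beta>\<gamma>\<close>, \<open>\<delta>\<beta>\<close>, \<open>\<delta>\<gamma>\<close> and squares.\<close>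

lemma cls_rels:
  "cls q (\<alpha> * \<beta>) = cls q (q \<cdot> (\<beta> * \<alpha>))"
  "cls q (\<alpha> * \<gamma>) = cls q (q \<cdot> (\<gamma> * \<alpha>))"
  "cls q (\<alpha> * \<delta>) = cls q (1 + q \<cdot> (\<beta> * \<gamma>))"
  "cls q (\<delta> * \<alpha>) = cls q (1 + inverse q \<cdot> (\<beta> * \<gamma>))"
  "cls q (\<gamma> * \<beta>) = cls q (\<beta> * \<gamma>)"
  "cls q (\<beta> * \<delta>) = cls q (q \<cdot> (\<delta> * \<beta>))"
  "cls q (\<gamma> * \<delta>) = cls q (q \<cdot> (\<delta> * \<gamma>))"
proof -
  note r = subsetD[OF I_rels]
  show ad: "cls q (\<alpha> * \<delta>) = cls q (1 + q \<cdot> (\<beta> * \<gamma>))"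
    unfolding cls_eq_iff by (rule r) (simp add: SUq2_rels_def algebra_simps)
  have "cls q (\<alpha> * \<delta>) = cls q (\<delta> * \<alpha> + (q - inverse q) \<cdot> (\<beta> * \<gamma>))"
    unfolding cls_eq_iff by (rule r) (simp add: SUq2_rels_def)
  moreover have "cls q (\<delta> * \<alpha>) = cls q (\<delta> * \<alpha> + (q - inverse q) \<cdot> (\<beta> * \<gamma>)) \<oplus>\<^bsub>A\<^esub>
    cls q ((inverse q - q) \<cdot> (\<beta> * \<gamma>))"
    unfolding cls_add[symmetric]
    by (rule arg_cong[of _ _ "cls q"], rule poly_mapping_eqI) (simp add: lookup_add algebra_simps)
  moreover have "cls q (1 + inverse q \<cdot> (\<beta> * \<gamma>)) = cls q (1 + q \<cdot> (\<beta> * \<gamma>)) \<oplus>\<^bsub>A\<^esub>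
    cls q ((inverse q - q) \<cdot> (\<beta> * \<gamma>))"
    unfolding cls_add[symmetric]
    by (rule arg_cong[of _ _ "cls q"], rule poly_mapping_eqI) (simp add: lookup_add algebra_simps)
  ultimately show "cls q (\<delta> * \<alpha>) = cls q (1 + inverse q \<cdot> (\<beta> * \<gamma>))"
    using ad by simp
  have "\<beta> * \<gamma> - \<gamma> * \<beta> \<in> I"
    by (rule r) (simp add: SUq2_rels_def)
  then show "cls q (\<gamma> * \<beta>) = cls q (\<beta> * \<gamma>)"
    using cls_eq_iff[of "\<beta> * \<gamma>" "\<gamma> * \<beta>"] by simp
qed (rule cls_eq_iff[THEN iffD2], rule subsetD[OF I_rels], simp add: SUq2_rels_def)+


subsection \<open>The coproduct is a well-defined algebra map\<close>

abbreviation T where "T \<equiv> tensor A A"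
abbreviation TA where "TA \<equiv> tensor_alg A A"
abbreviation P where "P x y \<equiv> pure_tensor A A (cls q x) (cls q y)"

lemma comult_gen_closed: "comult_gen q x \<in> carrier TA"
  by (cases x) simp_all

sublocale TA: calgebra TA
  by (rule AA.TA_calgebra)

abbreviation \<Delta> where "\<Delta> \<equiv> alg_ext TA (comult_gen q)"

lemmas Delta_mult = TA.alg_ext_mult[OF comult_gen_closed]
lemmas Delta_gen = TA.alg_ext_generator[OF comult_gen_closed]
lemma Delta_one: "\<Delta> 1 = P 1 1"
  using TA.alg_ext_one[OF comult_gen_closed] by (simp add: cls_one)

lemma Delta_linear: "\<Delta> \<in> linear_maps free_alg T"
  using TA.alg_ext_linear[OF comult_gen_closed] by simp

lemma Delta_closed [simp, intro]: "\<Delta> p \<in> carrier T"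
  using TA.alg_ext_closed[OF comult_gen_closed, where p = p] by simp

lemma Delta_add: "\<Delta> (p + r) = \<Delta> p \<oplus>\<^bsub>T\<^esub> \<Delta> r"
  using linear_add[OF Delta_linear, of p r] by simp

lemma Delta_scale: "\<Delta> (pm_scale c p) = c \<odot>\<^bsub>T\<^esub> \<Delta> p"
  using linear_scale[OF Delta_linear, of p c] by simp

lemma Delta_eqD:
  assumes "\<Delta> p = \<Delta> r"
  shows "\<Delta> (p - r) = \<zero>\<^bsub>TA\<^esub>"
proof -
  have "p - r = p + pm_scale (- 1) r"
    by (rule diff_conv_scale)
  then have "\<Delta> (p - r) = 1 \<odot>\<^bsub>T\<^esub> \<Delta> r \<oplus>\<^bsub>T\<^esub> (- 1) \<odot>\<^bsub>T\<^esub> \<Delta> r"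
    using assms by (simp only: Delta_add Delta_scale AA.T.scale_one Delta_closed)
  also have "\<dots> = \<zero>\<^bsub>TA\<^esub>"
    unfolding AA.T.scale_left_distrib[OF Delta_closed, symmetric] by simp
  finally show ?thesis .
qed

lemma P_mult: "P a b \<otimes>\<^bsub>TA\<^esub> P c d = P (a * c) (b * d)"
  by (simp add: AA.pure_mult cls_mult)

lemma P_sum_mult:
  "(P a b \<oplus>\<^bsub>T\<^esub> P c d) \<otimes>\<^bsub>TA\<^esub> (P a' b' \<oplus>\<^bsub>T\<^esub> P c' d') =
    (P (a * a') (b * b') \<oplus>\<^bsub>T\<^esub> P (c * a') (d * b')) \<oplus>\<^bsub>T\<^esub>
    (P (a * c') (b * d') \<oplus>\<^bsub>T\<^esub> P (c * c') (d * d'))"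
  using TA.l_distr[of "P a b" "P c d" "P a' b'"] TA.l_distr[of "P a b" "P c d" "P c' d'"]
    TA.r_distr[of "P a' b'" "P c' d'" "P a b \<oplus>\<^bsub>T\<^esub> P c d"]
  by (simp add: P_mult)

lemma P_add:
  "P (x + x') y = P x y \<oplus>\<^bsub>T\<^esub> P x' y" "P x (y + y') = P x y \<oplus>\<^bsub>T\<^esub> P x y'"
  by (simp_all add: cls_add AA.pure_add_left AA.pure_add_right)

lemma P_scale:
  "P (pm_scale c x) y = c \<odot>\<^bsub>T\<^esub> P x y" "P x (pm_scale c y) = c \<odot>\<^bsub>T\<^esub> P x y"
  by (simp_all add: cls_scale AA.pure_scale_left AA.pure_scale_right)

lemmas Delta_rel_simps = Delta_mult Delta_gen comult_gen.simps P_sum_mult Delta_add Delta_scale Delta_one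

lemma Delta_rels:
  assumes "r \<in> SUq2_rels q"
  shows "\<Delta> r = \<zero>\<^bsub>TA\<^esub>"
proof -
  note fs = AA.collect_formal cls_closed
  note fin = lookup_add lookup_single_ind
  \<comment> \<open>Each relation is multiplied out, both tensor legs are brought to normal form, and the
    coefficients of the resulting formal sums are compared.\<close>
  have e: "\<Delta> (\<alpha> * \<beta>) = \<Delta> (q \<cdot> (\<beta> * \<alpha>))"
    "\<Delta> (\<alpha> * \<gamma>) = \<Delta> (q \<cdot> (\<gamma> * \<alpha>))"
    "\<Delta> (\<alpha> * \<delta>) = \<Delta> (\<delta> * \<alpha> + (q - inverse q) \<cdot> (\<beta> * \<gamma>))"
    "\<Delta> (\<beta> * \<gamma>) = \<Delta> (\<gamma> * \<beta>)"
    "\<Delta> (\<beta> * \<delta>) = \<Delta> (q \<cdot> (\<delta> * \<beta>))"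
    "\<Delta> (\<gamma> * \<delta>) = \<Delta> (q \<cdot> (\<delta> * \<gamma>))"
    "\<Delta> (\<alpha> * \<delta> + (- q) \<cdot> (\<beta> * \<gamma>)) = \<Delta> 1"
    unfolding Delta_rel_simps
    by (simp only: cls_rels P_add P_scale, simp only: fs,
        rule arg_cong[of _ _ AA.formal], rule poly_mapping_eqI,
        simp add: fin q_nonzero field_simps)+
  have minus: "\<alpha> * \<delta> - q \<cdot> (\<beta> * \<gamma>) = \<alpha> * \<delta> + (- q) \<cdot> (\<beta> * \<gamma>)"
    by (rule poly_mapping_eqI) (simp add: lookup_minus lookup_add)
  show ?thesis
    using assms unfolding SUq2_rels_def minus
    by (elim insertE emptyE) (simp_all only: Delta_eqD e)
qed

lemma comult_cls: "comult q (cls q p) = \<Delta> p"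
  unfolding comult_def by (rule hom_lift[OF AA.TA_calgebra comult_gen_closed Delta_rels])

lemma comult_linear: "comult q \<in> linear_maps A T"
proof (rule linear_mapsI)
  fix x assume "x \<in> carrier A"
  then obtain p where x: "x = cls q p" by (rule clsE)
  show "comult q x \<in> carrier T" "comult q (c \<odot>\<^bsub>A\<^esub> x) = c \<odot>\<^bsub>T\<^esub> comult q x" for c
    unfolding x cls_scale[symmetric] comult_cls by (simp_all add: Delta_scale)
  fix y assume "y \<in> carrier A"
  then obtain r where y: "y = cls q r" by (rule clsE)
  show "comult q (x \<oplus>\<^bsub>A\<^esub> y) = comult q x \<oplus>\<^bsub>T\<^esub> comult q y"
    unfolding x y cls_add[symmetric] comult_cls by (rule Delta_add)
qed

end

section \<open>The quotient coalgebra as a right module\<close>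

text \<open>The projection onto the line through \<open>(1, t)\<close>, with matrix entries named after the matrix
  of generators, and the complementary projection.\<close>

fun up_coeff :: "gen \<Rightarrow> real \<Rightarrow> real" where
  "up_coeff Gen_alpha t = 1 / (1 + t\<^sup>2)"
| "up_coeff Gen_beta t = t / (1 + t\<^sup>2)"
| "up_coeff Gen_gamma t = t / (1 + t\<^sup>2)"
| "up_coeff Gen_delta t = t\<^sup>2 / (1 + t\<^sup>2)"

fun down_coeff :: "gen \<Rightarrow> real \<Rightarrow> real" where
  "down_coeff Gen_alpha t = t\<^sup>2 / (1 + t\<^sup>2)"
| "down_coeff Gen_beta t = - t / (1 + t\<^sup>2)"
| "down_coeff Gen_gamma t = - t / (1 + t\<^sup>2)"
| "down_coeff Gen_delta t = 1 / (1 + t\<^sup>2)"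

lemma one_plus_square: "1 + t\<^sup>2 \<noteq> (0 :: real)"
  using zero_le_power2[of t] by linarith

locale quantum_sphere = quantum_group +
  fixes s :: real
begin

abbreviation J where "J \<equiv> sphere_J q s"
abbreviation C where "C \<equiv> sphere_C q s"

lemma J_least:
  assumes "additive_subgroup N A" "\<And>x r. \<lbrakk>x \<in> N; r \<in> carrier A\<rbrakk> \<Longrightarrow> x \<otimes>\<^bsub>A\<^esub> r \<in> N"
    "cls q (xi q s - s \<cdot> 1) \<in> N" "cls q (eta q s + s \<cdot> 1) \<in> N" "cls q (zeta q s) \<in> N"
  shows "J \<subseteq> N"
  unfolding sphere_J_def right_ideal_gen_def
  by (rule Inter_lower) (use assms in simp)

lemma carrier_additive_subgroup: "additive_subgroup (carrier A) A"
  using A.carrier_is_submodule submodule.axioms(1) by (intro additive_subgroup.intro) blast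

lemma J_subset: "J \<subseteq> carrier A"
  by (rule J_least[OF carrier_additive_subgroup]) auto

lemma J_right: "\<lbrakk>x \<in> J; r \<in> carrier A\<rbrakk> \<Longrightarrow> x \<otimes>\<^bsub>A\<^esub> r \<in> J"
  unfolding sphere_J_def right_ideal_gen_def by blast

text \<open>Negation is right multiplication by \<open>-1\<close>, so closure of \<open>J\<close> under it comes from \<open>J\<close> being a right
  ideal.\<close>

lemma J_additive_subgroup: "additive_subgroup J A"
proof (rule additive_subgroup.intro, rule A.add.subgroupI)
  show "J \<subseteq> carrier A" by (rule J_subset)
  have *: "x \<in> J \<longleftrightarrow> (\<forall>N. additive_subgroup N A \<and> (\<forall>x\<in>N. \<forall>r\<in>carrier A. x \<otimes>\<^bsub>A\<^esub> r \<in> N) \<and>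
    {cls q (xi q s - s \<cdot> 1), cls q (eta q s + s \<cdot> 1), cls q (zeta q s)} \<subseteq> N \<longrightarrow> x \<in> N)" for x
    unfolding sphere_J_def right_ideal_gen_def by blast
  have "\<zero>\<^bsub>A\<^esub> \<in> J"
    unfolding * using additive_subgroup.zero_closed by blast
  then show "J \<noteq> {}" by blast
  show "\<ominus>\<^bsub>A\<^esub> x \<in> J" if "x \<in> J" for x
  proof -
    have x: "x \<in> carrier A"
      using that J_subset by blast
    have "x \<otimes>\<^bsub>A\<^esub> ((- 1) \<odot>\<^bsub>A\<^esub> \<one>\<^bsub>A\<^esub>) \<in> J"
      by (rule J_right[OF that]) simp
    then show ?thesis
      unfolding A.minus_eq_scale[OF x] A.mult_scale_right[OF x A.one_closed] A.r_one[OF x] .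
  qed
  show "x \<oplus>\<^bsub>A\<^esub> y \<in> J" if "x \<in> J" "y \<in> J" for x y
    unfolding *
  proof (intro allI impI, elim conjE)
    fix N assume N: "additive_subgroup N A" "\<forall>x\<in>N. \<forall>r\<in>carrier A. x \<otimes>\<^bsub>A\<^esub> r \<in> N"
      "{cls q (xi q s - s \<cdot> 1), cls q (eta q s + s \<cdot> 1), cls q (zeta q s)} \<subseteq> N"
    with that have "x \<in> N" "y \<in> N"
      unfolding * by blast+
    then show "x \<oplus>\<^bsub>A\<^esub> y \<in> N"
      by (rule additive_subgroup.a_closed[OF N(1)])
  qed
qed

lemma J_gens: "cls q (xi q s - s \<cdot> 1) \<in> J" "cls q (eta q s + s \<cdot> 1) \<in> J" "cls q (zeta q s) \<in> J"
  unfolding sphere_J_def right_ideal_gen_def by blast+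

lemma J_subspace: "subspace A J"
proof -
  have "submodule J complex_ring A"
  proof (rule A.subspaceI)
    show "J \<subseteq> carrier A" by (rule J_subset)
    show "\<zero>\<^bsub>A\<^esub> \<in> J" by (rule additive_subgroup.zero_closed[OF J_additive_subgroup])
    show "a \<oplus>\<^bsub>A\<^esub> b \<in> J" if "a \<in> J" "b \<in> J" for a b
      by (rule additive_subgroup.a_closed[OF J_additive_subgroup that])
    show "c \<odot>\<^bsub>A\<^esub> x \<in> J" if x: "x \<in> J" for c x
    proof -
      have "x \<otimes>\<^bsub>A\<^esub> (c \<odot>\<^bsub>A\<^esub> \<one>\<^bsub>A\<^esub>) \<in> J"
        by (rule J_right[OF x]) simp
      then show ?thesis
        using x J_subset by (simp add: A.mult_scale_right subset_iff)
    qed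
  qed
  then show ?thesis
    by (intro subspace.intro subspace_axioms.intro A.cspace_axioms)
qed

sublocale J: subspace A J
  by (rule J_subspace)

sublocale C: cspace C
  unfolding sphere_C_def by (rule J.quot_cspace)

lemma proj_linear: "proj q s \<in> linear_maps A C"
  using J.proj_linear unfolding sphere_C_def proj_def[abs_def] .

definition \<pi> where "\<pi> p = proj q s (cls q p)"

lemma pi_linear: "\<pi> \<in> linear_maps free_alg C"
  using linear_comp[OF cls_linear proj_linear] unfolding \<pi>_def[abs_def] .

lemma pi_closed [simp, intro]: "\<pi> p \<in> carrier C"
  by (rule linear_closed[OF pi_linear]) simp

lemma pi_add: "\<pi> (p + r) = \<pi> p \<oplus>\<^bsub>C\<^esub> \<pi> r"
  using linear_add[OF pi_linear, of p r] by simp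

lemma pi_scale: "\<pi> (pm_scale c p) = c \<odot>\<^bsub>C\<^esub> \<pi> p"
  using linear_scale[OF pi_linear, of p c] by simp

lemma piE:
  assumes "c \<in> carrier C"
  obtains p where "c = \<pi> p"
proof -
  obtain a where "a \<in> carrier A" "c = proj q s a"
    using assms unfolding sphere_C_def proj_def by (rule J.quotE)
  moreover from this(1) obtain p where "a = cls q p" by (rule clsE)
  ultimately show ?thesis using that by (simp add: \<pi>_def)
qed

text \<open>The congruences defining \<open>C\<close> can be computed in the free algebra, where
  the preimage of \<open>J\<close> is a right ideal.\<close>

definition K where "K = {p. cls q p \<in> J}"

lemma K_add: "\<lbrakk>p \<in> K; r \<in> K\<rbrakk> \<Longrightarrow> p + r \<in> K"
  by (simp add: K_def cls_add J.N_add)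

lemma K_scale: "p \<in> K \<Longrightarrow> pm_scale c p \<in> K"
  by (simp add: K_def cls_scale J.N_scale)

lemma K_right: "p \<in> K \<Longrightarrow> p * r \<in> K"
  by (simp add: K_def cls_mult J_right)

lemma I_K: "p \<in> I \<Longrightarrow> p \<in> K"
  using cls_eq_iff[of p 0] J.N_zero by (simp add: K_def cls_zero)

lemma K_gens: "xi q s - s \<cdot> 1 \<in> K" "eta q s + s \<cdot> 1 \<in> K" "zeta q s \<in> K"
  using J_gens by (simp_all add: K_def)

lemma pi_eq_iff: "\<pi> p = \<pi> r \<longleftrightarrow> p - r \<in> K"
proof -
  have "p - r = p + pm_scale (- 1) r"
    by (rule diff_conv_scale)
  then have "cls q (p - r) = cls q p \<ominus>\<^bsub>A\<^esub> cls q r"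
    by (simp only: cls_add cls_scale a_minus_def A.minus_eq_scale cls_closed)
  then show ?thesis
    unfolding \<pi>_def proj_def K_def by (subst J.coset_eq_iff) simp_all
qed

text \<open>The right action of the quantum group on \<open>C\<close>, for an acting element given as a noncommutative
  polynomial.\<close>

definition ract where "ract r c = the_elem ((\<lambda>a. proj q s (a \<otimes>\<^bsub>A\<^esub> cls q r)) ` c)"

lemma
  shows ract_linear: "ract r \<in> linear_maps C C"
    and ract_pi: "ract r (\<pi> p) = \<pi> (p * r)"
proof -
  have lin: "(\<lambda>a. proj q s (a \<otimes>\<^bsub>A\<^esub> cls q r)) \<in> linear_maps A C"
    by (rule linear_comp[OF A.mult_linear_left proj_linear]) simp
  have zero: "proj q s (x \<otimes>\<^bsub>A\<^esub> cls q r) = \<zero>\<^bsub>C\<^esub>" if "x \<in> J" for x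
  proof -
    have xr: "x \<otimes>\<^bsub>A\<^esub> cls q r \<in> J"
      using that by (rule J_right) simp
    have "proj q s (x \<otimes>\<^bsub>A\<^esub> cls q r) = proj q s \<zero>\<^bsub>A\<^esub>"
      unfolding proj_def using J.a_rcos_const[OF xr] J.a_rcos_const[OF J.N_zero] by simp
    then show ?thesis
      using linear_zero[OF A.cspace_axioms C.cspace_axioms proj_linear] by simp
  qed
  show "ract r \<in> linear_maps C C"
    using J.quot_lift(1)[OF C.cspace_axioms lin zero]
    unfolding ract_def[abs_def] by (simp add: sphere_C_def)
  show "ract r (\<pi> p) = \<pi> (p * r)"
    using J.quot_lift(2)[OF C.cspace_axioms lin zero, of "cls q p"]
    unfolding ract_def \<pi>_def by (simp add: proj_def cls_mult)
qed

subsection \<open>Congruences\<close>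

abbreviation "rel1 \<equiv> \<alpha> * \<beta> - q \<cdot> (\<beta> * \<alpha>)"
abbreviation "rel2 \<equiv> \<alpha> * \<gamma> - q \<cdot> (\<gamma> * \<alpha>)"
abbreviation "rel3 \<equiv> \<alpha> * \<delta> - (\<delta> * \<alpha> + (q - inverse q) \<cdot> (\<beta> * \<gamma>))"
abbreviation "rel4 \<equiv> \<beta> * \<gamma> - \<gamma> * \<beta>"
abbreviation "rel5 \<equiv> \<beta> * \<delta> - q \<cdot> (\<delta> * \<beta>)"
abbreviation "rel6 \<equiv> \<gamma> * \<delta> - q \<cdot> (\<delta> * \<gamma>)"
abbreviation "rel7 \<equiv> \<alpha> * \<delta> - q \<cdot> (\<beta> * \<gamma>) - 1"

lemma rels_I: "rel1 \<in> I" "rel2 \<in> I" "rel3 \<in> I" "rel4 \<in> I" "rel5 \<in> I" "rel6 \<in> I" "rel7 \<in> I"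
  by (rule subsetD[OF I_rels], simp add: SUq2_rels_def)+

lemma I_add: "\<lbrakk>p \<in> I; r \<in> I\<rbrakk> \<Longrightarrow> p + r \<in> I"
  using subspace.N_add[OF I_subspace, of p r] by simp

lemma I_scale: "p \<in> I \<Longrightarrow> pm_scale c p \<in> I"
  using subspace.N_scale[OF I_subspace, of p c] by simp

lemmas free_expand = distrib_left distrib_right left_diff_distrib right_diff_distrib
  pm_scale_mult pm_scale_distrib mult_single plus_word_def
lemmas free_lookup = lookup_add lookup_minus lookup_single_ind

text \<open>Together with \<open>\<beta> - \<gamma>\<close>, this expression vanishes on a commutative 2-by-2 matrix exactly if
  the matrix is symmetric with eigenvector \<open>(1, t)\<close>.\<close>

abbreviation E where "E t \<equiv> t \<cdot> \<delta> - t \<cdot> \<alpha> + (1 - t\<^sup>2) \<cdot> \<beta>"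

text \<open>Let \<open>U\<close> be the matrix of generators and \<open>N\<close> the matrix with rows \<open>(s, 0)\<close> and
  \<open>(s\<^sup>2 - 1, - s / q)\<close>.  In the quantum group, \<open>U N U\<^sup>T\<close> has the entries \<open>\<xi>\<close>, \<open>\<zeta> / q\<close>,
  \<open>\<zeta> / q\<^sup>2 + s\<^sup>2 - 1\<close> and \<open>\<eta> / q\<close>, so it agrees with \<open>N\<close> modulo the generators of \<open>J\<close>.
  Multiplying from the right by the inverse of \<open>U\<^sup>T\<close> leaves identities that are linear in \<open>U\<close>.
  The next three lemmas are these identities with their error terms in the ideal of relations
  written out.\<close>

lemma base_E_identity:
  "(xi q s - s \<cdot> 1) * \<delta> - zeta q s * \<beta> = (-1) \<cdot> E s +
    (s \<cdot> (\<alpha> * (rel7 + q \<cdot> rel4)) + (- s * inverse q) \<cdot> (\<beta> * rel5) +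
     ((s\<^sup>2 - 1) * inverse q) \<cdot> (rel1 * \<delta>) + (s\<^sup>2 - 1) \<cdot> (\<beta> * (rel7 + q \<cdot> rel4)))"
  unfolding xi_def eta_def zeta_def
  by (rule poly_mapping_eqI) (simp add: free_expand free_lookup q_nonzero field_simps)

lemma base_beta_gamma_identity:
  "(xi q s - s \<cdot> 1) * \<gamma> - zeta q s * \<alpha> = s \<cdot> (\<beta> - \<gamma>) +
    (s \<cdot> (\<alpha> * rel2) + s \<cdot> (\<beta> * (rel7 - rel3)) +
     ((s\<^sup>2 - 1) * inverse q) \<cdot> (rel1 * \<gamma> + q \<cdot> (\<beta> * rel2)))"
  unfolding xi_def eta_def zeta_def
  by (rule poly_mapping_eqI) (simp add: free_expand free_lookup q_nonzero field_simps)

lemma base_gamma_E_identity: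
  "(eta q s + s \<cdot> 1) * \<alpha> - (inverse q ^ 2) \<cdot> (zeta q s * \<gamma>) =
    (s \<cdot> \<alpha> + (s\<^sup>2 - 1) \<cdot> \<gamma> - s \<cdot> \<delta>) +
    ((- s * inverse q) \<cdot> (rel2 * \<gamma> + q \<cdot> (\<gamma> * rel2)) + (- s) \<cdot> (\<delta> * (rel7 - rel3)) +
     (s * inverse q ^ 2) \<cdot> (rel5 * \<gamma>) + (s\<^sup>2 - 1) \<cdot> (\<gamma> * (rel7 - rel3) - inverse q \<cdot> (rel4 * \<gamma>)))"
  unfolding xi_def eta_def zeta_def
  by (rule poly_mapping_eqI)
    (simp add: free_expand free_lookup q_nonzero field_simps power2_eq_square)

text \<open>In the following identities the left factor moves past \<open>\<beta> - \<gamma>\<close> and \<open>E\<close>: up to the last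
  summand, a combination of relators, the right-hand sides lie in the right ideal generated by
  \<open>\<beta> - \<gamma>\<close> and \<open>E t\<close>, plus \<open>1\<close> in the cases of \<open>up_inverse\<close> and \<open>down_inverse\<close>.\<close>

lemma up_beta_gamma:
  "(\<alpha> + t \<cdot> \<beta>) * (\<beta> - \<gamma>) = (\<beta> - \<gamma>) * (q \<cdot> \<alpha> + t \<cdot> \<beta>) + (rel1 - rel2 - t \<cdot> rel4)"
  by (rule poly_mapping_eqI) (simp add: free_expand free_lookup algebra_simps)

lemma up_E:
  "(\<alpha> + t \<cdot> \<beta>) * E (q * t) =
    E t * (q \<cdot> \<alpha> + (q\<^sup>2 * t) \<cdot> \<beta>) + (\<beta> - \<gamma>) * ((t * (1 - q\<^sup>2)) \<cdot> \<beta>) +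
    (rel1 + (q * t) \<cdot> rel3 + (q * t\<^sup>2) \<cdot> rel5 + (t * (q\<^sup>2 - 1)) \<cdot> rel4)"
  by (rule poly_mapping_eqI)
    (simp add: free_expand free_lookup q_nonzero field_simps power2_eq_square)

lemma up_inverse:
  "(\<alpha> + t \<cdot> \<beta>) * (\<delta> - (q * t) \<cdot> \<gamma>) =
    1 + E t * (q \<cdot> \<gamma>) + (\<beta> - \<gamma>) * (t \<cdot> \<delta>) + (rel7 + t \<cdot> rel6)"
  by (rule poly_mapping_eqI)
    (simp add: free_expand free_lookup q_nonzero field_simps power2_eq_square)

lemma down_beta_gamma:
  "(\<delta> - t \<cdot> \<gamma>) * (\<beta> - \<gamma>) =
    (\<beta> - \<gamma>) * (inverse q \<cdot> \<delta> - t \<cdot> \<gamma>) +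
    ((- inverse q) \<cdot> rel5 + inverse q \<cdot> rel6 + t \<cdot> rel4)"
  by (rule poly_mapping_eqI)
    (simp add: free_expand free_lookup q_nonzero field_simps power2_eq_square)

lemma down_E:
  assumes "t = q * u"
  shows "(\<delta> - t \<cdot> \<gamma>) * E u =
    E t * (inverse q \<cdot> \<delta> - (u * inverse q) \<cdot> \<gamma>) + (\<beta> - \<gamma>) * ((inverse q * (t\<^sup>2 - u\<^sup>2)) \<cdot> \<delta>) +
    ((- t * u * inverse q) \<cdot> rel2 + u \<cdot> rel3 + (t * (1 - u\<^sup>2)) \<cdot> rel4 +
     (- (1 - u\<^sup>2) * inverse q) \<cdot> rel5 + (- t * u * inverse q ^ 2) \<cdot> rel6)"
  unfolding assms
  by (rule poly_mapping_eqI)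
    (simp add: free_expand free_lookup q_nonzero field_simps power2_eq_square)

lemma down_inverse:
  assumes "t = q * u"
  shows "(\<delta> - t \<cdot> \<gamma>) * (\<alpha> + u \<cdot> \<beta>) =
    1 + E t * (inverse q \<cdot> \<beta>) +
    (\<beta> - \<gamma>) * (t \<cdot> \<alpha> - (inverse q * (1 - t\<^sup>2)) \<cdot> \<beta>) +
    (rel7 - rel3 + u \<cdot> rel1 + inverse q \<cdot> rel4)"
  unfolding assms
  by (rule poly_mapping_eqI)
    (simp add: free_expand free_lookup q_nonzero field_simps power2_eq_square)

lemma pm_scale_cancel: "a * b = 1 \<Longrightarrow> pm_scale a (pm_scale b p) = p"
  by (simp only: pm_scale_distrib)

lemma K_diff: "\<lbrakk>p \<in> K; r \<in> K\<rbrakk> \<Longrightarrow> p - r \<in> K"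
proof -
  assume "p \<in> K" "r \<in> K"
  moreover have "p - r = p + pm_scale (- 1) r"
    by (rule diff_conv_scale)
  ultimately show ?thesis
    using K_add K_scale by metis
qed

lemma I_diff: "\<lbrakk>p \<in> I; r \<in> I\<rbrakk> \<Longrightarrow> p - r \<in> I"
proof -
  assume "p \<in> I" "r \<in> I"
  moreover have "p - r = p + pm_scale (- 1) r"
    by (rule diff_conv_scale)
  ultimately show ?thesis
    using I_add I_scale by metis
qed

lemmas rel_sums_I = I_diff[OF rels_I(7,3)] I_add[OF rels_I(7) I_scale[OF rels_I(4)]]

text \<open>The rules that close a whole relator come first: a relator is itself a difference, and splitting it
  would lead to false goals.\<close>

lemmas I_intros =
  rels_I rels_I[THEN I_mult_left] rels_I[THEN I_mult_right]
  rel_sums_I rel_sums_I[THEN I_mult_left] I_add I_scale I_diff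

lemma E_s_K: "E s \<in> K"
proof -
  let ?i = "s \<cdot> (\<alpha> * (rel7 + q \<cdot> rel4)) + (- s * inverse q) \<cdot> (\<beta> * rel5) +
     ((s\<^sup>2 - 1) * inverse q) \<cdot> (rel1 * \<delta>) + (s\<^sup>2 - 1) \<cdot> (\<beta> * (rel7 + q \<cdot> rel4))"
  have i: "?i \<in> K"
    by (intro I_K I_intros)
  have "(xi q s - s \<cdot> 1) * \<delta> - zeta q s * \<beta> - ?i \<in> K"
    by (intro K_diff K_right K_gens i)
  then have "(-1) \<cdot> E s \<in> K"
    unfolding base_E_identity by (simp only: add_diff_cancel_right')
  then have "pm_scale (- 1) ((-1) \<cdot> E s) \<in> K"
    by (rule K_scale)
  also have "pm_scale (- 1) ((-1) \<cdot> E s) = E s"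
    by (rule pm_scale_cancel) simp
  finally show ?thesis .
qed

lemma beta_minus_gamma_K: "\<beta> - \<gamma> \<in> K"
proof -
  let ?i = "s \<cdot> (\<alpha> * rel2) + s \<cdot> (\<beta> * (rel7 - rel3)) +
     ((s\<^sup>2 - 1) * inverse q) \<cdot> (rel1 * \<gamma> + q \<cdot> (\<beta> * rel2))"
  let ?j = "(- s * inverse q) \<cdot> (rel2 * \<gamma> + q \<cdot> (\<gamma> * rel2)) + (- s) \<cdot> (\<delta> * (rel7 - rel3)) +
     (s * inverse q ^ 2) \<cdot> (rel5 * \<gamma>) + (s\<^sup>2 - 1) \<cdot> (\<gamma> * (rel7 - rel3) - inverse q \<cdot> (rel4 * \<gamma>))"
  have i: "?i \<in> K" "?j \<in> K"
    by (intro I_K I_intros)+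
  have "(xi q s - s \<cdot> 1) * \<gamma> - zeta q s * \<alpha> - ?i \<in> K"
    by (intro K_diff K_right K_gens i)
  then have 1: "s \<cdot> (\<beta> - \<gamma>) \<in> K"
    unfolding base_beta_gamma_identity by (simp only: add_diff_cancel_right')
  have "(eta q s + s \<cdot> 1) * \<alpha> - (inverse q ^ 2) \<cdot> (zeta q s * \<gamma>) - ?j \<in> K"
    by (intro K_diff K_right K_scale K_gens i)
  then have "s \<cdot> \<alpha> + (s\<^sup>2 - 1) \<cdot> \<gamma> - s \<cdot> \<delta> \<in> K"
    unfolding base_gamma_E_identity by (simp only: add_diff_cancel_right')
  then have "(s \<cdot> \<alpha> + (s\<^sup>2 - 1) \<cdot> \<gamma> - s \<cdot> \<delta>) + E s \<in> K"
    using E_s_K by (rule K_add)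
  also have "(s \<cdot> \<alpha> + (s\<^sup>2 - 1) \<cdot> \<gamma> - s \<cdot> \<delta>) + E s = (1 - s\<^sup>2) \<cdot> (\<beta> - \<gamma>)"
    by (rule poly_mapping_eqI) (simp add: free_lookup algebra_simps)
  finally have 2: "(1 - s\<^sup>2) \<cdot> (\<beta> - \<gamma>) \<in> K" .
  \<comment> \<open>The factors \<open>s\<close> and \<open>1 - s\<^sup>2\<close> in \<open>1\<close> and \<open>2\<close> have no common zero.\<close>
  show ?thesis
  proof (cases "s = 0")
    case True
    then have "(1 :: real) \<cdot> (\<beta> - \<gamma>) \<in> K" using 2 by simp
    then show ?thesis by (simp only: of_real_1 pm_scale_distrib(7))
  next
    case False
    have "pm_scale (inverse s) (s \<cdot> (\<beta> - \<gamma>)) \<in> K"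
      by (rule K_scale[OF 1])
    also have "pm_scale (inverse s) (s \<cdot> (\<beta> - \<gamma>)) = \<beta> - \<gamma>"
      by (rule pm_scale_cancel) (use False in simp)
    finally show ?thesis .
  qed
qed

text \<open>The class of \<open>x\<close> behaves under right multiplication like \<open>g\<^sub>n\<close> with \<open>q\<^sup>n s = t\<close>.\<close>

definition step_ready :: "free \<Rightarrow> real \<Rightarrow> bool" where
  "step_ready x t \<longleftrightarrow> x * (\<beta> - \<gamma>) \<in> K \<and> x * E t \<in> K"

text \<open>\<open>K\<close> is only a right ideal, but the ideal of relations is two-sided; this is why a left factor
  \<open>x\<close> may be put in front of an identity that holds up to relations.\<close>

lemma K_combine:
  assumes "step_ready x t" "l = m + E t * y + (\<beta> - \<gamma>) * z + i" "i \<in> I"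
  shows "x * l - x * m \<in> K"
proof -
  have expand: "x * (m + e * y + d * z + i) - x * m = x * e * y + x * d * z + x * i" for e d
    by (simp add: algebra_simps)
  have "x * E t * y \<in> K" "x * (\<beta> - \<gamma>) * z \<in> K" "x * i \<in> K"
    using assms(1,3) by (auto simp only: step_ready_def intro: K_right I_K I_mult_left)
  then show ?thesis
    unfolding assms(2) expand by (intro K_add)
qed

lemma step_ready_up:
  assumes "step_ready x t"
  shows "step_ready (x * (\<alpha> + t \<cdot> \<beta>)) (q * t)"
proof -
  have "x * ((\<alpha> + t \<cdot> \<beta>) * (\<beta> - \<gamma>)) - x * 0 \<in> K"
    by (rule K_combine[OF assms, where y = 0 and z = "q \<cdot> \<alpha> + t \<cdot> \<beta>"
        and i = "rel1 - rel2 - t \<cdot> rel4"])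
      (simp only: up_beta_gamma add_0 mult_zero_right, intro I_intros)
  moreover have "x * ((\<alpha> + t \<cdot> \<beta>) * E (q * t)) - x * 0 \<in> K"
    by (rule K_combine[OF assms, where y = "q \<cdot> \<alpha> + (q\<^sup>2 * t) \<cdot> \<beta>"
        and z = "(t * (1 - q\<^sup>2)) \<cdot> \<beta>"
        and i = "rel1 + (q * t) \<cdot> rel3 + (q * t\<^sup>2) \<cdot> rel5 + (t * (q\<^sup>2 - 1)) \<cdot> rel4"])
      (simp only: up_E add_0, intro I_intros)
  ultimately show ?thesis
    by (simp only: step_ready_def mult.assoc mult_zero_right diff_zero)
qed

lemma up_down:
  assumes "step_ready x t"
  shows "\<pi> (x * (\<alpha> + t \<cdot> \<beta>) * (\<delta> - (q * t) \<cdot> \<gamma>)) = \<pi> x"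
proof -
  have "x * ((\<alpha> + t \<cdot> \<beta>) * (\<delta> - (q * t) \<cdot> \<gamma>)) - x * 1 \<in> K"
    by (rule K_combine[OF assms up_inverse]) (intro I_intros)
  then show ?thesis
    by (simp only: pi_eq_iff mult.assoc mult_1_right)
qed

lemma step_ready_down:
  assumes "step_ready x t" "t = q * u"
  shows "step_ready (x * (\<delta> - t \<cdot> \<gamma>)) u"
proof -
  have "x * ((\<delta> - t \<cdot> \<gamma>) * (\<beta> - \<gamma>)) - x * 0 \<in> K"
    by (rule K_combine[OF assms(1), where y = 0 and z = "inverse q \<cdot> \<delta> - t \<cdot> \<gamma>"
        and i = "(- inverse q) \<cdot> rel5 + inverse q \<cdot> rel6 + t \<cdot> rel4"])
      (simp only: down_beta_gamma add_0 mult_zero_right, intro I_intros)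
  moreover have "x * ((\<delta> - t \<cdot> \<gamma>) * E u) - x * 0 \<in> K"
    by (rule K_combine[OF assms(1), where y = "inverse q \<cdot> \<delta> - (u * inverse q) \<cdot> \<gamma>"
        and z = "(inverse q * (t\<^sup>2 - u\<^sup>2)) \<cdot> \<delta>"
        and i = "(- t * u * inverse q) \<cdot> rel2 + u \<cdot> rel3 + (t * (1 - u\<^sup>2)) \<cdot> rel4 +
          (- (1 - u\<^sup>2) * inverse q) \<cdot> rel5 + (- t * u * inverse q ^ 2) \<cdot> rel6"])
      (simp only: down_E[OF assms(2)] add_0, intro I_intros)
  ultimately show ?thesis
    by (simp only: step_ready_def mult.assoc mult_zero_right diff_zero)
qed

lemma down_up:
  assumes "step_ready x t" "t = q * u"
  shows "\<pi> (x * (\<delta> - t \<cdot> \<gamma>) * (\<alpha> + u \<cdot> \<beta>)) = \<pi> x"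
proof -
  have "x * ((\<delta> - t \<cdot> \<gamma>) * (\<alpha> + u \<cdot> \<beta>)) - x * 1 \<in> K"
    by (rule K_combine[OF assms(1) down_inverse[OF assms(2)]]) (intro I_intros)
  then show ?thesis
    by (simp only: pi_eq_iff mult.assoc mult_1_right)
qed

definition \<tau> :: "int \<Rightarrow> real" where "\<tau> n = q powi n * s"

lemma tau_Suc: "\<tau> (n + 1) = q * \<tau> n"
  using power_int_add_1[of q n] q_nonzero by (simp add: \<tau>_def)

text \<open>The products that define \<open>g\<^sup>+\<^sub>n\<close> and \<open>g\<^sup>-\<^sub>n\<close>, indexed by all integers.\<close>

definition G :: "int \<Rightarrow> free" where
  "G n = (if n \<ge> 0 then \<Prod>k\<leftarrow>[0..<nat n]. \<alpha> + (q ^ k * s) \<cdot> \<beta>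
    else \<Prod>k\<leftarrow>[0..<nat (- n)]. \<delta> - (inverse q ^ k * s) \<cdot> \<gamma>)"

lemma G_0: "G 0 = 1"
  by (simp add: G_def)

lemma G_up: "n \<ge> 0 \<Longrightarrow> G (n + 1) = G n * (\<alpha> + \<tau> n \<cdot> \<beta>)"
proof -
  assume n: "n \<ge> 0"
  define m where "m = nat n"
  have m: "n = int m" "nat (int m + 1) = Suc m" "nat (1 + int m) = Suc m"
    using n by (simp_all add: m_def)
  show ?thesis
    by (simp add: G_def m \<tau>_def)
qed

lemma G_down: "n \<le> 0 \<Longrightarrow> G (n - 1) = G n * (\<delta> - \<tau> n \<cdot> \<gamma>)"
proof -
  assume n: "n \<le> 0"
  define m where "m = nat (- n)"
  have m: "n = - int m" "nat (1 - n) = Suc m" "nat (1 + int m) = Suc m"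
    using n by (simp_all add: m_def nat_diff_distrib)
  show ?thesis
    by (cases "m = 0") (simp_all add: G_def m \<tau>_def power_int_minus power_inverse)
qed

lemma step_ready_G: "step_ready (G n) (\<tau> n)"
proof (induction n rule: int_induct[where k = 0])
  case base
  then show ?case
    using beta_minus_gamma_K E_s_K by (simp add: step_ready_def G_0 \<tau>_def)
next
  case (step1 n)
  then show ?case
    unfolding G_up[OF step1(1)] tau_Suc by (intro step_ready_up)
next
  case (step2 n)
  then show ?case
    unfolding G_down[OF step2(1)] using tau_Suc[of "n - 1"] by (intro step_ready_down) simp_all
qed

definition g where "g n = \<pi> (G n)"

lemma g_closed [simp, intro]: "g n \<in> carrier C"
  by (simp add: g_def)

text \<open>For negative \<open>n\<close> the factor \<open>\<alpha> + t \<beta>\<close> undoes the last factor of the product.\<close>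

lemma g_up: "\<pi> (G n * (\<alpha> + \<tau> n \<cdot> \<beta>)) = g (n + 1)"
proof (cases "n \<ge> 0")
  case True
  then show ?thesis by (simp add: g_def G_up)
next
  case False
  then have "G n = G (n + 1) * (\<delta> - \<tau> (n + 1) \<cdot> \<gamma>)"
    using G_down[of "n + 1"] by simp
  then show ?thesis
    unfolding g_def by (rule ssubst) (rule down_up[OF step_ready_G tau_Suc])
qed

lemma g_down: "\<pi> (G n * (\<delta> - \<tau> n \<cdot> \<gamma>)) = g (n - 1)"
proof (cases "n \<le> 0")
  case True
  then show ?thesis by (simp add: g_def G_down)
next
  case False
  then have G: "G n = G (n - 1) * (\<alpha> + \<tau> (n - 1) \<cdot> \<beta>)" and t: "\<tau> n = q * \<tau> (n - 1)"
    using G_up[of "n - 1"] tau_Suc[of "n - 1"] by simp_all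
  show ?thesis
    unfolding g_def G t by (rule up_down[OF step_ready_G])
qed

text \<open>After multiplication by \<open>1 + t\<^sup>2\<close> this is a linear system for the four
  coefficients of the decomposition, with polynomial solution in \<open>t\<close>.\<close>

lemma generator_decomposition:
  "\<exists>e f. generator x = up_coeff x t \<cdot> (\<alpha> + t \<cdot> \<beta>) + down_coeff x t \<cdot> (\<delta> - t \<cdot> \<gamma>) +
    E t * pm_scale e 1 + (\<beta> - \<gamma>) * pm_scale f 1"
proof -
  define a b e f :: real where "a = (case x of Gen_alpha \<Rightarrow> 1 | Gen_beta \<Rightarrow> t | Gen_gamma \<Rightarrow> t | Gen_delta \<Rightarrow> t\<^sup>2)"
    and "b = (case x of Gen_alpha \<Rightarrow> t\<^sup>2 | Gen_beta \<Rightarrow> - t | Gen_gamma \<Rightarrow> - t | Gen_delta \<Rightarrow> 1)"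
    and "e = (case x of Gen_alpha \<Rightarrow> - t | Gen_beta \<Rightarrow> 1 | Gen_gamma \<Rightarrow> 1 | Gen_delta \<Rightarrow> t)"
    and "f = (case x of Gen_alpha \<Rightarrow> - (t ^ 3) | Gen_beta \<Rightarrow> t\<^sup>2 | Gen_gamma \<Rightarrow> - 1 | Gen_delta \<Rightarrow> - t)"
  define w where "w = 1 / (1 + t\<^sup>2)"
  have w: "w * (1 + t\<^sup>2) = 1"
    using one_plus_square by (simp add: w_def)
  have c: "up_coeff x t = w * a" "down_coeff x t = w * b"
    by (cases x; simp add: w_def a_def b_def)+
  have "(1 + t\<^sup>2) \<cdot> generator x = a \<cdot> (\<alpha> + t \<cdot> \<beta>) + b \<cdot> (\<delta> - t \<cdot> \<gamma>) +
    E t * e \<cdot> 1 + (\<beta> - \<gamma>) * f \<cdot> 1"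
    unfolding a_def b_def e_def f_def
    by (rule poly_mapping_eqI, cases x;
        simp add: pm_scale_mult free_lookup algebra_simps power2_eq_square power3_eq_cube)
  then have "w \<cdot> ((1 + t\<^sup>2) \<cdot> generator x) = w \<cdot> (a \<cdot> (\<alpha> + t \<cdot> \<beta>) + b \<cdot> (\<delta> - t \<cdot> \<gamma>) +
    E t * e \<cdot> 1 + (\<beta> - \<gamma>) * f \<cdot> 1)"
    by (rule arg_cong)
  also have "w \<cdot> ((1 + t\<^sup>2) \<cdot> generator x) = (w * (1 + t\<^sup>2)) \<cdot> generator x"
    by (simp only: pm_scale_distrib of_real_mult)
  also have "\<dots> = generator x"
    unfolding w by (simp add: pm_scale_distrib)
  also have "w \<cdot> (a \<cdot> (\<alpha> + t \<cdot> \<beta>) + b \<cdot> (\<delta> - t \<cdot> \<gamma>) + E t * e \<cdot> 1 + (\<beta> - \<gamma>) * f \<cdot> 1) =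
    up_coeff x t \<cdot> (\<alpha> + t \<cdot> \<beta>) + down_coeff x t \<cdot> (\<delta> - t \<cdot> \<gamma>) +
    E t * pm_scale (w * e) 1 + (\<beta> - \<gamma>) * pm_scale (w * f) 1"
    unfolding c by (rule poly_mapping_eqI) (simp add: pm_scale_mult lookup_add algebra_simps)
  finally show ?thesis by blast
qed

lemma pi_generator:
  "\<pi> (G n * generator x) =
    up_coeff x (\<tau> n) \<odot>\<^bsub>C\<^esub> g (n + 1) \<oplus>\<^bsub>C\<^esub> down_coeff x (\<tau> n) \<odot>\<^bsub>C\<^esub> g (n - 1)"
proof -
  let ?m = "up_coeff x (\<tau> n) \<cdot> (\<alpha> + \<tau> n \<cdot> \<beta>) + down_coeff x (\<tau> n) \<cdot> (\<delta> - \<tau> n \<cdot> \<gamma>)"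
  obtain e f where "generator x = ?m + E (\<tau> n) * pm_scale e 1 + (\<beta> - \<gamma>) * pm_scale f 1 + 0"
    using generator_decomposition[of x "\<tau> n"] by auto
  then have "G n * generator x - G n * ?m \<in> K"
    by (rule K_combine[OF step_ready_G]) (use subspace.N_zero[OF I_subspace] in simp)
  then have "\<pi> (G n * generator x) = \<pi> (G n * ?m)"
    by (simp only: pi_eq_iff)
  also have "\<dots> = up_coeff x (\<tau> n) \<odot>\<^bsub>C\<^esub> g (n + 1) \<oplus>\<^bsub>C\<^esub> down_coeff x (\<tau> n) \<odot>\<^bsub>C\<^esub> g (n - 1)"
    unfolding distrib_left[of "G n" "up_coeff x (\<tau> n) \<cdot> (\<alpha> + \<tau> n \<cdot> \<beta>)"] pm_scale_mult pi_add pi_scale g_up g_down ..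
  finally show ?thesis .
qed

end

section \<open>Independence of the group-likes\<close>

abbreviation M :: "(complex, int \<Rightarrow>\<^sub>0 complex) module" where "M \<equiv> free_module UNIV"

abbreviation e :: "int \<Rightarrow> int \<Rightarrow>\<^sub>0 complex" where "e n \<equiv> Poly_Mapping.single n 1"

interpretation M: cspace M
  by (rule free_module_cspace)

text \<open>Linear endomorphisms, multiplied in the order of a right action, so that algebra maps into
  \<open>right_End\<close> are right actions.\<close>

definition right_End :: "(complex, (int \<Rightarrow>\<^sub>0 complex) \<Rightarrow> (int \<Rightarrow>\<^sub>0 complex)) module" where
  "right_End = \<lparr>carrier = linear_maps M M, mult = (\<lambda>f g x. g (f x)), one = (\<lambda>x. x),
     zero = (\<lambda>x. 0), add = (\<lambda>f g x. f x + g x), smult = (\<lambda>c f x. pm_scale c (f x))\<rparr>"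

lemma right_End_simps [simp]:
  "carrier right_End = linear_maps M M" "mult right_End = (\<lambda>f g x. g (f x))"
  "one right_End = (\<lambda>x. x)" "zero right_End = (\<lambda>x. 0)"
  "add right_End = (\<lambda>f g x. f x + g x)" "smult right_End = (\<lambda>c f x. pm_scale c (f x))"
  by (simp_all add: right_End_def)

lemma End_add: "f \<in> linear_maps M M \<Longrightarrow> f (x + y) = f x + f y"
  using linear_add[of f M M x y] by simp

lemma End_scale: "f \<in> linear_maps M M \<Longrightarrow> f (pm_scale c x) = pm_scale c (f x)"
  using linear_scale[of f M M x c] by simp

lemma End_zero: "f \<in> linear_maps M M \<Longrightarrow> f 0 = 0"
  using linear_zero[OF M.cspace_axioms M.cspace_axioms] by simp

lemma End_addI: "\<lbrakk>f \<in> linear_maps M M; g \<in> linear_maps M M\<rbrakk> \<Longrightarrow> (\<lambda>x. f x + g x) \<in> linear_maps M M"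
  using linear_maps_add[OF M.cspace_axioms, of f M g] by simp

lemma End_scaleI: "f \<in> linear_maps M M \<Longrightarrow> (\<lambda>x. pm_scale c (f x)) \<in> linear_maps M M"
  using linear_maps_scale[OF M.cspace_axioms, of f M c] by simp

lemma End_zeroI: "(\<lambda>x. 0) \<in> linear_maps M M"
  by (rule linear_mapsI) (simp_all add: pm_scale_distrib)

lemma right_End_calgebra: "calgebra right_End"
proof (rule calgebraI)
  show "cspace right_End"
  proof (rule cspaceI)
    show "abelian_group right_End"
    proof (rule abelian_groupI)
      fix f assume f: "f \<in> carrier right_End"
      show "\<exists>g\<in>carrier right_End. g \<oplus>\<^bsub>right_End\<^esub> f = \<zero>\<^bsub>right_End\<^esub>"
      proof (rule bexI)
        show "(\<lambda>x. pm_scale (- 1) (f x)) \<in> carrier right_End"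
          using f by (simp add: End_scaleI)
        show "(\<lambda>x. pm_scale (- 1) (f x)) \<oplus>\<^bsub>right_End\<^esub> f = \<zero>\<^bsub>right_End\<^esub>"
          by (rule ext, rule poly_mapping_eqI) (simp add: lookup_add)
      qed
    qed (simp_all add: End_addI End_zeroI add_ac)
  qed (simp_all add: End_scaleI pm_scale_distrib)
  show "\<one>\<^bsub>right_End\<^esub> \<in> carrier right_End"
    using linear_id by simp
  show "(\<lambda>g. f \<otimes>\<^bsub>right_End\<^esub> g) \<in> linear_maps right_End right_End"
    if "f \<in> carrier right_End" for f
    using that by (intro linear_mapsI) (simp_all add: linear_comp)
  show "(\<lambda>g. g \<otimes>\<^bsub>right_End\<^esub> f) \<in> linear_maps right_End right_End"
    if "f \<in> carrier right_End" for f
    using that by (intro linear_mapsI) (simp_all add: linear_comp End_add End_scale)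
qed simp_all

text \<open>Acting on \<open>e\<^sub>n\<close> with two generators in succession gives a vector supported on \<open>n + 2\<close>,
  \<open>n\<close> and \<open>n - 2\<close>.\<close>

definition tri :: "int \<Rightarrow> real \<Rightarrow> real \<Rightarrow> real \<Rightarrow> int \<Rightarrow>\<^sub>0 complex" where
  "tri n a b c = Poly_Mapping.single (n + 2) (complex_of_real a) +
    Poly_Mapping.single n (complex_of_real b) + Poly_Mapping.single (n - 2) (complex_of_real c)"

lemma tri_add: "tri n a b c + tri n a' b' c' = tri n (a + a') (b + b') (c + c')"
  by (simp add: tri_def single_add)

lemma tri_scale: "pm_scale (complex_of_real r) (tri n a b c) = tri n (r * a) (r * b) (r * c)"
  by (simp add: tri_def pm_scale_distrib)

lemma tri_diff: "tri n a b c - tri n a' b' c' = tri n (a - a') (b - b') (c - c')"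
  by (simp add: tri_def single_diff)

lemma tri_zeroI: "\<lbrakk>a = 0; b = 0; c = 0\<rbrakk> \<Longrightarrow> tri n a b c = 0"
  by (simp add: tri_def)

lemma tri_one: "e n = tri n 0 1 0"
  by (simp add: tri_def)

text \<open>\<open>W x y\<close> is \<open>e\<^sub>n\<close> acted on by \<open>x\<close> and then by \<open>y\<close>.  The parameters at
  \<open>n - 1\<close>, \<open>n\<close> and \<open>n + 1\<close> are written as \<open>u\<close>, \<open>q u\<close> and \<open>q\<^sup>2 u\<close> to keep all
  denominators polynomial.\<close>

lemma two_step_relations:
  fixes q u :: real and n :: int
  assumes q: "q \<noteq> 0"
  defines "W x y \<equiv> tri n (up_coeff x (q * u) * up_coeff y (q * (q * u)))
    (up_coeff x (q * u) * down_coeff y (q * (q * u)) + down_coeff x (q * u) * up_coeff y u)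
    (down_coeff x (q * u) * down_coeff y u)"
  shows "W Gen_alpha Gen_beta - pm_scale q (W Gen_beta Gen_alpha) = 0" (is ?R1)
    and "W Gen_alpha Gen_gamma - pm_scale q (W Gen_gamma Gen_alpha) = 0" (is ?R2)
    and "W Gen_alpha Gen_delta -
      (W Gen_delta Gen_alpha + pm_scale (complex_of_real (q - inverse q)) (W Gen_beta Gen_gamma)) = 0" (is ?R3)
    and "W Gen_beta Gen_gamma - W Gen_gamma Gen_beta = 0" (is ?R4)
    and "W Gen_beta Gen_delta - pm_scale q (W Gen_delta Gen_beta) = 0" (is ?R5)
    and "W Gen_gamma Gen_delta - pm_scale q (W Gen_delta Gen_gamma) = 0" (is ?R6)
    and "W Gen_alpha Gen_delta - pm_scale q (W Gen_beta Gen_gamma) - e n = 0" (is ?R7)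
proof -
  define D0 D1 D2 where D: "D0 = 1 + u\<^sup>2" "D1 = 1 + (q * u)\<^sup>2" "D2 = 1 + (q * (q * u))\<^sup>2"
  have d: "D0 \<noteq> 0" "D1 \<noteq> 0" "D2 \<noteq> 0"
    unfolding D by (rule one_plus_square)+
  have "?R1 \<and> ?R2 \<and> ?R3 \<and> ?R4 \<and> ?R5 \<and> ?R6 \<and> ?R7"
    unfolding W_def up_coeff.simps down_coeff.simps D[symmetric] tri_one tri_scale tri_add tri_diff
    apply (intro conjI tri_zeroI)
    using d q apply (simp_all add: divide_simps)
    unfolding D apply -
    \<comment> \<open>The qualified name selects the decision method for polynomial identities over fields,
      not the normaliser for rings with carriers.\<close>
    apply Groebner_Basis.algebra+
    done
  then show ?R1 ?R2 ?R3 ?R4 ?R5 ?R6 ?R7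
    by blast+
qed

context quantum_sphere
begin

definition act where
  "act x = lin_ext M (\<lambda>n. Poly_Mapping.single (n + 1) (complex_of_real (up_coeff x (\<tau> n))) +
    Poly_Mapping.single (n - 1) (complex_of_real (down_coeff x (\<tau> n))))"

lemma act_linear: "act x \<in> linear_maps M M"
  unfolding act_def by (rule M.lin_ext_linear) simp

lemma act_single:
  "act x (Poly_Mapping.single n c) =
    Poly_Mapping.single (n + 1) (c * up_coeff x (\<tau> n)) + Poly_Mapping.single (n - 1) (c * down_coeff x (\<tau> n))"
  unfolding act_def by (subst M.lin_ext_single) (simp_all add: pm_scale_distrib)

lemma act_act:
  "act y (act x (e n)) = tri n (up_coeff x (\<tau> n) * up_coeff y (\<tau> (n + 1)))
    (up_coeff x (\<tau> n) * down_coeff y (\<tau> (n + 1)) + down_coeff x (\<tau> n) * up_coeff y (\<tau> (n - 1)))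
    (down_coeff x (\<tau> n) * down_coeff y (\<tau> (n - 1)))"
  by (simp add: act_single End_add[OF act_linear] tri_def single_add add_ac)

sublocale RE: calgebra right_End
  by (rule right_End_calgebra)

abbreviation \<Phi> where "\<Phi> \<equiv> alg_ext right_End act"

lemma act_closed: "act x \<in> carrier right_End"
  by (simp add: act_linear)

lemmas Phi_gen = RE.alg_ext_generator[where f = act, OF act_closed]

lemma Phi_mult: "\<Phi> (p * r) m = \<Phi> r (\<Phi> p m)"
  using RE.alg_ext_mult[where f = act, OF act_closed, where p = p and r = r] by simp

lemma Phi_one: "\<Phi> 1 m = m"
  using RE.alg_ext_one[where f = act, OF act_closed] by simp

lemma Phi_add: "\<Phi> (p + r) m = \<Phi> p m + \<Phi> r m"
  using linear_add[OF RE.alg_ext_linear[where f = act, OF act_closed], of p r] by simp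

lemma Phi_scale: "\<Phi> (pm_scale c p) m = pm_scale c (\<Phi> p m)"
  using linear_scale[OF RE.alg_ext_linear[where f = act, OF act_closed], of p c] by simp

lemma Phi_linear: "\<Phi> p \<in> linear_maps M M"
  using RE.alg_ext_closed[where f = act, OF act_closed, where p = p] by simp

lemma Phi_diff: "\<Phi> (p - r) m = \<Phi> p m - \<Phi> r m"
proof -
  have "p - r = p + pm_scale (- 1) r"
    by (rule diff_conv_scale)
  then have "\<Phi> (p - r) m = \<Phi> p m + pm_scale (- 1) (\<Phi> r m)"
    by (simp only: Phi_add Phi_scale)
  also have "\<dots> = \<Phi> p m - \<Phi> r m"
    by (rule poly_mapping_eqI) (simp add: lookup_minus lookup_add)
  finally show ?thesis .
qed

lemma Phi_rels:
  assumes "r \<in> SUq2_rels q"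
  shows "\<Phi> r = \<zero>\<^bsub>right_End\<^esub>"
proof -
  have "\<Phi> r (e n) = 0" for n
  proof -
    define u where "u = \<tau> (n - 1)"
    have t: "\<tau> (n - 1) = u" "\<tau> n = q * u" "\<tau> (n + 1) = q * (q * u)"
      using tau_Suc[of "n - 1"] tau_Suc[of n] by (simp_all add: u_def)
    have "\<Phi> rel1 (e n) = 0" "\<Phi> rel2 (e n) = 0" "\<Phi> rel3 (e n) = 0" "\<Phi> rel4 (e n) = 0"
      "\<Phi> rel5 (e n) = 0" "\<Phi> rel6 (e n) = 0" "\<Phi> rel7 (e n) = 0"
      unfolding Phi_diff Phi_mult Phi_add Phi_scale Phi_gen Phi_one act_act t
      by (rule two_step_relations[OF q_nonzero])+
    then show ?thesis
      using assms unfolding SUq2_rels_def by (elim insertE emptyE) (simp_all only:)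
  qed
  then have "\<Phi> r m = 0" for m
    using M.free_module_ext[of "\<Phi> r" UNIV "\<lambda>x. 0" m] by (simp add: Phi_linear End_zeroI)
  then show ?thesis
    by auto
qed

end

text \<open>The basis vector \<open>e\<^sub>0\<close> should not be rewritten to the unit of the convolution product.\<close>

declare single_one [simp del]

text \<open>The case \<open>n = 0\<close>, where the parameter is \<open>s\<close> itself, says that \<open>e\<^sub>0\<close> is annihilated by
  the generators of \<open>J\<close>.\<close>

lemma two_step_invariant:
  fixes q u s :: real and n :: int
  assumes q: "q \<noteq> 0" and s: "s = q * u"
  defines "W x y \<equiv> tri n (up_coeff x (q * u) * up_coeff y (q * (q * u)))
    (up_coeff x (q * u) * down_coeff y (q * (q * u)) + down_coeff x (q * u) * up_coeff y u)
    (down_coeff x (q * u) * down_coeff y u)"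
  shows "pm_scale s (W Gen_alpha Gen_alpha - pm_scale (complex_of_real (inverse q)) (W Gen_beta Gen_beta)) +
      pm_scale (complex_of_real ((s\<^sup>2 - 1) * inverse q)) (W Gen_alpha Gen_beta) - pm_scale s (e n) = 0"
      (is ?R1)
    and "pm_scale s (pm_scale q (W Gen_gamma Gen_gamma) - W Gen_delta Gen_delta) +
      pm_scale (complex_of_real (s\<^sup>2 - 1)) (W Gen_gamma Gen_delta) + pm_scale s (e n) = 0" (is ?R2)
    and "pm_scale s (pm_scale q (W Gen_alpha Gen_gamma) - W Gen_beta Gen_delta) +
      pm_scale (complex_of_real ((s\<^sup>2 - 1) * q)) (W Gen_beta Gen_gamma) = 0" (is ?R3)
proof -
  define D0 D1 D2 where D: "D0 = 1 + u\<^sup>2" "D1 = 1 + (q * u)\<^sup>2" "D2 = 1 + (q * (q * u))\<^sup>2"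
  have d: "D0 \<noteq> 0" "D1 \<noteq> 0" "D2 \<noteq> 0"
    unfolding D by (rule one_plus_square)+
  have "?R1 \<and> ?R2 \<and> ?R3"
    unfolding W_def up_coeff.simps down_coeff.simps D[symmetric] tri_one tri_scale tri_add tri_diff
    apply (intro conjI tri_zeroI)
    using d q apply (simp_all add: divide_simps)
    unfolding D s apply -
    apply Groebner_Basis.algebra+
    done
  then show ?R1 ?R2 ?R3
    by blast+
qed

context quantum_sphere
begin

definition \<theta>\<^sub>A where "\<theta>\<^sub>A a = the_elem (\<Phi> ` a) (e 0)"

lemma theta_A_cls: "\<theta>\<^sub>A (cls q p) = \<Phi> p (e 0)"
  unfolding \<theta>\<^sub>A_def
  by (subst hom_lift[OF right_End_calgebra act_closed Phi_rels]) simp_all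

lemma theta_A_linear: "\<theta>\<^sub>A \<in> linear_maps A M"
proof (rule linear_mapsI)
  fix x assume "x \<in> carrier A"
  then obtain p where x: "x = cls q p" by (rule clsE)
  show "\<theta>\<^sub>A x \<in> carrier M" by simp
  show "\<theta>\<^sub>A (c \<odot>\<^bsub>A\<^esub> x) = c \<odot>\<^bsub>M\<^esub> \<theta>\<^sub>A x" for c
    unfolding x cls_scale[symmetric] theta_A_cls by (simp add: Phi_scale)
  fix y assume "y \<in> carrier A"
  then obtain r where y: "y = cls q r" by (rule clsE)
  show "\<theta>\<^sub>A (x \<oplus>\<^bsub>A\<^esub> y) = \<theta>\<^sub>A x \<oplus>\<^bsub>M\<^esub> \<theta>\<^sub>A y"
    unfolding x y cls_add[symmetric] theta_A_cls by (simp add: Phi_add)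
qed

lemma invariants:
  "\<Phi> (xi q s - s \<cdot> 1) (e 0) = 0" "\<Phi> (eta q s + s \<cdot> 1) (e 0) = 0" "\<Phi> (zeta q s) (e 0) = 0"
proof -
  define u where "u = \<tau> (- 1)"
  have t: "\<tau> (0 - 1) = u" "\<tau> 0 = q * u" "\<tau> (0 + 1) = q * (q * u)" "s = q * u"
    using tau_Suc[of "- 1"] tau_Suc[of 0] by (simp_all add: u_def \<tau>_def)
  show "\<Phi> (xi q s - s \<cdot> 1) (e 0) = 0"
    unfolding xi_def Phi_diff Phi_mult Phi_add Phi_scale Phi_gen Phi_one act_act t(1-3)
    by (rule two_step_invariant[OF q_nonzero t(4)])
  show "\<Phi> (eta q s + s \<cdot> 1) (e 0) = 0"
    unfolding eta_def Phi_diff Phi_mult Phi_add Phi_scale Phi_gen Phi_one act_act t(1-3)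
    by (rule two_step_invariant[OF q_nonzero t(4)])
  show "\<Phi> (zeta q s) (e 0) = 0"
    unfolding zeta_def Phi_diff Phi_mult Phi_add Phi_scale Phi_gen Phi_one act_act t(1-3)
    by (rule two_step_invariant[OF q_nonzero t(4)])
qed

lemma theta_A_J: "x \<in> J \<Longrightarrow> \<theta>\<^sub>A x = \<zero>\<^bsub>M\<^esub>"
proof -
  let ?N = "{x \<in> carrier A. \<theta>\<^sub>A x = \<zero>\<^bsub>M\<^esub>}"
  have "J \<subseteq> ?N"
  proof (rule J_least)
    show "additive_subgroup ?N A"
      by (rule additive_subgroup.intro, rule submodule.axioms(1),
        rule linear_kernel_subspace[OF A.cspace_axioms free_module_cspace theta_A_linear])
    show "x \<otimes>\<^bsub>A\<^esub> r \<in> ?N" if x: "x \<in> ?N" and r: "r \<in> carrier A" for x r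
    proof -
      have "x \<in> carrier A" using x by simp
      then obtain p where p: "x = cls q p" by (rule clsE)
      from r obtain r' where r': "r = cls q r'" by (rule clsE)
      show ?thesis
        using x End_zero[OF Phi_linear]
        unfolding p r' cls_mult[symmetric] by (simp add: theta_A_cls Phi_mult)
    qed
  qed (simp_all add: theta_A_cls invariants)
  then show "x \<in> J \<Longrightarrow> \<theta>\<^sub>A x = \<zero>\<^bsub>M\<^esub>" by blast
qed

definition \<theta> where "\<theta> c = the_elem (\<theta>\<^sub>A ` c)"

lemma theta_linear: "\<theta> \<in> linear_maps C M"
  using J.quot_lift(1)[OF free_module_cspace theta_A_linear theta_A_J]
  unfolding \<theta>_def[abs_def] by (simp add: sphere_C_def)

lemma theta_pi: "\<theta> (\<pi> p) = \<Phi> p (e 0)"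
  using J.quot_lift(2)[OF free_module_cspace theta_A_linear theta_A_J, of "cls q p"]
  unfolding \<theta>_def \<pi>_def by (simp add: proj_def theta_A_cls)

lemma Phi_up: "\<Phi> (\<alpha> + \<tau> n \<cdot> \<beta>) (e n) = e (n + 1)"
proof -
  define t where "t = \<tau> n"
  have h1: "up_coeff Gen_alpha t + t * up_coeff Gen_beta t = 1"
    using one_plus_square[of t] by (simp add: divide_simps power2_eq_square)
  have h2: "down_coeff Gen_alpha t + t * down_coeff Gen_beta t = 0"
    using one_plus_square[of t] by (simp add: divide_simps power2_eq_square)
  have h3: "\<Phi> (\<alpha> + t \<cdot> \<beta>) (e n) =
    Poly_Mapping.single (n + 1) (complex_of_real (up_coeff Gen_alpha t + t * up_coeff Gen_beta t)) +
    Poly_Mapping.single (n - 1) (complex_of_real (down_coeff Gen_alpha t + t * down_coeff Gen_beta t))"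
    unfolding Phi_add Phi_scale Phi_gen act_single t_def[symmetric]
    by (simp add: pm_scale_distrib single_add del: up_coeff.simps down_coeff.simps)
  show ?thesis
    unfolding t_def[symmetric] h3 h1 h2 by simp
qed

lemma Phi_down: "\<Phi> (\<delta> - \<tau> n \<cdot> \<gamma>) (e n) = e (n - 1)"
proof -
  define t where "t = \<tau> n"
  have h1: "up_coeff Gen_delta t - t * up_coeff Gen_gamma t = 0"
    using one_plus_square[of t] by (simp add: divide_simps power2_eq_square)
  have h2: "down_coeff Gen_delta t - t * down_coeff Gen_gamma t = 1"
    using one_plus_square[of t] by (simp add: divide_simps power2_eq_square)
  have h3: "\<Phi> (\<delta> - t \<cdot> \<gamma>) (e n) =
    Poly_Mapping.single (n + 1) (complex_of_real (up_coeff Gen_delta t - t * up_coeff Gen_gamma t)) +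
    Poly_Mapping.single (n - 1) (complex_of_real (down_coeff Gen_delta t - t * down_coeff Gen_gamma t))"
    unfolding Phi_diff Phi_scale Phi_gen act_single t_def[symmetric]
    by (simp add: pm_scale_distrib single_diff del: up_coeff.simps down_coeff.simps)
  show ?thesis
    unfolding t_def[symmetric] h3 h1 h2 by simp
qed

lemma Phi_G: "\<Phi> (G n) (e 0) = e n"
proof (induction n rule: int_induct[where k = 0])
  case base
  then show ?case by (simp add: G_0 Phi_one)
next
  case (step1 n)
  then show ?case by (simp only: G_up Phi_mult Phi_up)
next
  case (step2 n)
  then show ?case by (simp only: G_down Phi_mult Phi_down)
qed

lemma theta_g: "\<theta> (g n) = e n"
  by (simp add: g_def theta_pi Phi_G)

definition \<Gamma> where "\<Gamma> = lin_ext C g"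

lemma Gamma_linear: "\<Gamma> \<in> linear_maps M C"
  unfolding \<Gamma>_def by (rule C.lin_ext_linear) auto

lemma Gamma_single: "\<Gamma> (Poly_Mapping.single n c) = c \<odot>\<^bsub>C\<^esub> g n"
  unfolding \<Gamma>_def by (rule C.lin_ext_single) simp

lemma Gamma_add: "\<Gamma> (x + y) = \<Gamma> x \<oplus>\<^bsub>C\<^esub> \<Gamma> y"
  using linear_add[OF Gamma_linear, of x y] by simp

lemma ract_g: "ract (generator x) (g n) =
    up_coeff x (\<tau> n) \<odot>\<^bsub>C\<^esub> g (n + 1) \<oplus>\<^bsub>C\<^esub> down_coeff x (\<tau> n) \<odot>\<^bsub>C\<^esub> g (n - 1)"
  unfolding g_def[of n] ract_pi by (rule pi_generator)

lemma Gamma_act: "\<Gamma> (act x m) = ract (generator x) (\<Gamma> m)"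
proof (rule C.free_module_ext[of "\<lambda>m. \<Gamma> (act x m)" UNIV "\<lambda>m. ract (generator x) (\<Gamma> m)"])
  show "(\<lambda>m. \<Gamma> (act x m)) \<in> linear_maps M C"
    by (rule linear_comp[OF act_linear Gamma_linear])
  show "(\<lambda>m. ract (generator x) (\<Gamma> m)) \<in> linear_maps M C"
    by (rule linear_comp[OF Gamma_linear ract_linear])
  show "\<Gamma> (act x (e n)) = ract (generator x) (\<Gamma> (e n))" for n
    by (simp add: act_single Gamma_add Gamma_single ract_g)
qed simp

lemma word_snoc:
  "Poly_Mapping.single (Word (xs @ [x])) 1 = Poly_Mapping.single (Word xs) 1 * generator x"
  by (simp add: mult_single plus_word_def)

text \<open>Both sides intertwine the right actions and agree on the unit.\<close>

lemma Gamma_Phi: "\<Gamma> (\<Phi> p (e 0)) = \<pi> p"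
proof (rule C.free_alg_ext[of "\<lambda>p. \<Gamma> (\<Phi> p (e 0))" \<pi>])
  show "(\<lambda>p. \<Gamma> (\<Phi> p (e 0))) \<in> linear_maps free_alg C"
  proof (rule linear_comp[OF _ Gamma_linear])
    show "(\<lambda>p. \<Phi> p (e 0)) \<in> linear_maps free_alg M"
      by (rule linear_mapsI) (simp_all add: Phi_add Phi_scale)
  qed
  show "\<pi> \<in> linear_maps free_alg C" by (rule pi_linear)
  have "\<Gamma> (\<Phi> (Poly_Mapping.single (Word xs) 1) (e 0)) = \<pi> (Poly_Mapping.single (Word xs) 1)" for xs
  proof (induction xs rule: rev_induct)
    case Nil
    have "Poly_Mapping.single (Word []) 1 = (1 :: free)"
      unfolding zero_word_def[symmetric] by (rule single_one)
    then show ?case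
      by (simp add: Phi_one Gamma_single g_def G_0)
  next
    case (snoc x xs)
    show ?case
      unfolding word_snoc Phi_mult Phi_gen Gamma_act snoc.IH ract_pi ..
  qed
  then show "\<Gamma> (\<Phi> (Poly_Mapping.single w 1) (e 0)) = \<pi> (Poly_Mapping.single w 1)" for w
    by (metis word.exhaust)
qed

lemma Gamma_theta: "c \<in> carrier C \<Longrightarrow> \<Gamma> (\<theta> c) = c"
  by (erule piE) (simp add: theta_pi Gamma_Phi)

text \<open>The \<open>g\<^sub>n\<close> span \<open>C\<close>.\<close>

lemma C_ext:
  assumes "cspace U" "f \<in> linear_maps C U" "h \<in> linear_maps C U"
    and eq: "\<And>n. f (g n) = h (g n)" and c: "c \<in> carrier C"
  shows "f c = h c"
proof -
  interpret U: cspace U by fact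
  have "f (\<Gamma> m) = h (\<Gamma> m)" for m
    by (rule U.free_module_ext[of "\<lambda>m. f (\<Gamma> m)" UNIV "\<lambda>m. h (\<Gamma> m)"])
      (simp_all add: linear_comp[OF Gamma_linear assms(2)] linear_comp[OF Gamma_linear assms(3)]
        Gamma_single eq)
  from this[of "\<theta> c"] show ?thesis
    by (simp add: Gamma_theta c)
qed

text \<open>The \<open>g\<^sub>n\<close> are linearly independent.\<close>

lemma C_lift:
  assumes "cspace U" "\<And>n. u n \<in> carrier U"
  shows "(\<lambda>c. lin_ext U u (\<theta> c)) \<in> linear_maps C U" "lin_ext U u (\<theta> (g n)) = u n"
proof -
  interpret U: cspace U by fact
  show "(\<lambda>c. lin_ext U u (\<theta> c)) \<in> linear_maps C U"
    by (rule linear_comp[OF theta_linear U.lin_ext_linear]) (use assms in auto)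
  show "lin_ext U u (\<theta> (g n)) = u n"
    using assms by (simp add: theta_g U.lin_ext_single)
qed

end

section \<open>The coproduct along right module maps\<close>

text \<open>The two summands of the coproduct of a generator have the tensor legs \<open>left_leg1\<close>,
  \<open>right_leg1\<close> and \<open>left_leg2\<close>, \<open>right_leg2\<close>; see \<open>comult_gen_legs\<close> below.\<close>

fun left_leg1 :: "gen \<Rightarrow> gen" where
  "left_leg1 Gen_alpha = Gen_alpha" | "left_leg1 Gen_beta = Gen_alpha"
| "left_leg1 Gen_gamma = Gen_gamma" | "left_leg1 Gen_delta = Gen_gamma"

fun right_leg1 :: "gen \<Rightarrow> gen" where
  "right_leg1 Gen_alpha = Gen_alpha" | "right_leg1 Gen_beta = Gen_beta"
| "right_leg1 Gen_gamma = Gen_alpha" | "right_leg1 Gen_delta = Gen_beta"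

fun left_leg2 :: "gen \<Rightarrow> gen" where
  "left_leg2 Gen_alpha = Gen_beta" | "left_leg2 Gen_beta = Gen_beta"
| "left_leg2 Gen_gamma = Gen_delta" | "left_leg2 Gen_delta = Gen_delta"

fun right_leg2 :: "gen \<Rightarrow> gen" where
  "right_leg2 Gen_alpha = Gen_gamma" | "right_leg2 Gen_beta = Gen_delta"
| "right_leg2 Gen_gamma = Gen_gamma" | "right_leg2 Gen_delta = Gen_delta"

definition gen_sum :: "(complex, 'v) module \<Rightarrow> (gen \<Rightarrow> real) \<Rightarrow> (gen \<Rightarrow> 'v) \<Rightarrow> 'v" where
  "gen_sum V c f = c Gen_alpha \<odot>\<^bsub>V\<^esub> f Gen_alpha \<oplus>\<^bsub>V\<^esub> c Gen_beta \<odot>\<^bsub>V\<^esub> f Gen_beta \<oplus>\<^bsub>V\<^esub>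
    c Gen_gamma \<odot>\<^bsub>V\<^esub> f Gen_gamma \<oplus>\<^bsub>V\<^esub> c Gen_delta \<odot>\<^bsub>V\<^esub> f Gen_delta"

lemma up_down_complex:
  fixes t :: real and d :: complex
  defines "d \<equiv> 1 + (complex_of_real t)\<^sup>2"
  shows "d \<noteq> 0"
    and "complex_of_real (up_coeff Gen_alpha t) = 1 / d" "complex_of_real (up_coeff Gen_beta t) = t / d"
    "complex_of_real (up_coeff Gen_gamma t) = t / d" "complex_of_real (up_coeff Gen_delta t) = t\<^sup>2 / d"
    "complex_of_real (down_coeff Gen_alpha t) = t\<^sup>2 / d" "complex_of_real (down_coeff Gen_beta t) = - t / d"
    "complex_of_real (down_coeff Gen_gamma t) = - t / d" "complex_of_real (down_coeff Gen_delta t) = 1 / d"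
proof -
  have "d = complex_of_real (1 + t\<^sup>2)"
    by (simp add: d_def)
  then show "d \<noteq> 0"
    using one_plus_square[of t] by (metis of_real_eq_0_iff)
qed (simp_all add: d_def)

context tensor_product
begin

context
  fixes t :: real
begin

text \<open>Here \<open>D\<close> is the action of the coproduct of a generator on a pure tensor whose right leg is acted on as
  \<open>g\<^sub>n\<close> is, with \<open>w\<close> and \<open>w'\<close> in place of \<open>g\<^sub>n\<^sub>+\<^sub>1\<close> and \<open>g\<^sub>n\<^sub>-\<^sub>1\<close>.  Summing over the
  generators with the entries of one projection
  reproduces this projection by idempotency and removes the other one by orthogonality.\<close>

lemma coaction_sums_right:
  assumes v: "\<And>x. v x \<in> carrier V" and w: "w \<in> carrier W" "w' \<in> carrier W"
  defines "r x \<equiv> up_coeff x t \<odot>\<^bsub>W\<^esub> w \<oplus>\<^bsub>W\<^esub> down_coeff x t \<odot>\<^bsub>W\<^esub> w'"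
  defines "D x \<equiv> pt (v (left_leg1 x)) (r (right_leg1 x)) \<oplus>\<^bsub>T\<^esub> pt (v (left_leg2 x)) (r (right_leg2 x))"
  shows "gen_sum T (\<lambda>x. up_coeff x t) D = pt (gen_sum V (\<lambda>x. up_coeff x t) v) w"
    and "gen_sum T (\<lambda>x. down_coeff x t) D = pt (gen_sum V (\<lambda>x. down_coeff x t) v) w'"
proof -
  define d :: complex where "d = 1 + (complex_of_real t)\<^sup>2"
  note c = up_down_complex[of t, folded d_def]
  show "gen_sum T (\<lambda>x. up_coeff x t) D = pt (gen_sum V (\<lambda>x. up_coeff x t) v) w"
    unfolding gen_sum_def D_def r_def left_leg1.simps left_leg2.simps right_leg1.simps right_leg2.simps c(2-)
    apply (simp only: expand_pure v w V.scale_closed W.scale_closed V.a_closed W.a_closed)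
    apply (simp only: collect_formal v w)
    apply (rule arg_cong[of _ _ formal], rule poly_mapping_eqI)
    apply (simp add: lookup_add lookup_single_ind)
    apply (simp add: c(1) divide_simps)
    apply (unfold d_def)
    apply Groebner_Basis.algebra
    done
  show "gen_sum T (\<lambda>x. down_coeff x t) D = pt (gen_sum V (\<lambda>x. down_coeff x t) v) w'"
    unfolding gen_sum_def D_def r_def left_leg1.simps left_leg2.simps right_leg1.simps right_leg2.simps c(2-)
    apply (simp only: expand_pure v w V.scale_closed W.scale_closed V.a_closed W.a_closed)
    apply (simp only: collect_formal v w)
    apply (rule arg_cong[of _ _ formal], rule poly_mapping_eqI)
    apply (simp add: lookup_add lookup_single_ind)
    apply (simp add: c(1) divide_simps)
    apply (unfold d_def)
    apply Groebner_Basis.algebra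
    done
qed

lemma coaction_sums_left:
  assumes v: "\<And>x. v x \<in> carrier W" and w: "w \<in> carrier V" "w' \<in> carrier V"
  defines "r x \<equiv> up_coeff x t \<odot>\<^bsub>V\<^esub> w \<oplus>\<^bsub>V\<^esub> down_coeff x t \<odot>\<^bsub>V\<^esub> w'"
  defines "D x \<equiv> pt (r (left_leg1 x)) (v (right_leg1 x)) \<oplus>\<^bsub>T\<^esub> pt (r (left_leg2 x)) (v (right_leg2 x))"
  shows "gen_sum T (\<lambda>x. up_coeff x t) D = pt w (gen_sum W (\<lambda>x. up_coeff x t) v)"
    and "gen_sum T (\<lambda>x. down_coeff x t) D = pt w' (gen_sum W (\<lambda>x. down_coeff x t) v)"
proof -
  define d :: complex where "d = 1 + (complex_of_real t)\<^sup>2"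
  note c = up_down_complex[of t, folded d_def]
  show "gen_sum T (\<lambda>x. up_coeff x t) D = pt w (gen_sum W (\<lambda>x. up_coeff x t) v)"
    unfolding gen_sum_def D_def r_def left_leg1.simps left_leg2.simps right_leg1.simps right_leg2.simps c(2-)
    apply (simp only: expand_pure v w V.scale_closed W.scale_closed V.a_closed W.a_closed)
    apply (simp only: collect_formal v w)
    apply (rule arg_cong[of _ _ formal], rule poly_mapping_eqI)
    apply (simp add: lookup_add lookup_single_ind)
    apply (simp add: c(1) divide_simps)
    apply (unfold d_def)
    apply Groebner_Basis.algebra
    done
  show "gen_sum T (\<lambda>x. down_coeff x t) D = pt w' (gen_sum W (\<lambda>x. down_coeff x t) v)"
    unfolding gen_sum_def D_def r_def left_leg1.simps left_leg2.simps right_leg1.simps right_leg2.simps c(2-)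
    apply (simp only: expand_pure v w V.scale_closed W.scale_closed V.a_closed W.a_closed)
    apply (simp only: collect_formal v w)
    apply (rule arg_cong[of _ _ formal], rule poly_mapping_eqI)
    apply (simp add: lookup_add lookup_single_ind)
    apply (simp add: c(1) divide_simps)
    apply (unfold d_def)
    apply Groebner_Basis.algebra
    done
qed

text \<open>If both legs are acted on in this way, the mixed terms cancel: the product of two complementary
  projections is zero.\<close>

lemma coaction_diagonal:
  assumes v: "v \<in> carrier V" "v' \<in> carrier V" and w: "w \<in> carrier W" "w' \<in> carrier W"
  defines "l x \<equiv> up_coeff x t \<odot>\<^bsub>V\<^esub> v \<oplus>\<^bsub>V\<^esub> down_coeff x t \<odot>\<^bsub>V\<^esub> v'"
  defines "r x \<equiv> up_coeff x t \<odot>\<^bsub>W\<^esub> w \<oplus>\<^bsub>W\<^esub> down_coeff x t \<odot>\<^bsub>W\<^esub> w'"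
  shows "pt (l (left_leg1 x)) (r (right_leg1 x)) \<oplus>\<^bsub>T\<^esub> pt (l (left_leg2 x)) (r (right_leg2 x)) =
    up_coeff x t \<odot>\<^bsub>T\<^esub> pt v w \<oplus>\<^bsub>T\<^esub> down_coeff x t \<odot>\<^bsub>T\<^esub> pt v' w'"
proof -
  define d :: complex where "d = 1 + (complex_of_real t)\<^sup>2"
  note c = up_down_complex[of t, folded d_def]
  show ?thesis
    unfolding l_def r_def
    apply (induct x; simp only: left_leg1.simps left_leg2.simps right_leg1.simps right_leg2.simps c(2-))
       apply (simp_all only: expand_pure v w V.scale_closed W.scale_closed V.a_closed W.a_closed)
       apply (simp_all only: collect_formal v w)
       apply (rule_tac [!] arg_cong[of _ _ formal], rule_tac [!] poly_mapping_eqI)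
       apply (simp_all add: lookup_add lookup_single_ind)
       apply (simp_all add: c(1) divide_simps)
       apply (unfold d_def)
       apply Groebner_Basis.algebra+
    done
qed

end

end

context quantum_group
begin

lemma comult_gen_legs:
  "comult_gen q x = P (generator (left_leg1 x)) (generator (right_leg1 x)) \<oplus>\<^bsub>T\<^esub>
    P (generator (left_leg2 x)) (generator (right_leg2 x))"
  by (cases x) simp_all

definition right_module_map where
  "right_module_map V p \<rho> \<longleftrightarrow> cspace V \<and> p \<in> linear_maps A V \<and>
    (\<forall>x. \<rho> x \<in> linear_maps V V) \<and> (\<forall>x. \<forall>a\<in>carrier A. p (a \<otimes>\<^bsub>A\<^esub> cls q (generator x)) = \<rho> x (p a))"

text \<open>Right multiplication in the tensor square of the quantum group descends along right module maps.\<close>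

lemma comult_step:
  assumes "right_module_map V p \<rho>" "right_module_map W p' \<rho>'"
  defines "f \<equiv> tensor_map V W p p'"
  shows "f (\<Delta> (y * generator x)) =
    tensor_map V W (\<rho> (left_leg1 x)) (\<rho>' (right_leg1 x)) (f (\<Delta> y)) \<oplus>\<^bsub>tensor V W\<^esub>
    tensor_map V W (\<rho> (left_leg2 x)) (\<rho>' (right_leg2 x)) (f (\<Delta> y))"
proof -
  have V: "cspace V" "p \<in> linear_maps A V" "\<And>x. \<rho> x \<in> linear_maps V V"
    "\<And>x a. a \<in> carrier A \<Longrightarrow> p (a \<otimes>\<^bsub>A\<^esub> cls q (generator x)) = \<rho> x (p a)"
    using assms(1) by (auto simp: right_module_map_def)
  have W: "cspace W" "p' \<in> linear_maps A W" "\<And>x. \<rho>' x \<in> linear_maps W W"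
    "\<And>x a. a \<in> carrier A \<Longrightarrow> p' (a \<otimes>\<^bsub>A\<^esub> cls q (generator x)) = \<rho>' x (p' a)"
    using assms(2) by (auto simp: right_module_map_def)
  interpret VW: tensor_product V W
    using V W by (intro tensor_productI)
  note f = tensor_map[OF A.cspace_axioms A.cspace_axioms V(1) W(1) V(2) W(2), folded f_def]
  have one: "f (X \<otimes>\<^bsub>TA\<^esub> P (generator u) (generator u')) = tensor_map V W (\<rho> u) (\<rho>' u') (f X)"
    if X: "X \<in> carrier T" for X u u'
  proof (rule AA.tensor_ext[OF VW.T.cspace_axioms _ _ _ X])
    note m = tensor_map[OF V(1) W(1) V(1) W(1) V(3)[of u] W(3)[of u']]
    show "(\<lambda>X. f (X \<otimes>\<^bsub>TA\<^esub> P (generator u) (generator u'))) \<in> linear_maps T (tensor V W)"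
      by (rule linear_comp[OF AA.TA_mult_linear_left f(1)]) simp
    show "(\<lambda>X. tensor_map V W (\<rho> u) (\<rho>' u') (f X)) \<in> linear_maps T (tensor V W)"
      by (rule linear_comp[OF f(1) m(1)])
    fix a b assume ab: "a \<in> carrier A" "b \<in> carrier A"
    show "f (pure_tensor A A a b \<otimes>\<^bsub>TA\<^esub> P (generator u) (generator u')) =
      tensor_map V W (\<rho> u) (\<rho>' u') (f (pure_tensor A A a b))"
      using ab linear_closed[OF V(2) ab(1)] linear_closed[OF W(2) ab(2)]
      by (simp add: AA.pure_mult f(2) m(2) V(4) W(4))
  qed
  have d: "\<Delta> (y * generator x) =
    \<Delta> y \<otimes>\<^bsub>TA\<^esub> P (generator (left_leg1 x)) (generator (right_leg1 x)) \<oplus>\<^bsub>T\<^esub>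
    \<Delta> y \<otimes>\<^bsub>TA\<^esub> P (generator (left_leg2 x)) (generator (right_leg2 x))"
    unfolding Delta_mult Delta_gen comult_gen_legs[of x]
    by (rule linear_add[OF AA.TA_mult_linear_right]) simp_all
  have c: "\<Delta> y \<otimes>\<^bsub>TA\<^esub> P (generator u) (generator u') \<in> carrier T" for u u'
    by (rule AA.TA_mult_closed) simp_all
  show ?thesis
    unfolding d linear_add[OF f(1) c c] one[OF Delta_closed] ..
qed

end

context quantum_sphere
begin

interpretation CC: tensor_product C C
  by (rule tensor_productI[OF C.cspace_axioms C.cspace_axioms])

interpretation AC: tensor_product A C
  by (rule tensor_productI[OF A.cspace_axioms C.cspace_axioms])

interpretation CA: tensor_product C A
  by (rule tensor_productI[OF C.cspace_axioms A.cspace_axioms])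

lemma right_module_map_id:
  "right_module_map A (\<lambda>a. a) (\<lambda>x a. a \<otimes>\<^bsub>A\<^esub> cls q (generator x))"
  by (simp add: right_module_map_def A.cspace_axioms linear_id A.mult_linear_left)

lemma right_module_map_proj: "right_module_map C (proj q s) (\<lambda>x. ract (generator x))"
proof -
  have "proj q s (a \<otimes>\<^bsub>A\<^esub> cls q (generator x)) = ract (generator x) (proj q s a)"
    if a: "a \<in> carrier A" for a x
  proof -
    obtain p where p: "a = cls q p" using a by (rule clsE)
    show ?thesis
      using ract_pi[of "generator x" p] unfolding p cls_mult[symmetric] \<pi>_def by simp
  qed
  then show ?thesis
    by (simp add: right_module_map_def C.cspace_axioms proj_linear ract_linear)
qed

definition diag where
  "diag c = lin_ext (tensor C C) (\<lambda>n. pure_tensor C C (g n) (g n)) (\<theta> c)"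

lemma diag_linear: "diag \<in> linear_maps C (tensor C C)"
  unfolding diag_def[abs_def] by (rule C_lift[OF CC.T.cspace_axioms]) auto

lemma diag_g: "diag (g n) = pure_tensor C C (g n) (g n)"
  unfolding diag_def by (rule C_lift[OF CC.T.cspace_axioms]) auto

definition proj2 where "proj2 = tensor_map C C (proj q s) (proj q s)"

lemmas proj2 = tensor_map[OF A.cspace_axioms A.cspace_axioms C.cspace_axioms C.cspace_axioms
    proj_linear proj_linear, folded proj2_def]

lemma diag_ract:
  assumes c: "c \<in> carrier C"
  shows "diag (ract (generator x) c) =
    tensor_map C C (ract (generator (left_leg1 x))) (ract (generator (right_leg1 x))) (diag c)
      \<oplus>\<^bsub>tensor C C\<^esub>
    tensor_map C C (ract (generator (left_leg2 x))) (ract (generator (right_leg2 x))) (diag c)"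
proof (rule C_ext[OF CC.T.cspace_axioms _ _ _ c])
  note m = tensor_map[OF C.cspace_axioms C.cspace_axioms C.cspace_axioms C.cspace_axioms
      ract_linear ract_linear]
  show "(\<lambda>c. diag (ract (generator x) c)) \<in> linear_maps C (tensor C C)"
    by (rule linear_comp[OF ract_linear diag_linear])
  show "(\<lambda>c. tensor_map C C (ract (generator (left_leg1 x))) (ract (generator (right_leg1 x))) (diag c)
      \<oplus>\<^bsub>tensor C C\<^esub>
    tensor_map C C (ract (generator (left_leg2 x))) (ract (generator (right_leg2 x))) (diag c))
    \<in> linear_maps C (tensor C C)"
    by (intro linear_maps_add[OF CC.T.cspace_axioms] linear_comp[OF diag_linear m(1)])
  fix n
  have "diag (ract (generator x) (g n)) =
    up_coeff x (\<tau> n) \<odot>\<^bsub>tensor C C\<^esub> pure_tensor C C (g (n + 1)) (g (n + 1)) \<oplus>\<^bsub>tensor C C\<^esub>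
    down_coeff x (\<tau> n) \<odot>\<^bsub>tensor C C\<^esub> pure_tensor C C (g (n - 1)) (g (n - 1))"
    unfolding ract_g by (simp add: linear_add[OF diag_linear] linear_scale[OF diag_linear] diag_g)
  then show "diag (ract (generator x) (g n)) =
    tensor_map C C (ract (generator (left_leg1 x))) (ract (generator (right_leg1 x))) (diag (g n))
      \<oplus>\<^bsub>tensor C C\<^esub>
    tensor_map C C (ract (generator (left_leg2 x))) (ract (generator (right_leg2 x))) (diag (g n))"
    unfolding diag_g m(2)[OF g_closed g_closed] ract_g
    by (subst CC.coaction_diagonal) simp_all
qed

text \<open>In particular the left-hand side depends only on the class of \<open>p\<close>, that is, \<open>J\<close> is a
  coideal.\<close>

lemma proj2_Delta: "proj2 (\<Delta> p) = diag (\<pi> p)"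
proof (rule CC.T.free_alg_ext[of "\<lambda>p. proj2 (\<Delta> p)" "\<lambda>p. diag (\<pi> p)"])
  show "(\<lambda>p. proj2 (\<Delta> p)) \<in> linear_maps free_alg (tensor C C)"
    by (rule linear_comp[OF Delta_linear proj2(1)])
  show "(\<lambda>p. diag (\<pi> p)) \<in> linear_maps free_alg (tensor C C)"
    by (rule linear_comp[OF pi_linear diag_linear])
  have "proj2 (\<Delta> (Poly_Mapping.single (Word xs) 1)) = diag (\<pi> (Poly_Mapping.single (Word xs) 1))" for xs
  proof (induction xs rule: rev_induct)
    case Nil
    have one: "Poly_Mapping.single (Word []) 1 = (1 :: free)"
      unfolding zero_word_def[symmetric] by (rule single_one)
    have "diag (\<pi> 1) = pure_tensor C C (\<pi> 1) (\<pi> 1)"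
      using diag_g[of 0] by (simp add: g_def G_0)
    then show ?case
      unfolding one Delta_one by (simp add: proj2(2) \<pi>_def)
  next
    case (snoc x xs)
    show ?case
      unfolding word_snoc ract_pi[symmetric] diag_ract[OF pi_closed] snoc.IH[symmetric]
      unfolding proj2_def by (rule comult_step[OF right_module_map_proj right_module_map_proj])
  qed
  then show "proj2 (\<Delta> (Poly_Mapping.single w 1)) = diag (\<pi> (Poly_Mapping.single w 1))" for w
    by (metis word.exhaust)
qed

lemma comult_C_eq:
  assumes c: "c \<in> carrier C"
  shows "comult_C q s c = diag c"
proof -
  have lin: "(\<lambda>a. proj2 (comult q a)) \<in> linear_maps A (tensor C C)"
    by (rule linear_comp[OF comult_linear proj2(1)])
  have zero: "proj2 (comult q x) = \<zero>\<^bsub>tensor C C\<^esub>" if "x \<in> J" for x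
  proof -
    have "x \<in> carrier A" using that J_subset by blast
    then obtain p where p: "x = cls q p" by (rule clsE)
    have "\<pi> p = \<pi> 0"
      using that unfolding p by (simp only: pi_eq_iff K_def diff_zero mem_Collect_eq)
    also have "\<dots> = \<zero>\<^bsub>C\<^esub>"
      using linear_zero[OF free_alg_calgebra[THEN calgebra.axioms(1)] C.cspace_axioms pi_linear] by simp
    finally show ?thesis
      unfolding p comult_cls proj2_Delta
      using linear_zero[OF C.cspace_axioms CC.T.cspace_axioms diag_linear] by simp
  qed
  obtain p where p: "c = \<pi> p" using c by (rule piE)
  have "comult_C q s c = proj2 (comult q (cls q p))"
    unfolding comult_C_def p \<pi>_def proj_def proj2_def[symmetric]
    by (rule J.quot_lift(2)[OF CC.T.cspace_axioms lin zero]) simp_all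
  then show ?thesis
    by (simp add: comult_cls proj2_Delta p)
qed

subsection \<open>The splitting map\<close>

text \<open>The factors in the definition of \<open>i\<close> have this form with the projections as coefficients.\<close>

definition lin_gen :: "(gen \<Rightarrow> real) \<Rightarrow> free" where
  "lin_gen c = c Gen_alpha \<cdot> \<alpha> + c Gen_beta \<cdot> \<beta> + c Gen_gamma \<cdot> \<gamma> + c Gen_delta \<cdot> \<delta>"

text \<open>Representatives of \<open>i(g\<^sub>n)\<close>, indexed by all integers.\<close>

definition H :: "int \<Rightarrow> free" where
  "H n = (if n \<ge> 0 then \<Prod>k\<leftarrow>[0..<nat n]. lin_gen (\<lambda>x. up_coeff x (\<tau> (int k)))
    else \<Prod>k\<leftarrow>[0..<nat (- n)]. lin_gen (\<lambda>x. down_coeff x (\<tau> (- int k))))"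

lemma H_0: "H 0 = 1"
  by (simp add: H_def)

lemma H_up: "n \<ge> 0 \<Longrightarrow> H (n + 1) = H n * lin_gen (\<lambda>x. up_coeff x (\<tau> n))"
proof -
  assume n: "n \<ge> 0"
  define m where "m = nat n"
  have m: "n = int m" "nat (int m + 1) = Suc m" "nat (1 + int m) = Suc m"
    using n by (simp_all add: m_def)
  show ?thesis
    by (simp add: H_def m)
qed

lemma H_down: "n \<le> 0 \<Longrightarrow> H (n - 1) = H n * lin_gen (\<lambda>x. down_coeff x (\<tau> n))"
proof -
  assume n: "n \<le> 0"
  define m where "m = nat (- n)"
  have m: "n = - int m" "nat (1 - n) = Suc m" "nat (1 + int m) = Suc m"
    using n by (simp_all add: m_def nat_diff_distrib)
  show ?thesis
    by (cases "m = 0") (simp_all add: H_def m)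
qed

lemma H_induct [case_names zero up down]:
  assumes "R 0 1" "\<And>n. \<lbrakk>n \<ge> 0; R n (H n)\<rbrakk> \<Longrightarrow> R (n + 1) (H n * lin_gen (\<lambda>x. up_coeff x (\<tau> n)))"
    "\<And>n. \<lbrakk>n \<le> 0; R n (H n)\<rbrakk> \<Longrightarrow> R (n - 1) (H n * lin_gen (\<lambda>x. down_coeff x (\<tau> n)))"
  shows "R n (H n)"
proof (induction n rule: int_induct[where k = 0])
  case base
  then show ?case using assms(1) by (simp add: H_0)
next
  case (step1 n)
  then show ?case using assms(2)[of n] by (simp only: H_up)
next
  case (step2 n)
  then show ?case using assms(3)[of n] by (simp only: H_down)
qed

lemma i_plus_eq: "i_plus q s n = cls q (H (int n))"
proof -
  have "(1 / (1 + q ^ (2 * k) * s\<^sup>2)) \<cdot>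
     (\<alpha> + (q ^ k * s) \<cdot> (\<beta> + \<gamma>) + (q ^ (2 * k) * s\<^sup>2) \<cdot> \<delta>) = lin_gen (\<lambda>x. up_coeff x (\<tau> (int k)))" for k
  proof -
    have t: "\<tau> (int k) = q ^ k * s" "q ^ (2 * k) * s\<^sup>2 = (q ^ k * s)\<^sup>2"
      by (simp_all add: \<tau>_def power_mult_distrib power_mult[symmetric] mult.commute)
    show ?thesis
      unfolding t lin_gen_def
      by (rule poly_mapping_eqI) (simp add: pm_scale_distrib lookup_add lookup_single_ind algebra_simps)
  qed
  then show ?thesis
    by (simp only: i_plus_def H_def of_nat_0_le_iff if_True nat_int)
qed

lemma i_minus_eq:
  assumes "n \<ge> 1"
  shows "i_minus q s n = cls q (H (- int n))"
proof -
  have "(1 / (1 + inverse q ^ (2 * k) * s\<^sup>2)) \<cdot>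
     (\<delta> - (inverse q ^ k * s) \<cdot> (\<beta> + \<gamma>) + (inverse q ^ (2 * k) * s\<^sup>2) \<cdot> \<alpha>) =
     lin_gen (\<lambda>x. down_coeff x (\<tau> (- int k)))" for k
  proof -
    have t: "\<tau> (- int k) = inverse q ^ k * s" "inverse q ^ (2 * k) * s\<^sup>2 = (inverse q ^ k * s)\<^sup>2"
      by (simp_all add: \<tau>_def power_int_minus power_inverse power_mult_distrib power_mult[symmetric] mult.commute)
    show ?thesis
      unfolding t lin_gen_def
      by (rule poly_mapping_eqI)
        (simp add: pm_scale_distrib lookup_add lookup_minus lookup_single_ind algebra_simps)
  qed
  moreover have "\<not> 0 \<le> - int n" "nat (- (- int n)) = n"
    using assms by simp_all
  ultimately show ?thesis
    by (simp only: i_minus_def H_def if_False)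
qed

lemma g_plus_eq: "g_plus q s n = g (int n)"
  by (simp add: g_plus_def g_def \<pi>_def G_def)

lemma g_minus_eq: "n \<ge> 1 \<Longrightarrow> g_minus q s n = g (- int n)"
  by (simp add: g_minus_def g_def \<pi>_def G_def)

lemma linear_lin_gen:
  assumes "f \<in> linear_maps free_alg V"
  shows "f (y * lin_gen c) = gen_sum V c (\<lambda>x. f (y * generator x))"
  unfolding lin_gen_def gen_sum_def distrib_left pm_scale_mult
  using linear_add[OF assms] linear_scale[OF assms] by simp

lemma gen_sum_ract:
  "gen_sum C (\<lambda>x. up_coeff x (\<tau> n)) (\<lambda>x. ract (generator x) (g n)) = g (n + 1)"
  "gen_sum C (\<lambda>x. down_coeff x (\<tau> n)) (\<lambda>x. ract (generator x) (g n)) = g (n - 1)"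
proof -
  define t where "t = \<tau> n"
  define d :: complex where "d = 1 + (complex_of_real t)\<^sup>2"
  note c = up_down_complex[of t, folded d_def]
  show "gen_sum C (\<lambda>x. up_coeff x (\<tau> n)) (\<lambda>x. ract (generator x) (g n)) = g (n + 1)"
    unfolding gen_sum_def ract_g
    unfolding g_def pi_scale[symmetric] pi_add[symmetric] t_def[symmetric] c(2-)
    apply (rule arg_cong[of _ _ \<pi>], rule poly_mapping_eqI)
    apply (simp add: lookup_add)
    apply (simp add: c(1) divide_simps)
    apply (unfold d_def)
    apply Groebner_Basis.algebra
    done
  show "gen_sum C (\<lambda>x. down_coeff x (\<tau> n)) (\<lambda>x. ract (generator x) (g n)) = g (n - 1)"
    unfolding gen_sum_def ract_g
    unfolding g_def pi_scale[symmetric] pi_add[symmetric] t_def[symmetric] c(2-)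
    apply (rule arg_cong[of _ _ \<pi>], rule poly_mapping_eqI)
    apply (simp add: lookup_add)
    apply (simp add: c(1) divide_simps)
    apply (unfold d_def)
    apply Groebner_Basis.algebra
    done
qed

lemma pi_H: "\<pi> (H n) = g n"
proof (induction n rule: H_induct)
  case zero
  then show ?case by (simp add: g_def G_0)
next
  case (up n)
  show ?case
    unfolding linear_lin_gen[OF pi_linear]
    unfolding ract_pi[symmetric] up(2)
    by (rule gen_sum_ract)
next
  case (down n)
  show ?case
    unfolding linear_lin_gen[OF pi_linear]
    unfolding ract_pi[symmetric] down(2)
    by (rule gen_sum_ract)
qed

definition right_proj where "right_proj = tensor_map A C (\<lambda>a. a) (proj q s)"
definition left_proj where "left_proj = tensor_map C A (proj q s) (\<lambda>a. a)"

lemmas right_proj = tensor_map[OF A.cspace_axioms A.cspace_axioms A.cspace_axioms C.cspace_axioms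
    linear_id proj_linear, folded right_proj_def]
lemmas left_proj = tensor_map[OF A.cspace_axioms A.cspace_axioms C.cspace_axioms A.cspace_axioms
    proj_linear linear_id, folded left_proj_def]

lemma right_proj_step:
  assumes "right_proj (\<Delta> y) = pure_tensor A C (cls q y) (g n)"
  shows "right_proj (\<Delta> (y * generator x)) =
    pure_tensor A C (cls q (y * generator (left_leg1 x))) (ract (generator (right_leg1 x)) (g n))
      \<oplus>\<^bsub>tensor A C\<^esub>
    pure_tensor A C (cls q (y * generator (left_leg2 x))) (ract (generator (right_leg2 x)) (g n))"
  unfolding right_proj_def comult_step[OF right_module_map_id right_module_map_proj]
  unfolding right_proj_def[symmetric] assms cls_mult
  by (simp add: tensor_map[OF A.cspace_axioms C.cspace_axioms A.cspace_axioms C.cspace_axioms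
      A.mult_linear_left[OF cls_closed] ract_linear])

lemma left_proj_step:
  assumes "left_proj (\<Delta> y) = pure_tensor C A (g n) (cls q y)"
  shows "left_proj (\<Delta> (y * generator x)) =
    pure_tensor C A (ract (generator (left_leg1 x)) (g n)) (cls q (y * generator (right_leg1 x)))
      \<oplus>\<^bsub>tensor C A\<^esub>
    pure_tensor C A (ract (generator (left_leg2 x)) (g n)) (cls q (y * generator (right_leg2 x)))"
  unfolding left_proj_def comult_step[OF right_module_map_proj right_module_map_id]
  unfolding left_proj_def[symmetric] assms cls_mult
  by (simp add: tensor_map[OF C.cspace_axioms A.cspace_axioms C.cspace_axioms A.cspace_axioms
      ract_linear A.mult_linear_left[OF cls_closed]])

lemma right_proj_linear: "(\<lambda>p. right_proj (\<Delta> p)) \<in> linear_maps free_alg (tensor A C)"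
  by (rule linear_comp[OF Delta_linear right_proj(1)])

lemma left_proj_linear: "(\<lambda>p. left_proj (\<Delta> p)) \<in> linear_maps free_alg (tensor C A)"
  by (rule linear_comp[OF Delta_linear left_proj(1)])

lemma right_covariant: "right_proj (\<Delta> (H n)) = pure_tensor A C (cls q (H n)) (g n)"
proof (induction n rule: H_induct)
  case zero
  then show ?case
    unfolding Delta_one by (simp add: right_proj g_def G_0 \<pi>_def)
next
  case (up n)
  show ?case
    unfolding linear_lin_gen[OF right_proj_linear] right_proj_step[OF up(2)]
      linear_lin_gen[OF cls_linear] ract_g
    by (rule AC.coaction_sums_right(1)) simp_all
next
  case (down n)
  show ?case
    unfolding linear_lin_gen[OF right_proj_linear] right_proj_step[OF down(2)]
      linear_lin_gen[OF cls_linear] ract_g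
    by (rule AC.coaction_sums_right(2)) simp_all
qed

lemma left_covariant: "left_proj (\<Delta> (H n)) = pure_tensor C A (g n) (cls q (H n))"
proof (induction n rule: H_induct)
  case zero
  then show ?case
    unfolding Delta_one by (simp add: left_proj g_def G_0 \<pi>_def)
next
  case (up n)
  show ?case
    unfolding linear_lin_gen[OF left_proj_linear] left_proj_step[OF up(2)]
      linear_lin_gen[OF cls_linear] ract_g
    by (rule CA.coaction_sums_left(1)) simp_all
next
  case (down n)
  show ?case
    unfolding linear_lin_gen[OF left_proj_linear] left_proj_step[OF down(2)]
      linear_lin_gen[OF cls_linear] ract_g
    by (rule CA.coaction_sums_left(2)) simp_all
qed

definition \<iota> where "\<iota> c = lin_ext A (\<lambda>n. cls q (H n)) (\<theta> c)"

lemma iota_linear: "\<iota> \<in> linear_maps C A"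
  unfolding \<iota>_def[abs_def] by (rule C_lift[OF A.cspace_axioms]) simp

lemma iota_g: "\<iota> (g n) = cls q (H n)"
  unfolding \<iota>_def by (rule C_lift[OF A.cspace_axioms]) simp

lemma proj_one: "proj q s \<one>\<^bsub>A\<^esub> = g 0"
  by (simp add: g_def G_0 \<pi>_def cls_one)

text \<open>The conditions on \<open>i\<close> at \<open>\<pi>(1)\<close>, \<open>g\<^sup>+\<^sub>n\<close> and \<open>g\<^sup>-\<^sub>n\<close> are the cases \<open>0\<close>, \<open>n\<close> and \<open>- n\<close> of one
  condition over the integers.\<close>

lemma splitting_map_iff:
  "is_splitting_map q s i \<longleftrightarrow> i \<in> linear_maps C A \<and> (\<forall>n. i (g n) = cls q (H n))"
proof -
  have "(\<forall>n. i (g n) = cls q (H n)) \<longleftrightarrow> i (g 0) = \<one>\<^bsub>A\<^esub> \<and>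
    (\<forall>n\<ge>1. i (g (int n)) = cls q (H (int n)) \<and> i (g (- int n)) = cls q (H (- int n)))"
    (is "?L \<longleftrightarrow> ?R")
  proof
    assume ?L
    then show ?R by (simp add: H_0 cls_one)
  next
    assume R: ?R
    show ?L
    proof
      fix n :: int
      consider "n = 0" | "n = int (nat n)" "nat n \<ge> 1" | "n = - int (nat (- n))" "nat (- n) \<ge> 1"
        by linarith
      then show "i (g n) = cls q (H n)"
      proof cases
        case 1
        then show ?thesis using R by (simp add: H_0 cls_one)
      next
        case 2
        from R 2(2) have "i (g (int (nat n))) = cls q (H (int (nat n)))" by blast
        then show ?thesis using 2(1) by simp
      next
        case 3
        from R 3(2) have "i (g (- int (nat (- n)))) = cls q (H (- int (nat (- n))))" by blast
        then show ?thesis using 3(1) by simp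
      qed
    qed
  qed
  then show ?thesis
    unfolding is_splitting_map_def proj_one by (auto simp: g_plus_eq g_minus_eq i_plus_eq i_minus_eq)
qed

theorem bicovariant_splitting:
  "\<exists>i. is_splitting_map q s i \<and>
    (\<forall>i'. is_splitting_map q s i' \<longrightarrow> (\<forall>c\<in>carrier C. i' c = i c)) \<and>
    (\<forall>c\<in>carrier C.
      proj q s (i c) = c \<and>
      tensor_map A C (\<lambda>a. a) (proj q s) (comult q (i c)) =
        tensor_map A C i (\<lambda>x. x) (comult_C q s c) \<and>
      tensor_map C A (proj q s) (\<lambda>a. a) (comult q (i c)) =
        tensor_map C A (\<lambda>x. x) i (comult_C q s c))"
proof (intro exI[of _ \<iota>] conjI allI impI ballI)
  show "is_splitting_map q s \<iota>"
    by (simp add: splitting_map_iff iota_linear iota_g)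
next
  fix i' c assume "is_splitting_map q s i'" and c: "c \<in> carrier C"
  then have i': "i' \<in> linear_maps C A" "\<And>n. i' (g n) = cls q (H n)"
    unfolding splitting_map_iff by blast+
  show "i' c = \<iota> c"
    by (rule C_ext[OF A.cspace_axioms i'(1) iota_linear _ c]) (simp only: i'(2) iota_g)
next
  fix c assume c: "c \<in> carrier C"
  show "proj q s (\<iota> c) = c"
  proof (rule C_ext[OF C.cspace_axioms _ linear_id _ c])
    show "(\<lambda>c. proj q s (\<iota> c)) \<in> linear_maps C C"
      by (rule linear_comp[OF iota_linear proj_linear])
    show "proj q s (\<iota> (g n)) = g n" for n
      using pi_H[of n] by (simp add: iota_g \<pi>_def)
  qed
  note r = tensor_map[OF C.cspace_axioms C.cspace_axioms A.cspace_axioms C.cspace_axioms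
      iota_linear linear_id]
  note l = tensor_map[OF C.cspace_axioms C.cspace_axioms C.cspace_axioms A.cspace_axioms
      linear_id iota_linear]
  have "right_proj (comult q (\<iota> c)) = tensor_map A C \<iota> (\<lambda>x. x) (diag c)"
  proof (rule C_ext[OF AC.T.cspace_axioms _ _ _ c])
    show "(\<lambda>c. right_proj (comult q (\<iota> c))) \<in> linear_maps C (tensor A C)"
      by (rule linear_comp[OF linear_comp[OF iota_linear comult_linear] right_proj(1)])
    show "(\<lambda>c. tensor_map A C \<iota> (\<lambda>x. x) (diag c)) \<in> linear_maps C (tensor A C)"
      by (rule linear_comp[OF diag_linear r(1)])
    show "right_proj (comult q (\<iota> (g n))) = tensor_map A C \<iota> (\<lambda>x. x) (diag (g n))" for n
      by (simp add: iota_g comult_cls right_covariant diag_g r(2))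
  qed
  then show "tensor_map A C (\<lambda>a. a) (proj q s) (comult q (\<iota> c)) =
      tensor_map A C \<iota> (\<lambda>x. x) (comult_C q s c)"
    by (simp only: right_proj_def comult_C_eq[OF c])
  have "left_proj (comult q (\<iota> c)) = tensor_map C A (\<lambda>x. x) \<iota> (diag c)"
  proof (rule C_ext[OF CA.T.cspace_axioms _ _ _ c])
    show "(\<lambda>c. left_proj (comult q (\<iota> c))) \<in> linear_maps C (tensor C A)"
      by (rule linear_comp[OF linear_comp[OF iota_linear comult_linear] left_proj(1)])
    show "(\<lambda>c. tensor_map C A (\<lambda>x. x) \<iota> (diag c)) \<in> linear_maps C (tensor C A)"
      by (rule linear_comp[OF diag_linear l(1)])
    show "left_proj (comult q (\<iota> (g n))) = tensor_map C A (\<lambda>x. x) \<iota> (diag (g n))" for n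
      by (simp add: iota_g comult_cls left_covariant diag_g l(2))
  qed
  then show "tensor_map C A (proj q s) (\<lambda>a. a) (comult q (\<iota> c)) =
      tensor_map C A (\<lambda>x. x) \<iota> (comult_C q s c)"
    by (simp only: left_proj_def comult_C_eq[OF c])
qed

end

theorem proposition6p3:
  fixes q s :: real
  assumes "q \<noteq> 0" and "0 \<le> s" and "s \<le> 1"
  shows "\<exists>i. is_splitting_map q s i \<and>
    (\<forall>i'. is_splitting_map q s i' \<longrightarrow> (\<forall>c\<in>carrier (sphere_C q s). i' c = i c)) \<and>
    (\<forall>c\<in>carrier (sphere_C q s).
      proj q s (i c) = c \<and>
      tensor_map (SUq2 q) (sphere_C q s) (\<lambda>a. a) (proj q s) (comult q (i c)) =
        tensor_map (SUq2 q) (sphere_C q s) i (\<lambda>x. x) (comult_C q s c) \<and>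
      tensor_map (sphere_C q s) (SUq2 q) (proj q s) (\<lambda>a. a) (comult q (i c)) =
        tensor_map (sphere_C q s) (SUq2 q) (\<lambda>x. x) i (comult_C q s c))"
proof -
  interpret quantum_sphere q s
    by unfold_locales fact
  show ?thesis
    by (rule bicovariant_splitting)
qed

end
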